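(* Let $p>5$ be a prime, and let $\varepsilon_p=1,-1,0$ according as $p\equiv\pm1$, $\pm2$ or $\pm4\pmod 9$. (i) If $p\equiv1,4\pmod{15}$, so that $p=x^2+15y^2$ with $x,y\in\mathbb Z$, then $$2\sum_{k=0}^{[p/6]}\frac{\binom{6k}{2k}}{27^{2k}}-\varepsilon_p\equiv\sum_{k=0}^{[p/3]}\frac{\binom{3k}k}{(-27)^k}\equiv\begin{cases}1\pmod p&\text{if }3\mid y,\\ (x-5y)/(10y)\pmod p&\text{if }3\mid y-x.\end{cases}$$ (ii) If $p\equiv2,8\pmod{15}$, so that $p=5x^2+3y^2$ with $x,y\in\mathbb Z$, then $$2\sum_{k=0}^{[p/6]}\frac{\binom{6k}{2k}}{27^{2k}}-\varepsilon_p\equiv\sum_{k=0}^{[p/3]}\frac{\binom{3k}k}{(-27)^k}\equiv\begin{cases}1\pmod p&\text{if }3\mid y,\\ -(x+y)/(2y)\pmod p&\text{if }3\mid y-x.\end{cases}$$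
   Context: $[x]$ is the greatest integer not exceeding $x$. Quotients are interpreted modulo $p$. *)

theory Defs
  imports "HOL-Number_Theory.Number_Theory" "HOL-Number_Theory.Modular_Inverse"
begin

text \<open>
  The quotient \<open>a / b\<close> modulo \<open>p\<close>. It is meaningful only if \<open>b\<close> is coprime to \<open>p\<close>;
  the lemmas below confirm this for every denominator to which it is applied.
\<close>

definition quot_mod :: "nat \<Rightarrow> int \<Rightarrow> int \<Rightarrow> int" where
  "quot_mod p a b = a * modular_inverse (int p) b"

text \<open>The last case is \<open>p \<equiv> \<plusminus>4 (mod 9)\<close>, since the argument will be a prime greater than 5.\<close>

definition eps :: "nat \<Rightarrow> int" where
  "eps p =
     (if [int p = 1] (mod 9) \<or> [int p = - 1] (mod 9) then 1
      else if [int p = 2] (mod 9) \<or> [int p = - 2] (mod 9) then - 1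
      else 0)"

lemma eps_last_case:
  assumes "prime p" "p > 5"
    and "\<not> ([int p = 1] (mod 9) \<or> [int p = - 1] (mod 9))"
    and "\<not> ([int p = 2] (mod 9) \<or> [int p = - 2] (mod 9))"
  shows "[int p = 4] (mod 9) \<or> [int p = - 4] (mod 9)"
proof -
  have "\<not> 3 dvd p"
    using assms(1,2) primes_dvd_imp_eq[of 3 p] by auto
  then have "\<not> 3 dvd int p"
    by presburger
  then have *: "\<not> 3 dvd int p mod 9"
    by (simp add: dvd_mod_iff)
  have "int p mod 9 \<in> {0..<9}"
    by simp
  also have "{0..<9} = {0, 1, 2, 3, 4, 5, 6, 7, 8 :: int}"
    by auto
  finally show ?thesis
    using * assms(3,4) unfolding cong_def by auto
qed

lemma coprime_small:
  assumes "prime p" "p > 5" "c \<in> {2, 3, 5}"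
  shows "coprime (int c) (int p)"
proof -
  have "prime c"
    using assms(3) by auto
  then have "coprime c p"
    using assms by (intro primes_coprime) auto
  then show ?thesis
    by simp
qed

lemma coprime_denominator_sums:
  assumes "prime p" "p > 5"
  shows "coprime (27 ^ k :: int) (int p)" "coprime ((- 27) ^ k :: int) (int p)"
proof -
  have "coprime (3 :: int) (int p)"
    using coprime_small[OF assms, of 3] by simp
  then have "coprime (3 * 3 * 3 :: int) (int p)"
    by (simp only: coprime_mult_left_iff)
  then have "coprime (27 :: int) (int p)"
    by simp
  then show "coprime (27 ^ k :: int) (int p)" "coprime ((- 27) ^ k :: int) (int p)"
    by simp_all
qed

lemma coprime_denominator_form:
  fixes a b x y :: int
  assumes "prime p" "p > 5" "coprime a (int p)" "int p = a * x^2 + b * y^2"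
  shows "coprime (2 * y) (int p)" "coprime (10 * y) (int p)"
proof -
  have pr: "prime (int p)"
    using assms(1) by simp
  have "\<not> int p dvd y"
  proof
    assume y: "int p dvd y"
    then have "int p dvd a * x^2 + b * y^2 - b * y^2"
      using assms(4) by (intro dvd_diff) (auto simp: power2_eq_square)
    then have "int p dvd a * x^2"
      by simp
    then have "int p dvd x^2"
      using assms(3) coprime_dvd_mult_right_iff[of "int p" a "x^2"]
      by (simp add: coprime_commute)
    then have "int p dvd x"
      using prime_dvd_power[OF pr] by blast
    with y have "(int p)^2 dvd a * x^2 + b * y^2"
      by (intro dvd_add dvd_mult dvd_power_same)
    then have "int p * int p dvd int p * 1"
      using assms(4) by (simp add: power2_eq_square)
    then have "int p dvd 1"
      using assms(2) by (subst (asm) dvd_mult_cancel_left) auto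
    with assms(2) show False
      by simp
  qed
  then have y: "coprime y (int p)"
    using pr prime_imp_coprime coprime_commute by blast
  have 2: "coprime 2 (int p)" and 5: "coprime 5 (int p)"
    using coprime_small[OF assms(1,2), of 2] coprime_small[OF assms(1,2), of 5] by simp_all
  show "coprime (2 * y) (int p)"
    using 2 y by simp
  have "coprime (2 * 5 * y) (int p)"
    using 2 5 y by (simp only: coprime_mult_left_iff)
  then show "coprime (10 * y) (int p)"
    by simp
qed

end

theory Submission
  imports Defs "HOL-Computational_Algebra.Polynomial" "HOL-Library.Discrete_Functions"
begin

text \<open>
  With \<open>n = [p/3]\<close>, the quotient of \<open>3k choose k\<close> by \<open>(- 27)\<^sup>k\<close> is congruent to \<open>n + k choose 2k\<close>
  modulo \<open>p\<close>. Hence the second sum is the Fibonacci number \<open>F(2n + 1)\<close>, and the first sum, which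
  collects the even \<open>k\<close>, differs from half of it by a sequence of period 6 in \<open>n\<close>.

  By Binet's formula \<open>F(2n + 1)\<close> is determined modulo \<open>p\<close> by the cubic character of the golden ratio.
  Modulo \<open>p\<close>, the square root of 5 is a rational multiple of the square root \<open>\<theta>\<close> of \<open>- 3\<close>, so this is the
  cubic character of \<open>A = x + y \<theta>\<close> modulo \<open>p\<close>. Cubic reciprocity between \<open>A\<close> and rational primes makes it
  a character of \<open>p\<close> modulo \<open>N(A) = x\<^sup>2 + 3 y\<^sup>2\<close>, where \<open>p \<equiv> \<plusminus>(x - 3 y)(x + 3 y)\<close>. Modulo a prime \<open>q\<close>
  dividing \<open>x \<plusminus> 3 y\<close>, \<open>A\<close> is an integer times \<open>\<theta>\<close> times a cube root of unity, so a second use of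
  reciprocity leaves only the characters of \<open>\<omega>\<close>, which depend on residues modulo 9.

  The reciprocity law comes from the Gauss sum \<open>G\<close> of a cubic character modulo a prime \<open>r\<close>, taken in the
  group ring \<open>\<int>[\<omega>][X]/(X\<^sup>r - 1)\<close>, where \<open>G\<^sup>4 = r J G\<close> for the Jacobi sum \<open>J\<close>, by comparing this with
  the Frobenius formula for \<open>G\<close> to the power \<open>q\<^sup>2\<close> modulo \<open>q\<close>.
\<close>

section \<open>Eisenstein integers\<close>

text \<open>Reciprocity for an Eisenstein integer needs its coefficient of \<omega> to be divisible
  by 3. For A = x + y \<theta> this coefficient is 2y, for \<omega> A it is x - y. Hence the two
  cases of the theorem; the second one brings in the symbol of \<omega> at p. The symbols at the
  primes q dividing x - 3y or x + 3y can be computed because 3 + \<theta> = -2 \<omega> \<theta> and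
  -3 + \<theta> = -2 \<omega>^2 \<theta>, while integers prime to q and \<theta> have trivial cubic
  symbol at q > 3. These linear forms enter through x^2 + 15y^2 = 2N - (x^2 - 9y^2) and 5x^2 + 3y^2
  = 4N + (x^2 - 9y^2), where N = x^2 + 3y^2. In the group ring the powers of X below r are a basis,
  so a congruence modulo q can be read off coefficient by coefficient. The price is that G^3 = r J
  fails there and holds only after a further multiplication by G. Symbols are powers with exponent
  (p^2 - 1)/3, which is an integer for p = 1 and for p = 2 modulo 3.\<close>

datatype eis = Eis (re: int) (om: int)

instantiation eis :: comm_ring_1
begin

definition "0 = Eis 0 0"
definition "1 = Eis 1 0"
definition "a + b = Eis (re a + re b) (om a + om b)"
definition "a - b = Eis (re a - re b) (om a - om b)"
definition "- a = Eis (- re a) (- om a)"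
definition "a * b = Eis (re a * re b - om a * om b) (re a * om b + om a * re b - om a * om b)"

instance
  by standard (auto simp: zero_eis_def one_eis_def plus_eis_def minus_eis_def uminus_eis_def
      times_eis_def algebra_simps)

end

lemma eis_sel [simp]:
  "re 0 = 0" "om 0 = 0" "re 1 = 1" "om 1 = 0"
  "re (a + b) = re a + re b" "om (a + b) = om a + om b"
  "re (a - b) = re a - re b" "om (a - b) = om a - om b"
  "re (- a) = - re a" "om (- a) = - om a"
  "re (a * b) = re a * re b - om a * om b"
  "om (a * b) = re a * om b + om a * re b - om a * om b"
  by (simp_all add: zero_eis_def one_eis_def plus_eis_def minus_eis_def uminus_eis_def times_eis_def)

lemma eis_eqI: "re a = re b \<Longrightarrow> om a = om b \<Longrightarrow> a = b"
  by (rule eis.expand) simp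

lemma of_nat_eis [simp]: "re (of_nat n) = int n" "om (of_nat n) = 0"
  by (induction n) simp_all

lemma of_int_eis [simp]: "re (of_int k) = k" "om (of_int k) = 0"
  by (cases k; simp)+

lemma numeral_eis [simp]: "re (numeral k) = numeral k" "om (numeral k) = 0"
  using of_int_eis[of "numeral k"] by simp_all

lemma of_int_dvd_eis_iff: "of_int q dvd a \<longleftrightarrow> q dvd re a \<and> q dvd om a"
proof
  assume "of_int q dvd a"
  then show "q dvd re a \<and> q dvd om a" by (auto elim!: dvdE)
next
  assume "q dvd re a \<and> q dvd om a"
  then obtain u v where "re a = q * u" "om a = q * v" by (auto elim!: dvdE)
  then have "a = of_int q * Eis u v" by (intro eis_eqI) simp_all
  then show "of_int q dvd a" by simp
qed

lemma of_nat_dvd_eis_iff: "of_nat q dvd a \<longleftrightarrow> int q dvd re a \<and> int q dvd om a"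
  using of_int_dvd_eis_iff[of "int q" a] by simp

definition \<omega> :: eis where "\<omega> = Eis 0 1"

definition econj :: "eis \<Rightarrow> eis" where "econj a = Eis (re a - om a) (- om a)"

definition enorm :: "eis \<Rightarrow> int" where "enorm a = (re a)\<^sup>2 - re a * om a + (om a)\<^sup>2"

lemma omega_sel [simp]: "re \<omega> = 0" "om \<omega> = 1"
  by (simp_all add: \<omega>_def)

lemma econj_sel [simp]: "re (econj a) = re a - om a" "om (econj a) = - om a"
  by (simp_all add: econj_def)

lemma eis_eq: "a = of_int (re a) + of_int (om a) * \<omega>"
  by (rule eis_eqI) simp_all

lemma omega_square: "\<omega>\<^sup>2 = - 1 - \<omega>"
  by (rule eis_eqI) (simp_all add: power2_eq_square)

lemma omega_cube [simp]: "\<omega> ^ 3 = 1"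
  by (rule eis_eqI) (simp_all add: power3_eq_cube)

lemma omega_power_mod: "\<omega> ^ n = \<omega> ^ (n mod 3)"
proof -
  have "\<omega> ^ n = \<omega> ^ (3 * (n div 3) + n mod 3)" by simp
  also have "\<dots> = \<omega> ^ (n mod 3)" by (simp only: power_add power_mult omega_cube power_one mult_1)
  finally show ?thesis .
qed

lemma econj_simps [simp]:
  "econj (a * b) = econj a * econj b" "econj (a + b) = econj a + econj b" "econj (econj a) = a"
  "econj 0 = 0" "econj 1 = 1" "econj (of_int k) = of_int k"
  "econj (of_nat n) = of_nat n"
  by (rule eis_eqI; simp add: algebra_simps)+

lemma econj_power [simp]: "econj (a ^ n) = econj a ^ n"
  by (induction n) simp_all

lemma econj_sum [simp]: "econj (sum f S) = (\<Sum>x\<in>S. econj (f x))"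
  by (induction S rule: infinite_finite_induct) simp_all

lemma econj_omega: "econj \<omega> = \<omega>\<^sup>2"
  by (rule eis_eqI) (simp_all add: power2_eq_square)

lemma mult_econj: "a * econj a = of_int (enorm a)"
  by (rule eis_eqI) (simp_all add: enorm_def power2_eq_square algebra_simps)

lemma enorm_mult: "enorm (a * b) = enorm a * enorm b"
  by (simp add: enorm_def power2_eq_square algebra_simps)

lemma enorm_simps [simp]: "enorm 1 = 1" "enorm \<omega> = 1" "enorm (econj a) = enorm a"
  "enorm (of_int k) = k\<^sup>2"
  by (simp_all add: enorm_def power2_eq_square algebra_simps)

lemma enorm_power: "enorm (a ^ n) = enorm a ^ n"
  by (induction n) (simp_all add: enorm_mult)

lemma four_enorm: "4 * enorm a = (2 * re a - om a)\<^sup>2 + 3 * (om a)\<^sup>2"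
  by (simp add: enorm_def power2_eq_square algebra_simps)

lemma enorm_nonneg: "enorm a \<ge> 0"
  using four_enorm[of a] by (smt (verit) zero_le_power2)

lemma enorm_eq_0_iff: "enorm a = 0 \<longleftrightarrow> a = 0"
proof
  assume "enorm a = 0"
  then have "(2 * re a - om a)\<^sup>2 + 3 * (om a)\<^sup>2 = 0" using four_enorm[of a] by simp
  then have "(2 * re a - om a)\<^sup>2 = 0 \<and> 3 * (om a)\<^sup>2 = 0"
    by (smt (verit) zero_le_power2)
  then show "a = 0" by (intro eis_eqI) auto
qed (simp add: enorm_def)

instance eis :: idom
  by standard (metis enorm_eq_0_iff enorm_mult mult_eq_0_iff)

instance eis :: ring_char_0
  by standard (metis injI of_nat_eis(1) of_nat_eq_iff)

text \<open>A difference of two distinct cube roots of unity has a coordinate 1 or -1, so no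
  rational prime divides it, not even 3. This turns congruences between symbols into
  equalities.\<close>

lemma cube_roots_of_unity_cong_imp_eq:
  assumes "a \<in> {1, \<omega>, \<omega>\<^sup>2}" "b \<in> {1, \<omega>, \<omega>\<^sup>2}" "prime q" "of_nat q dvd a - b"
  shows "a = b"
proof (rule ccontr)
  assume "a \<noteq> b"
  have "\<not> int q dvd 1" using assms(3)
    by (simp add: prime_gt_1_nat not_less) (metis One_nat_def not_prime_1)
  with assms \<open>a \<noteq> b\<close> show False
    unfolding of_nat_dvd_eis_iff
    by (auto simp: omega_square)
qed

section \<open>Congruences modulo two ring elements\<close>

text \<open>Congruence modulo the ideal generated by \<open>m\<close> and \<open>n\<close>. Gauss
  sums need a prime q together with X^r - 1; \<open>n = 0\<close> gives back congruence modulo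
  \<open>m\<close>.\<close>

definition cong2 :: "'a::comm_ring_1 \<Rightarrow> 'a \<Rightarrow> 'a \<Rightarrow> 'a \<Rightarrow> bool" where
  "cong2 m n a b \<longleftrightarrow> (\<exists>u v. a - b = m * u + n * v)"

lemma cong2_refl [simp, intro]: "cong2 m n a a"
  unfolding cong2_def by (rule exI[of _ 0], rule exI[of _ 0]) simp

lemma cong2_sym: "cong2 m n a b \<Longrightarrow> cong2 m n b a"
  unfolding cong2_def
proof (elim exE)
  fix u v assume "a - b = m * u + n * v"
  then have "b - a = m * (- u) + n * (- v)" by (simp add: algebra_simps)
  then show "\<exists>u v. b - a = m * u + n * v" by blast
qed

lemma cong2_add: "cong2 m n a b \<Longrightarrow> cong2 m n c d \<Longrightarrow> cong2 m n (a + c) (b + d)"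
  unfolding cong2_def
proof (elim exE)
  fix u v u' v' assume "a - b = m * u + n * v" "c - d = m * u' + n * v'"
  then have "a + c - (b + d) = m * (u + u') + n * (v + v')" by (simp add: algebra_simps)
  then show "\<exists>u v. a + c - (b + d) = m * u + n * v" by blast
qed

lemma cong2_mult_left: "cong2 m n a b \<Longrightarrow> cong2 m n (c * a) (c * b)"
  unfolding cong2_def
proof (elim exE)
  fix u v assume "a - b = m * u + n * v"
  then have "c * a - c * b = m * (c * u) + n * (c * v)"
    by (metis (no_types, lifting) distrib_left mult.left_commute right_diff_distrib)
  then show "\<exists>u v. c * a - c * b = m * u + n * v" by blast
qed

lemma cong2_trans [trans]: "cong2 m n a b \<Longrightarrow> cong2 m n b c \<Longrightarrow> cong2 m n a c"
  using cong2_add[of m n a b b c] by (auto simp: cong2_def)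

lemma cong2_eq_trans [trans]:
  "cong2 m n a b \<Longrightarrow> b = c \<Longrightarrow> cong2 m n a c" "a = b \<Longrightarrow> cong2 m n b c \<Longrightarrow> cong2 m n a c"
  by simp_all

lemma cong2_mult: "cong2 m n a b \<Longrightarrow> cong2 m n c d \<Longrightarrow> cong2 m n (a * c) (b * d)"
  using cong2_mult_left[of m n c d a] cong2_mult_left[of m n a b d]
  by (metis cong2_trans mult.commute)

lemma cong2_diff: "cong2 m n a b \<Longrightarrow> cong2 m n c d \<Longrightarrow> cong2 m n (a - c) (b - d)"
  using cong2_add[of m n a b "- 1 * c" "- 1 * d"] cong2_mult_left[of m n c d "- 1"] by simp

lemma cong2_power: "cong2 m n a b \<Longrightarrow> cong2 m n (a ^ k) (b ^ k)"
  by (induction k) (auto intro: cong2_mult)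

lemma cong2_sum: "(\<And>x. x \<in> S \<Longrightarrow> cong2 m n (f x) (g x)) \<Longrightarrow> cong2 m n (sum f S) (sum g S)"
  by (induction S rule: infinite_finite_induct) (auto intro: cong2_add)

lemma cong2_of_dvd_left: "m dvd a - b \<Longrightarrow> cong2 m n a b"
  unfolding cong2_def by (elim dvdE) (metis add.right_neutral mult_zero_right)

lemma cong2_of_dvd_right: "n dvd a - b \<Longrightarrow> cong2 m n a b"
  unfolding cong2_def by (elim dvdE) (metis add.left_neutral mult_zero_right)

lemma cong2_0_iff: "cong2 m 0 a b \<longleftrightarrow> m dvd a - b"
  by (auto simp: cong2_def dvd_def)

lemma freshmans_dream_add:
  fixes a b :: "'a::comm_ring_1"
  assumes "prime q"
  shows "of_nat q dvd (a + b) ^ q - (a ^ q + b ^ q)"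
proof -
  have q: "q > 1" using assms by (rule prime_gt_1_nat)
  have "(a + b) ^ q = (\<Sum>k\<le>q. of_nat (q choose k) * a ^ k * b ^ (q - k))"
    by (rule binomial_ring)
  also have "{..q} = insert 0 (insert q {0<..<q})" using q by auto
  also have "(\<Sum>k\<in>insert 0 (insert q {0<..<q}). of_nat (q choose k) * a ^ k * b ^ (q - k)) =
      b ^ q + (a ^ q + (\<Sum>k\<in>{0<..<q}. of_nat (q choose k) * a ^ k * b ^ (q - k)))"
    using q by simp
  finally have "(a + b) ^ q - (a ^ q + b ^ q) = (\<Sum>k\<in>{0<..<q}. of_nat (q choose k) * a ^ k * b ^ (q - k))"
    by simp
  also have "of_nat q dvd \<dots>"
  proof (intro dvd_sum dvd_mult2)
    fix k assume "k \<in> {0<..<q}"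
    then have "q dvd (q choose k)" using assms by (intro dvd_choose_prime) auto
    then show "of_nat q dvd (of_nat (q choose k) :: 'a)" by (auto elim!: dvdE)
  qed
  finally show ?thesis .
qed

lemma freshmans_dream_sum:
  fixes f :: "'b \<Rightarrow> 'a::comm_ring_1"
  assumes "prime q"
  shows "cong2 (of_nat q) n ((\<Sum>x\<in>S. f x) ^ q) (\<Sum>x\<in>S. f x ^ q)"
proof (induction S rule: infinite_finite_induct)
  case (insert x S)
  have "cong2 (of_nat q) n ((f x + sum f S) ^ q) (f x ^ q + sum f S ^ q)"
    by (intro cong2_of_dvd_left freshmans_dream_add assms)
  also have "cong2 (of_nat q) n \<dots> (f x ^ q + (\<Sum>x\<in>S. f x ^ q))"
    by (intro cong2_add cong2_refl insert)
  finally show ?case using insert by simp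
qed (use assms prime_gt_0_nat[of q] in \<open>auto simp: power_0_left\<close>)

section \<open>The group ring of the integers modulo a prime\<close>

lemma sum_residues_reindex:
  fixes r :: int and f :: "int \<Rightarrow> 'a::comm_monoid_add"
  assumes "r > 0" and per: "\<And>m. f (m mod r) = f m"
    and inj: "\<And>s t. [h s = h t] (mod r) \<Longrightarrow> [s = t] (mod r)"
  shows "(\<Sum>s\<in>{0..<r}. f (h s)) = (\<Sum>s\<in>{0..<r}. f s)"
proof -
  have inj': "inj_on (\<lambda>s. h s mod r) {0..<r}"
  proof (rule inj_onI)
    fix s t assume st: "s \<in> {0..<r}" "t \<in> {0..<r}" "h s mod r = h t mod r"
    from st(3) have "[s = t] (mod r)" unfolding cong_def by (rule inj[unfolded cong_def])
    then show "s = t" using st(1,2) by (intro cong_less_imp_eq_int) auto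
  qed
  have "(\<lambda>s. h s mod r) ` {0..<r} = {0..<r}"
  proof (rule endo_inj_surj)
    show "(\<lambda>s. h s mod r) ` {0..<r} \<subseteq> {0..<r}" using assms(1) by (intro image_subsetI) simp
  qed (use inj' in simp_all)
  then have "(\<Sum>s\<in>{0..<r}. f s) = (\<Sum>s\<in>{0..<r}. f (h s mod r))"
    using sum.reindex[OF inj', of f] by (simp add: o_def)
  then show ?thesis unfolding per by (rule sym)
qed

text \<open>A function on the residues modulo \<open>r\<close> as an element of the group ring,
  through its representative of degree below \<open>r\<close>; X takes the place of a primitive r-th
  root of unity.\<close>

definition group_ring :: "nat \<Rightarrow> (int \<Rightarrow> 'a::comm_ring_1) \<Rightarrow> 'a poly" where
  "group_ring r f = (\<Sum>t\<in>{0..<int r}. monom (f t) (nat t))"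

abbreviation unity_poly :: "nat \<Rightarrow> 'a::comm_ring_1 poly" where
  "unity_poly r \<equiv> monom 1 r - 1"

text \<open>The argument \<open>u - s\<close> is not reduced, so this is the cyclic convolution only
  for \<open>g\<close> of period \<open>r\<close>.\<close>

definition convolution :: "nat \<Rightarrow> (int \<Rightarrow> 'a::comm_ring_1) \<Rightarrow> (int \<Rightarrow> 'a) \<Rightarrow> int \<Rightarrow> 'a" where
  "convolution r f g u = (\<Sum>s\<in>{0..<int r}. f s * g (u - s))"

lemma group_ring_cong:
  "(\<And>u. u \<in> {0..<int r} \<Longrightarrow> f u = g u) \<Longrightarrow> group_ring r f = group_ring r g"
  unfolding group_ring_def by (rule sum.cong) simp_all

lemma coeff_group_ring:
  "coeff (group_ring r f) n = (if n < r then f (int n) else 0)"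
proof -
  have "coeff (group_ring r f) n = (\<Sum>t\<in>{0..<int r}. if t = int n then f t else 0)"
    unfolding group_ring_def coeff_sum by (rule sum.cong) auto
  also have "\<dots> = (if n < r then f (int n) else 0)"
    by (subst sum.delta) auto
  finally show ?thesis .
qed

lemma group_ring_smult: "group_ring r (\<lambda>u. c * f u) = [:c:] * group_ring r f"
  by (simp add: poly_eq_iff coeff_group_ring)

lemma monom_cong_mod:
  assumes "m \<ge> 0" "r > 0"
  shows "cong2 q (unity_poly r) (monom c (nat m)) (monom c (nat (m mod int r)))"
proof -
  let ?k = "nat (m div int r)"
  have "nat m = nat (m mod int r) + r * ?k"
  proof -
    have "m = m mod int r + int r * (m div int r)" by simp
    moreover have "0 \<le> m mod int r" "0 \<le> m div int r"
      using assms by (simp_all add: pos_imp_zdiv_nonneg_iff)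
    ultimately have "int (nat m) = int (nat (m mod int r) + r * ?k)" using assms by simp
    then show ?thesis by (simp only: of_nat_eq_iff)
  qed
  then have "monom c (nat m) = monom c (nat (m mod int r)) * monom 1 r ^ ?k"
    by (simp add: monom_power mult_monom)
  also have "cong2 q (unity_poly r) \<dots> (monom c (nat (m mod int r)) * 1 ^ ?k)"
    by (intro cong2_mult cong2_refl cong2_power cong2_of_dvd_right) simp
  finally show ?thesis by simp
qed

lemma group_ring_mult:
  assumes "r > 0" and per: "\<And>m. g (m mod int r) = g m"
  shows "cong2 q (unity_poly r) (group_ring r f * group_ring r g) (group_ring r (convolution r f g))"
proof -
  let ?I = "{0..<int r}"
  let ?F = "\<lambda>s u. monom (f s * g (u - s)) (nat (u mod int r))"
  have "group_ring r f * group_ring r g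
      = (\<Sum>s\<in>?I. \<Sum>t\<in>?I. monom (f s * g t) (nat (s + t)))"
    unfolding group_ring_def sum_product
    by (intro sum.cong refl) (simp add: mult_monom nat_add_distrib)
  also have "cong2 q (unity_poly r) \<dots> (\<Sum>s\<in>?I. \<Sum>t\<in>?I. ?F s (s + t))"
    by (intro cong2_sum) (simp add: monom_cong_mod assms(1))
  also have "(\<Sum>s\<in>?I. \<Sum>t\<in>?I. ?F s (s + t)) = (\<Sum>s\<in>?I. \<Sum>u\<in>?I. ?F s u)"
  proof (rule sum.cong[OF refl])
    fix s
    show "(\<Sum>t\<in>?I. ?F s (s + t)) = (\<Sum>u\<in>?I. ?F s u)"
    proof (rule sum_residues_reindex)
      fix m
      have "g (m mod int r - s) = g (m - s)"
        by (subst (1 2) per[symmetric]) (simp add: mod_diff_left_eq)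
      then show "?F s (m mod int r) = ?F s m" by simp
    next
      fix x y :: int assume "[s + x = s + y] (mod int r)"
      then show "[x = y] (mod int r)" by (simp add: cong_add_lcancel)
    qed (use assms in auto)
  qed
  also have "\<dots> = (\<Sum>u\<in>?I. \<Sum>s\<in>?I. ?F s u)" by (rule sum.swap)
  also have "\<dots> = group_ring r (convolution r f g)"
    unfolding group_ring_def convolution_def by (intro sum.cong refl) (simp add: monom_sum)
  finally show ?thesis .
qed

text \<open>Multiplication by \<open>n\<close> permutes the residues, and the exponent
  \<open>u\<close> is reached from t = k u, with \<open>k\<close> the inverse of
  \<open>n\<close>.\<close>

lemma group_ring_scale:
  assumes "r > 0" and per: "\<And>m. f (m mod int r) = f m" and k: "[k * int n = 1] (mod int r)"
  shows "cong2 q (unity_poly r) (\<Sum>t\<in>{0..<int r}. monom (f t) (n * nat t))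
    (group_ring r (\<lambda>u. f (k * u)))"
proof -
  let ?I = "{0..<int r}"
  let ?F = "\<lambda>u. monom (f (k * u)) (nat (u mod int r))"
  have inv: "f (k * (int n * t)) = f t" for t
  proof -
    have "[k * int n * t = 1 * t] (mod int r)" by (intro cong_mult k cong_refl)
    then have "f (k * int n * t mod int r) = f (1 * t mod int r)" by (simp only: cong_def)
    then show ?thesis by (simp add: mult.assoc per)
  qed
  have "cong2 q (unity_poly r) (\<Sum>t\<in>?I. monom (f t) (n * nat t)) (\<Sum>t\<in>?I. ?F (int n * t))"
  proof (intro cong2_sum)
    fix t assume "t \<in> ?I"
    then have "n * nat t = nat (int n * t)" by (simp add: nat_mult_distrib)
    then show "cong2 q (unity_poly r) (monom (f t) (n * nat t)) (?F (int n * t))"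
      using monom_cong_mod[OF _ assms(1), of "int n * t" q "f t"] \<open>t \<in> ?I\<close> by (simp add: inv)
  qed
  also have "(\<Sum>t\<in>?I. ?F (int n * t)) = (\<Sum>t\<in>?I. ?F t)"
  proof (rule sum_residues_reindex)
    fix m
    have "f (k * (m mod int r)) = f (k * m)"
      by (subst (1 2) per[symmetric]) (simp add: mod_mult_right_eq)
    then show "?F (m mod int r) = ?F m" by simp
  next
    fix s t assume "[int n * s = int n * t] (mod int r)"
    then have "[k * (int n * s) = k * (int n * t)] (mod int r)" by (rule cong_scalar_left)
    moreover have "[k * int n * s = 1 * s] (mod int r)" "[k * int n * t = 1 * t] (mod int r)"
      by (intro cong_mult k cong_refl)+
    ultimately show "[s = t] (mod int r)" by (simp add: mult.assoc cong_def)
  qed (use assms in auto)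
  also have "\<dots> = group_ring r (\<lambda>u. f (k * u))" by (simp add: group_ring_def)
  finally show ?thesis .
qed

text \<open>Summing the coefficients at all exponents congruent to \<open>i\<close> modulo
  \<open>r\<close> annihilates every multiple of X^r - 1 and leaves a multiple of
  \<open>q\<close>.\<close>

lemma group_ring_cong_imp_dvd:
  assumes "cong2 (of_nat q) (unity_poly r) (group_ring r f) (group_ring r g)" "i < r"
  shows "of_nat q dvd f (int i) - g (int i)"
proof -
  obtain u v where uv: "group_ring r f - group_ring r g = of_nat q * u + unity_poly r * v"
    using assms(1) unfolding cong2_def by blast
  define M where "M = degree v + 1"
  have r: "r > 0" using assms(2) by simp
  have 1: "(\<Sum>j\<le>M. coeff (group_ring r f - group_ring r g) (i + r * j)) = f (int i) - g (int i)"
  proof -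
    have "(\<Sum>j\<le>M. coeff (group_ring r f - group_ring r g) (i + r * j))
        = (\<Sum>j\<le>M. if j = 0 then f (int i) - g (int i) else 0)"
    proof (intro sum.cong refl)
      fix j assume "j \<in> {..M}"
      have "\<not> i + r * j < r" if "j \<noteq> 0"
        using that by (cases j) simp_all
      then show "coeff (group_ring r f - group_ring r g) (i + r * j) = (if j = 0 then f (int i) - g (int i) else 0)"
        using assms(2) by (auto simp: coeff_group_ring)
    qed
    then show ?thesis by simp
  qed
  \<comment> \<open>The coefficient of (X^r - 1) v at i + r j is a difference of two neighbouring
    coefficients of v in the class of i. The one term that survives vanishes for m = M, since M
    exceeds the degree of v.\<close>
  have tele: "(\<Sum>j\<le>m. coeff (unity_poly r * v) (i + r * j)) = - coeff v (i + r * m)" for m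
  proof (induction m)
    case 0
    then show ?case using assms(2) by (simp add: left_diff_distrib coeff_monom_mult)
  next
    case (Suc m)
    then show ?case using assms(2) by (simp add: left_diff_distrib coeff_monom_mult)
  qed
  have "M \<le> r * M" using r by simp
  then have "coeff v (i + r * M) = 0" by (intro coeff_eq_0) (simp add: M_def)
  then have "(\<Sum>j\<le>M. coeff (of_nat q * u + unity_poly r * v) (i + r * j))
      = of_nat q * (\<Sum>j\<le>M. coeff u (i + r * j))"
    using tele[of M] by (simp add: sum.distrib of_nat_poly sum_distrib_left)
  then have "f (int i) - g (int i) = of_nat q * (\<Sum>j\<le>M. coeff u (i + r * j))"
    using 1 unfolding uv by simp
  then show ?thesis by simp
qed

section \<open>Cubic Jacobi sums\<close>

locale cubic_character =
  fixes r :: nat and \<chi> :: "int \<Rightarrow> eis"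
  assumes prime_r: "prime r"
    and chi_mult: "\<chi> (a * b) = \<chi> a * \<chi> b"
    and chi_mod: "\<chi> (a mod int r) = \<chi> a"
    and chi_dvd: "int r dvd a \<Longrightarrow> \<chi> a = 0"
    and chi_values: "\<not> int r dvd a \<Longrightarrow> \<chi> a \<in> {1, \<omega>, \<omega>\<^sup>2}"
    and chi_nontrivial: "\<exists>a. \<not> int r dvd a \<and> \<chi> a \<noteq> 1"
begin

lemma r_pos: "r > 0" and r_gt_1: "r > 1"
  using prime_gt_1_nat[OF prime_r] by simp_all

lemma chi_cube: "\<not> int r dvd a \<Longrightarrow> \<chi> a ^ 3 = 1"
  using chi_values[of a] power_mult[of \<omega> 3 2] power_mult[of \<omega> 2 3] by auto

lemma chi_1: "\<chi> 1 = 1"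
proof -
  have "\<not> int r dvd 1" using r_gt_1 by simp
  then have "\<chi> 1 ^ 3 = 1" by (rule chi_cube)
  moreover have "\<chi> 1 * \<chi> 1 = \<chi> 1" using chi_mult[of 1 1] by simp
  ultimately show ?thesis by (simp add: power3_eq_cube)
qed

lemma chi_minus_1: "\<chi> (- 1) = 1"
proof -
  have "\<not> int r dvd - 1" using r_gt_1 by simp
  then have "\<chi> (- 1) ^ 3 = 1" by (rule chi_cube)
  moreover have "\<chi> (- 1) * \<chi> (- 1) = 1" using chi_mult[of "- 1" "- 1"] chi_1 by simp
  ultimately show ?thesis by (simp add: power3_eq_cube)
qed

lemma chi_minus: "\<chi> (- a) = \<chi> a"
  using chi_mult[of "- 1" a] chi_minus_1 by simp

lemma chi_power: "\<chi> (a ^ n) = \<chi> a ^ n"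
  by (induction n) (simp_all add: chi_1 chi_mult)

lemma econj_chi: "econj (\<chi> a) = \<chi> a ^ 2"
proof (cases "int r dvd a")
  case True
  then show ?thesis by (simp add: chi_dvd)
next
  case False
  have "(\<omega>\<^sup>2)\<^sup>2 = \<omega>" by (rule eis_eqI) (simp_all add: power2_eq_square)
  with chi_values[OF False] show ?thesis by (auto simp: econj_omega)
qed

lemma cong_cancel:
  assumes "\<not> int r dvd a" "[a * s = a * t] (mod int r)"
  shows "[s = t] (mod int r)"
proof -
  have "coprime a (int r)"
    using assms(1) prime_r prime_imp_coprime[of "int r" a] by (simp add: coprime_commute)
  then show ?thesis using assms(2) by (simp add: cong_mult_lcancel)
qed

lemma sum_residues_scale:
  assumes "\<not> int r dvd a" "\<And>m. f (m mod int r) = f m"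
  shows "(\<Sum>s\<in>{0..<int r}. f (a * s)) = (\<Sum>s\<in>{0..<int r}. f s)"
proof (rule sum_residues_reindex)
  fix s t assume "[a * s = a * t] (mod int r)"
  then show "[s = t] (mod int r)" by (rule cong_cancel[OF assms(1)])
qed (use r_pos assms(2) in simp_all)

lemma sum_chi: "(\<Sum>s\<in>{0..<int r}. \<chi> s) = 0"
proof -
  obtain a where a: "\<not> int r dvd a" "\<chi> a \<noteq> 1" using chi_nontrivial by blast
  have "(\<Sum>s\<in>{0..<int r}. \<chi> s) = (\<Sum>s\<in>{0..<int r}. \<chi> (a * s))"
    using sum_residues_scale[OF a(1), of \<chi>] by (simp add: chi_mod)
  also have "\<dots> = \<chi> a * (\<Sum>s\<in>{0..<int r}. \<chi> s)" by (simp add: chi_mult sum_distrib_left)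
  finally show ?thesis using a(2) by (metis mult_cancel_right1)
qed

lemma sum_chi_square: "(\<Sum>s\<in>{0..<int r}. (\<chi> s)\<^sup>2) = 0"
proof -
  have "(\<Sum>s\<in>{0..<int r}. (\<chi> s)\<^sup>2) = econj (\<Sum>s\<in>{0..<int r}. \<chi> s)" by (simp add: econj_chi)
  then show ?thesis by (simp add: sum_chi)
qed

lemma chi_diff_mod: "\<chi> (a - b mod int r) = \<chi> (a - b)" "\<chi> (a mod int r - b) = \<chi> (a - b)"
  by (subst (1 2) chi_mod[symmetric], simp add: mod_simps)+

definition J :: eis where "J = (\<Sum>s\<in>{0..<int r}. \<chi> s * \<chi> (1 - s))"

text \<open>Substituting u s for s pulls \<chi>(u) out of both factors and leaves a Jacobi sum that
  does not depend on \<open>u\<close>.\<close>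

lemma convolution_scale:
  assumes "\<not> int r dvd u"
  shows "convolution r (\<lambda>s. \<chi> s ^ k) (\<lambda>s. \<chi> s ^ l) u
    = \<chi> u ^ (k + l) * (\<Sum>s\<in>{0..<int r}. \<chi> s ^ k * \<chi> (1 - s) ^ l)"
proof -
  have "convolution r (\<lambda>s. \<chi> s ^ k) (\<lambda>s. \<chi> s ^ l) u
      = (\<Sum>s\<in>{0..<int r}. \<chi> (u * s) ^ k * \<chi> (u - u * s) ^ l)"
    unfolding convolution_def
    by (subst sum_residues_scale[OF assms, symmetric, of "\<lambda>s. \<chi> s ^ k * \<chi> (u - s) ^ l"])
      (simp_all add: chi_mod chi_diff_mod)
  also have "\<dots> = (\<Sum>s\<in>{0..<int r}. \<chi> u ^ (k + l) * (\<chi> s ^ k * \<chi> (1 - s) ^ l))"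
  proof (intro sum.cong refl)
    fix s
    have "u - u * s = u * (1 - s)" by (simp add: algebra_simps)
    then show "\<chi> (u * s) ^ k * \<chi> (u - u * s) ^ l = \<chi> u ^ (k + l) * (\<chi> s ^ k * \<chi> (1 - s) ^ l)"
      by (simp add: chi_mult power_mult_distrib power_add)
  qed
  also have "\<dots> = \<chi> u ^ (k + l) * (\<Sum>s\<in>{0..<int r}. \<chi> s ^ k * \<chi> (1 - s) ^ l)"
    by (simp add: sum_distrib_left)
  finally show ?thesis .
qed

lemma convolution_chi_chi:
  assumes "u \<in> {0..<int r}"
  shows "convolution r \<chi> \<chi> u = J * (\<chi> u)\<^sup>2"
proof (cases "int r dvd u")
  case True
  with assms have "u = 0" using zdvd_not_zless[of u "int r"] by (cases "u = 0") auto
  then show ?thesis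
    using sum_chi_square True by (simp add: convolution_def chi_dvd chi_minus power2_eq_square)
next
  case False
  then show ?thesis using convolution_scale[OF False, of 1 1]
    by (simp add: J_def power2_eq_square mult.commute)
qed

lemma convolution_chi_square:
  assumes "u \<in> {0..<int r}"
  shows "convolution r (\<lambda>s. (\<chi> s)\<^sup>2) (\<lambda>s. (\<chi> s)\<^sup>2) u = econj J * \<chi> u"
proof -
  have "convolution r (\<lambda>s. (\<chi> s)\<^sup>2) (\<lambda>s. (\<chi> s)\<^sup>2) u = econj (convolution r \<chi> \<chi> u)"
    by (simp add: convolution_def econj_chi)
  also have "convolution r \<chi> \<chi> u = J * econj (\<chi> u)"
    by (simp only: convolution_chi_chi assms econj_chi)
  finally show ?thesis by simp
qed

text \<open>At 0 the terms \<chi>(s)^3 count the nonzero residues. Elsewhere the value is a constant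
  K because \<chi>(u)^3 = 1; summing over all u gives a multiple of the sum of \<chi>^2, which is 0,
  so (r - 1)(1 + K) = 0.\<close>

lemma convolution_chi_conj:
  assumes "u \<in> {0..<int r}"
  shows "convolution r \<chi> (\<lambda>s. (\<chi> s)\<^sup>2) u = (if u = 0 then of_nat r else 0) - 1"
proof -
  define K where "K = (\<Sum>s\<in>{0..<int r}. \<chi> s * (\<chi> (1 - s))\<^sup>2)"
  let ?c = "convolution r \<chi> (\<lambda>s. (\<chi> s)\<^sup>2)"
  have I: "{0..<int r} = insert 0 {1..<int r}" using r_gt_1 by auto
  have nd: "\<not> int r dvd u" if "u \<in> {1..<int r}" for u
    using that zdvd_not_zless[of u "int r"] by simp
  have c0: "?c 0 = of_nat r - 1"
  proof -
    have "?c 0 = (\<Sum>s\<in>{1..<int r}. \<chi> s ^ 3)"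
      by (simp add: convolution_def I chi_dvd chi_minus power2_eq_square power3_eq_cube mult.assoc)
    also have "\<dots> = (\<Sum>s\<in>{1..<int r}. 1)" using nd chi_cube by (intro sum.cong) auto
    also have "\<dots> = of_nat (nat (int r - 1))" by simp
    also have "\<dots> = of_nat r - 1" using r_gt_1 by (simp add: nat_diff_distrib of_nat_diff)
    finally show ?thesis .
  qed
  have cu: "?c u = K" if "u \<in> {1..<int r}" for u
    using convolution_scale[OF nd[OF that], of 1 2] chi_cube[OF nd[OF that]]
    by (simp add: K_def numeral_3_eq_3)
  have "(\<Sum>u\<in>{0..<int r}. ?c u) = (\<Sum>s\<in>{0..<int r}. \<chi> s * (\<Sum>u\<in>{0..<int r}. (\<chi> (u - s))\<^sup>2))"
    unfolding convolution_def by (subst sum.swap) (simp add: sum_distrib_left)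
  also have "\<dots> = (\<Sum>s\<in>{0..<int r}. \<chi> s * (\<Sum>u\<in>{0..<int r}. (\<chi> u)\<^sup>2))"
  proof -
    have "(\<Sum>u\<in>{0..<int r}. (\<chi> (u - s))\<^sup>2) = (\<Sum>u\<in>{0..<int r}. (\<chi> u)\<^sup>2)" for s
    proof (rule sum_residues_reindex[where f = "\<lambda>u. (\<chi> u)\<^sup>2"])
      fix x y :: int assume "[x - s = y - s] (mod int r)"
      then have "[x - s + s = y - s + s] (mod int r)" by (rule cong_add) simp
      then show "[x = y] (mod int r)" by simp
    qed (use r_pos in \<open>simp_all add: chi_mod\<close>)
    then show ?thesis by simp
  qed
  also have "\<dots> = 0" by (simp add: sum_chi_square)
  finally have "?c 0 + (\<Sum>u\<in>{1..<int r}. ?c u) = 0" by (simp add: I)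
  moreover have "(\<Sum>u\<in>{1..<int r}. ?c u) = (of_nat r - 1) * K"
  proof -
    have "(\<Sum>u\<in>{1..<int r}. ?c u) = (\<Sum>u\<in>{1..<int r}. K)" using cu by (intro sum.cong) auto
    also have "\<dots> = of_nat (nat (int r - 1)) * K" by simp
    also have "\<dots> = (of_nat r - 1) * K" using r_gt_1 by (simp add: nat_diff_distrib of_nat_diff)
    finally show ?thesis .
  qed
  ultimately have "(of_nat r - 1) * (1 + K) = 0" using c0 by (simp add: algebra_simps)
  moreover have "(of_nat r - 1 :: eis) \<noteq> 0" using r_gt_1
    by (metis less_numeral_extra(4) of_nat_1 of_nat_eq_iff right_minus_eq)
  ultimately have "K = - 1" by (metis add_eq_0_iff mult_eq_0_iff)
  then show ?thesis using c0 cu[of u] assms by (cases "u = 0") auto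
qed

section \<open>The Gauss sum, its powers and its images under Frobenius\<close>

abbreviation "G \<equiv> group_ring r \<chi>"
abbreviation "H \<equiv> group_ring r (\<lambda>s. (\<chi> s)\<^sup>2)"
text \<open>\<open>D\<close> is r - (1 + X + ... + X^(r-1)): at a primitive r-th root of unity it
  would be the number r.\<close>

abbreviation "\<delta> \<equiv> \<lambda>u. (if u = 0 then of_nat r else 0) - 1 :: eis"
abbreviation "D \<equiv> group_ring r \<delta>"

lemma G_square: "cong2 q (unity_poly r) (G * G) ([:J:] * H)"
proof -
  have "cong2 q (unity_poly r) (G * G) (group_ring r (convolution r \<chi> \<chi>))"
    by (intro group_ring_mult r_pos chi_mod)
  also have "group_ring r (convolution r \<chi> \<chi>) = [:J:] * H"
    unfolding group_ring_smult[symmetric] by (intro group_ring_cong convolution_chi_chi)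
  finally show ?thesis .
qed

lemma H_square: "cong2 q (unity_poly r) (H * H) ([:econj J:] * G)"
proof -
  have "cong2 q (unity_poly r) (H * H) (group_ring r (convolution r (\<lambda>s. (\<chi> s)\<^sup>2) (\<lambda>s. (\<chi> s)\<^sup>2)))"
    by (intro group_ring_mult r_pos) (simp add: chi_mod)
  also have "group_ring r (convolution r (\<lambda>s. (\<chi> s)\<^sup>2) (\<lambda>s. (\<chi> s)\<^sup>2)) = [:econj J:] * G"
    unfolding group_ring_smult[symmetric] by (intro group_ring_cong convolution_chi_square)
  finally show ?thesis .
qed

lemma G_H: "cong2 q (unity_poly r) (G * H) D"
proof -
  have "cong2 q (unity_poly r) (G * H) (group_ring r (convolution r \<chi> (\<lambda>s. (\<chi> s)\<^sup>2)))"
    by (intro group_ring_mult r_pos) (simp add: chi_mod)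
  also have "group_ring r (convolution r \<chi> (\<lambda>s. (\<chi> s)\<^sup>2)) = D"
    by (intro group_ring_cong convolution_chi_conj)
  finally show ?thesis .
qed

lemma D_G: "cong2 q (unity_poly r) (D * G) ([:of_nat r:] * G)"
proof -
  have "cong2 q (unity_poly r) (D * G) (group_ring r (convolution r \<delta> \<chi>))"
    by (intro group_ring_mult r_pos chi_mod)
  also have "group_ring r (convolution r \<delta> \<chi>) = [:of_nat r:] * G"
    unfolding group_ring_smult[symmetric]
  proof (intro group_ring_cong)
    fix u
    have "convolution r \<delta> \<chi> u = (\<Sum>s\<in>{0..<int r}. if s = 0 then of_nat r * \<chi> (u - s) else 0)
        - (\<Sum>s\<in>{0..<int r}. \<chi> (u - s))"
      unfolding convolution_def sum_subtractf[symmetric]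
      by (intro sum.cong) (auto simp: algebra_simps)
    also have "(\<Sum>s\<in>{0..<int r}. \<chi> (u - s)) = (\<Sum>s\<in>{0..<int r}. \<chi> s)"
    proof (rule sum_residues_reindex)
      fix x y assume "[u - x = u - y] (mod int r)"
      with cong_refl have "[u - (u - x) = u - (u - y)] (mod int r)" by (rule cong_diff)
      then show "[x = y] (mod int r)" by simp
    qed (use r_pos in \<open>simp_all add: chi_mod\<close>)
    finally show "convolution r \<delta> \<chi> u = of_nat r * \<chi> u" using r_pos by (simp add: sum_chi)
  qed
  finally show ?thesis .
qed

lemma G_cube: "cong2 q (unity_poly r) (G ^ 3) ([:J:] * D)"
proof -
  have "cong2 q (unity_poly r) (G * G * G) ([:J:] * H * G)"
    by (intro cong2_mult cong2_refl G_square)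
  also have "[:J:] * H * G = [:J:] * (G * H)" by (simp add: mult.commute)
  also have "cong2 q (unity_poly r) \<dots> ([:J:] * D)" by (intro cong2_mult cong2_refl G_H)
  finally show ?thesis by (simp add: power3_eq_cube mult.assoc)
qed

text \<open>G^3 is J D, and D acts as the constant r only on multiples of G (\<open>D_G\<close>);
  hence the exponent 3m + 1, which is also the shape of q^2 for a prime q other than 3.\<close>

lemma G_power: "cong2 q (unity_poly r) (G ^ (3 * m + 1)) ([:(of_nat r * J) ^ m:] * G)"
proof (induction m)
  case (Suc m)
  have "G ^ (3 * Suc m + 1) = G ^ 3 * G ^ (3 * m + 1)"
    by (simp only: power_add[symmetric]) simp
  also have "cong2 q (unity_poly r) \<dots> ([:J:] * D * ([:(of_nat r * J) ^ m:] * G))"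
    by (intro cong2_mult G_cube Suc)
  also have "[:J:] * D * ([:(of_nat r * J) ^ m:] * G) = [:J * (of_nat r * J) ^ m:] * (D * G)"
    by (simp add: algebra_simps)
  also have "cong2 q (unity_poly r) \<dots> ([:J * (of_nat r * J) ^ m:] * ([:of_nat r:] * G))"
    by (intro cong2_mult cong2_refl D_G)
  also have "\<dots> = [:(of_nat r * J) ^ Suc m:] * G" by (simp add: algebra_simps)
  finally show ?case .
qed (simp add: one_pCons[symmetric])

text \<open>(G G)(H H) and (G H)(G H) are the same element, worth J times its conjugate times D, and
  r D. With first modulus 0 the congruences are exact, and the coefficients at 1, where \<delta> is
  -1, are compared.\<close>

lemma enorm_J: "enorm J = int r"
proof -
  have "cong2 0 (unity_poly r) (G * G * (H * H)) ([:J:] * H * ([:econj J:] * G))"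
    by (intro cong2_mult G_square H_square)
  also have "[:J:] * H * ([:econj J:] * G) = [:J * econj J:] * (G * H)" by (simp add: algebra_simps)
  also have "cong2 0 (unity_poly r) \<dots> ([:J * econj J:] * D)" by (intro cong2_mult cong2_refl G_H)
  finally have 1: "cong2 0 (unity_poly r) (G * G * (H * H)) ([:J * econj J:] * D)" .
  have "G * G * (H * H) = (G * H) * (G * H)" by (simp add: algebra_simps)
  also have "cong2 0 (unity_poly r) \<dots> (D * (G * H))" by (intro cong2_mult cong2_refl G_H)
  also have "D * (G * H) = D * G * H" by (simp add: algebra_simps)
  also have "cong2 0 (unity_poly r) \<dots> ([:of_nat r:] * G * H)" by (intro cong2_mult cong2_refl D_G)
  also have "[:of_nat r:] * G * H = [:of_nat r:] * (G * H)" by (simp add: algebra_simps)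
  also have "cong2 0 (unity_poly r) \<dots> ([:of_nat r:] * D)" by (intro cong2_mult cong2_refl G_H)
  finally have "cong2 0 (unity_poly r) ([:J * econj J:] * D) ([:of_nat r:] * D)"
    using 1 cong2_sym cong2_trans by blast
  then have "of_nat 0 dvd J * econj J * \<delta> (int 1) - of_nat r * \<delta> (int 1)"
    unfolding group_ring_smult[symmetric] using r_gt_1
    by (intro group_ring_cong_imp_dvd) simp_all
  then have "of_int (enorm J) = (of_int (int r) :: eis)" by (simp add: mult_econj)
  then show ?thesis by (simp only: of_int_eq_iff)
qed

lemma frobenius_G:
  assumes "prime q"
  shows "cong2 (of_nat q) (unity_poly r) (G ^ q) (\<Sum>t\<in>{0..<int r}. monom (\<chi> t ^ q) (q * nat t))"
  using freshmans_dream_sum[OF assms, of "unity_poly r" "\<lambda>t. monom (\<chi> t) (nat t)" "{0..<int r}"]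
  by (simp add: group_ring_def monom_power mult.commute)

lemma frobenius_G_square:
  assumes "prime q"
  shows "cong2 (of_nat q) (unity_poly r) (G ^ q\<^sup>2) (\<Sum>t\<in>{0..<int r}. monom (\<chi> t ^ q\<^sup>2) (q\<^sup>2 * nat t))"
proof -
  have "G ^ q\<^sup>2 = (G ^ q) ^ q" by (simp add: power_mult[symmetric] power2_eq_square)
  also have "cong2 (of_nat q) (unity_poly r) \<dots> ((\<Sum>t\<in>{0..<int r}. monom (\<chi> t ^ q) (q * nat t)) ^ q)"
    by (intro cong2_power frobenius_G assms)
  also have "cong2 (of_nat q) (unity_poly r) \<dots> (\<Sum>t\<in>{0..<int r}. monom (\<chi> t ^ q) (q * nat t) ^ q)"
    by (rule freshmans_dream_sum[OF assms])
  also have "\<dots> = (\<Sum>t\<in>{0..<int r}. monom (\<chi> t ^ q\<^sup>2) (q\<^sup>2 * nat t))"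
    by (simp add: monom_power power_mult[symmetric] power2_eq_square mult_ac)
  finally show ?thesis .
qed

text \<open>On the right the coefficient at n mod r comes from t = 1, where \<chi> is 1.\<close>

lemma scale_coeff:
  assumes "\<not> r dvd n" "k > 0" "i = n mod r"
    and "cong2 (of_nat q) (unity_poly r) (group_ring r f) (\<Sum>t\<in>{0..<int r}. monom (\<chi> t ^ k) (n * nat t))"
  shows "of_nat q dvd f (int i) - 1"
proof -
  have "coprime (int n) (int r)"
    using assms(1) prime_r prime_imp_coprime[of r n] by (simp add: coprime_commute)
  then obtain n' where n': "[int n * n' = 1] (mod int r)" using cong_solve_coprime_int by blast
  then have n'': "[n' * int n = 1] (mod int r)" by (simp add: mult.commute)
  have "cong2 (of_nat q) (unity_poly r) (group_ring r f) (group_ring r (\<lambda>u. \<chi> (n' * u) ^ k))"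
    by (rule cong2_trans[OF assms(4) group_ring_scale[OF r_pos _ n'']]) (simp add: chi_mod)
  then have "of_nat q dvd f (int i) - \<chi> (n' * int i) ^ k"
    unfolding assms(3) using mod_less_divisor[OF r_pos, of n] by (rule group_ring_cong_imp_dvd)
  moreover have "\<chi> (n' * int i) = 1"
  proof -
    have "[n' * int i = n' * int n] (mod int r)"
      unfolding assms(3) by (intro cong_mult cong_refl) (simp add: cong_def zmod_int)
    then have "[n' * int i = 1] (mod int r)" using n'' by (rule cong_trans)
    then have "\<chi> (n' * int i mod int r) = \<chi> (1 mod int r)" by (simp only: cong_def)
    then show ?thesis by (simp only: chi_mod chi_1)
  qed
  ultimately show ?thesis by simp
qed

text \<open>G^3 is J D exactly and the sum of the X^(3t) modulo 3; at the exponent 3 mod r, nonzero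
  because r is not 3, this reads -J = 1. It follows that \<open>J\<close> satisfies the divisibility
  condition of \<open>cubic_reciprocal_exists\<close>.\<close>

lemma J_cong_minus_1:
  assumes "r \<noteq> 3"
  shows "3 dvd J + 1"
proof -
  have 3: "\<not> r dvd 3" using assms prime_r primes_dvd_imp_eq[of r 3] by auto
  have "cong2 (of_nat 3) (unity_poly r) (group_ring r (\<lambda>u. J * \<delta> u))
      (\<Sum>t\<in>{0..<int r}. monom (\<chi> t ^ 3) (3 * nat t))"
    unfolding group_ring_smult
    by (rule cong2_trans[OF cong2_sym[OF G_cube] frobenius_G]) simp
  from scale_coeff[OF 3 _ refl this] have "3 dvd J * \<delta> (int (3 mod r)) - 1" by simp
  moreover have "3 mod r \<noteq> 0" using 3 by (simp add: dvd_eq_mod_eq_0)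
  ultimately have "3 dvd - (J + 1)" by (simp split: if_splits)
  then show ?thesis by (simp only: dvd_minus_iff)
qed

text \<open>G to the power q^2 is (r J)^m G by \<open>G_power\<close>, and modulo q it is the
  Frobenius image. The coefficient at q^2 mod r gives (r J)^m \<chi>(q)^2 = 1, and \<chi>(q)^3 = 1
  solves this for the power. The factor r is the norm of J.\<close>

theorem reciprocity:
  assumes "prime q" "q \<noteq> r" "q\<^sup>2 = 3 * m + 1"
  shows "of_nat q dvd (J * of_int (enorm J)) ^ m - \<chi> (int q)"
proof -
  let ?a = "(of_nat r * J) ^ m"
  have nd: "\<not> r dvd q" using assms primes_dvd_imp_eq[OF prime_r] by blast
  then have nd2: "\<not> r dvd q\<^sup>2" using prime_r prime_dvd_power_nat by blast
  have "cong2 (of_nat q) (unity_poly r) (group_ring r (\<lambda>u. ?a * \<chi> u))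
      (\<Sum>t\<in>{0..<int r}. monom (\<chi> t ^ q\<^sup>2) (q\<^sup>2 * nat t))"
    unfolding group_ring_smult
    by (rule cong2_trans[OF cong2_sym[OF G_power[of "of_nat q" m, folded assms(3)]] frobenius_G_square[OF assms(1)]])
  from scale_coeff[OF nd2 _ refl this] have "of_nat q dvd ?a * \<chi> (int (q\<^sup>2 mod r)) - 1"
    using prime_gt_0_nat[OF assms(1)] by simp
  also have "\<chi> (int (q\<^sup>2 mod r)) = \<chi> (int q) ^ 2"
    by (simp add: zmod_int chi_mod chi_power)
  finally have "of_nat q dvd (?a * \<chi> (int q) ^ 2 - 1) * \<chi> (int q)" by (rule dvd_mult2)
  also have "(?a * \<chi> (int q) ^ 2 - 1) * \<chi> (int q) = ?a * \<chi> (int q) ^ 3 - \<chi> (int q)"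
    by (simp add: power2_eq_square power3_eq_cube algebra_simps)
  also have "\<chi> (int q) ^ 3 = 1" using nd by (intro chi_cube) simp
  finally show ?thesis by (simp add: enorm_J mult.commute)
qed

end

lemma fermat_int:
  assumes "prime p" "\<not> int p dvd x"
  shows "[x ^ (p - 1) = 1] (mod int p)"
proof -
  define a where "a = nat (x mod int p)"
  have a: "int a = x mod int p" using prime_gt_0_nat[OF assms(1)] by (simp add: a_def)
  have "\<not> p dvd a" using assms(2) a by (metis dvd_mod_iff dvd_refl int_dvd_int_iff)
  with assms(1) have "[a ^ (p - 1) = 1] (mod p)" by (rule fermat_theorem)
  then have "[int a ^ (p - 1) = 1] (mod int p)" by (metis cong_int_iff of_nat_1 of_nat_power)
  moreover have "[x = int a] (mod int p)" by (simp add: a)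
  ultimately show ?thesis using cong_pow cong_trans by blast
qed

section \<open>The cubic residue symbol for Eisenstein integers\<close>

text \<open>The character sends a power of a primitive root to the same power of \<omega>.\<close>

lemma cubic_character_exists:
  assumes "prime r" "[r = 1] (mod 3)"
  obtains \<chi> where "cubic_character r \<chi>"
proof -
  have r: "r > 1" using assms(1) by (rule prime_gt_1_nat)
  obtain g where g: "residue_primroot r g" using prime_primitive_root_exists[OF r assms(1)] by blast
  have ord_g: "ord r g = r - 1" and cop_g: "coprime r g"
    using g assms(1) by (auto simp: residue_primroot_def totient_prime)
  have dvd3: "3 dvd r - 1" using assms(2) r cong_to_1_nat by blast
  have ex: "\<exists>i. [a = int g ^ i] (mod int r)" if "\<not> int r dvd a" for a
  proof -
    define b where "b = nat (a mod int r)"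
    have b: "int b = a mod int r" using r by (simp add: b_def)
    have "b \<noteq> 0" using that b by (metis dvd_eq_mod_eq_0 of_nat_0)
    moreover have "b < r" using b r by (metis of_nat_0_less_iff of_nat_less_iff pos_mod_bound
          less_trans zero_less_one)
    ultimately have "b \<in> totatives r"
      using assms(1) by (simp add: totatives_prime)
    moreover have "bij_betw (\<lambda>i. g ^ i mod r) {..<totient r} (totatives r)"
      using residue_primroot_is_generator[OF r g] .
    ultimately obtain i where "b = g ^ i mod r" by (auto simp: bij_betw_def)
    then have "[a = int g ^ i] (mod int r)" using b by (simp add: cong_def zmod_int)
    then show ?thesis by blast
  qed
  \<comment> \<open>Discrete logarithms are determined modulo r - 1, a multiple of 3, so the power
    of \<omega> does not depend on their choice.\<close>
  have uniq: "\<omega> ^ i = \<omega> ^ j" if "[int g ^ i = int g ^ j] (mod int r)" for i j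
  proof -
    have "[g ^ i = g ^ j] (mod r)" using that by (simp flip: cong_int_iff)
    then have "[i = j] (mod (r - 1))" using order_divides_expdiff[OF cop_g, of i j] ord_g by simp
    then have "[i = j] (mod 3)" using dvd3 by (rule cong_dvd_modulus_nat)
    then show ?thesis by (metis cong_def omega_power_mod)
  qed
  define \<chi> where "\<chi> a = (if int r dvd a then 0 else \<omega> ^ (SOME i. [a = int g ^ i] (mod int r)))" for a
  have chi: "\<chi> a = \<omega> ^ i" if "[a = int g ^ i] (mod int r)" for a i
  proof -
    have "\<not> int r dvd int g ^ i"
      using cop_g assms(1) r by (metis coprime_absorb_left coprime_int_iff coprime_power_right_iff
          int_ops(2) of_nat_power of_nat_dvd_iff not_prime_1 prime_dvd_power_nat nat_dvd_1_iff_1)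
    then have nd: "\<not> int r dvd a" using that cong_dvd_iff by blast
    then have "[a = int g ^ (SOME i. [a = int g ^ i] (mod int r))] (mod int r)"
      using ex someI_ex by fast
    then have "[int g ^ (SOME i. [a = int g ^ i] (mod int r)) = int g ^ i] (mod int r)"
      using that cong_sym cong_trans by blast
    then show ?thesis using nd uniq by (simp add: \<chi>_def)
  qed
  have "cubic_character r \<chi>"
  proof
    fix a b
    show "\<chi> (a * b) = \<chi> a * \<chi> b"
    proof (cases "int r dvd a \<or> int r dvd b")
      case True
      then show ?thesis by (auto simp: \<chi>_def)
    next
      case False
      then obtain i j where ij: "[a = int g ^ i] (mod int r)" "[b = int g ^ j] (mod int r)"
        using ex by meson
      then have "[a * b = int g ^ (i + j)] (mod int r)" unfolding power_add by (rule cong_mult)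
      then show ?thesis using chi ij by (metis power_add)
    qed
  next
    fix a
    show "\<chi> (a mod int r) = \<chi> a" unfolding \<chi>_def by (simp add: cong_def dvd_mod_iff)
  next
    fix a assume "int r dvd a"
    then show "\<chi> a = 0" by (simp add: \<chi>_def)
  next
    fix a assume "\<not> int r dvd a"
    then obtain i where "[a = int g ^ i] (mod int r)" using ex by blast
    then have "\<chi> a = \<omega> ^ (i mod 3)" using chi omega_power_mod by simp
    moreover have "i mod 3 \<in> {0, 1, 2}" by auto
    ultimately show "\<chi> a \<in> {1, \<omega>, \<omega>\<^sup>2}" by auto
  next
    have "\<chi> (int g) = \<omega>" using chi[of "int g" 1] by simp
    moreover have "\<omega> \<noteq> 1" by (metis omega_sel(1) eis_sel(3) zero_neq_one)
    moreover have "\<not> int r dvd int g"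
      using cop_g r by (metis coprime_absorb_left int_dvd_int_iff nat_dvd_1_iff_1 less_irrefl)
    ultimately show "\<exists>a. \<not> int r dvd a \<and> \<chi> a \<noteq> 1" by metis
  qed (fact assms(1))
  then show ?thesis by (rule that)
qed

text \<open>
  For a rational prime \<open>q\<close> with \<open>q\<^sup>2 = 3m + 1\<close>, the power \<open>(A N(A))\<^sup>m\<close> modulo \<open>q\<close> is the cubic
  residue symbol of \<open>A\<close> modulo \<open>q\<close>: the factor \<open>N(A)\<close> makes one formula serve the split and the
  inert primes \<open>q\<close>.
\<close>

definition cubic_reciprocal :: "eis \<Rightarrow> (int \<Rightarrow> eis) \<Rightarrow> bool" where
  "cubic_reciprocal A \<chi> \<longleftrightarrow>
     (\<forall>a b. \<chi> (a * b) = \<chi> a * \<chi> b) \<and>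
     (\<forall>a b. [a = b] (mod enorm A) \<longrightarrow> \<chi> a = \<chi> b) \<and>
     (\<forall>a. coprime a (enorm A) \<longrightarrow> \<chi> a \<in> {1, \<omega>, \<omega>\<^sup>2}) \<and>
     (\<forall>q m. prime q \<longrightarrow> \<not> int q dvd enorm A \<longrightarrow> q\<^sup>2 = 3 * m + 1 \<longrightarrow>
        of_nat q dvd (A * of_int (enorm A)) ^ m - \<chi> (int q))"

lemma cubic_reciprocalD:
  assumes "cubic_reciprocal A \<chi>"
  shows "\<chi> (a * b) = \<chi> a * \<chi> b"
    and "[a = b] (mod enorm A) \<Longrightarrow> \<chi> a = \<chi> b"
    and "coprime a (enorm A) \<Longrightarrow> \<chi> a \<in> {1, \<omega>, \<omega>\<^sup>2}"
    and "prime q \<Longrightarrow> \<not> int q dvd enorm A \<Longrightarrow> q\<^sup>2 = 3 * m + 1 \<Longrightarrow>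
      of_nat q dvd (A * of_int (enorm A)) ^ m - \<chi> (int q)"
  using assms unfolding cubic_reciprocal_def by blast+

lemma cube_roots_mult_closed:
  "a \<in> {1, \<omega>, \<omega>\<^sup>2} \<Longrightarrow> b \<in> {1, \<omega>, \<omega>\<^sup>2} \<Longrightarrow> a * b \<in> {1, \<omega>, \<omega>\<^sup>2}"
proof -
  have "\<omega> * \<omega>\<^sup>2 = 1" "\<omega>\<^sup>2 * \<omega> = 1" "\<omega>\<^sup>2 * \<omega>\<^sup>2 = \<omega>" "\<omega> * \<omega> = \<omega>\<^sup>2"
    by (rule eis_eqI; simp add: power2_eq_square)+
  then show "a \<in> {1, \<omega>, \<omega>\<^sup>2} \<Longrightarrow> b \<in> {1, \<omega>, \<omega>\<^sup>2} \<Longrightarrow> a * b \<in> {1, \<omega>, \<omega>\<^sup>2}" by auto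
qed

lemma cubic_reciprocal_mult:
  assumes "cubic_reciprocal A \<chi>" "cubic_reciprocal B \<psi>"
  shows "cubic_reciprocal (A * B) (\<lambda>a. \<chi> a * \<psi> a)"
  unfolding cubic_reciprocal_def
proof (intro conjI allI impI)
  fix a b
  show "\<chi> (a * b) * \<psi> (a * b) = \<chi> a * \<psi> a * (\<chi> b * \<psi> b)"
    using assms by (simp add: cubic_reciprocal_def mult_ac)
next
  fix a b assume "[a = b] (mod enorm (A * B))"
  then have "[a = b] (mod enorm A)" "[a = b] (mod enorm B)"
    by (auto simp: enorm_mult intro: cong_dvd_modulus)
  then show "\<chi> a * \<psi> a = \<chi> b * \<psi> b" using assms by (metis cubic_reciprocal_def)
next
  fix a assume "coprime a (enorm (A * B))"
  then show "\<chi> a * \<psi> a \<in> {1, \<omega>, \<omega>\<^sup>2}"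
    using assms unfolding cubic_reciprocal_def enorm_mult
    by (intro cube_roots_mult_closed) simp_all
next
  fix q m assume q: "prime q" "\<not> int q dvd enorm (A * B)" "q\<^sup>2 = 3 * m + 1"
  then have "\<not> int q dvd enorm A" "\<not> int q dvd enorm B" by (auto simp: enorm_mult)
  then have "cong2 (of_nat q) 0 ((A * of_int (enorm A)) ^ m) (\<chi> (int q))"
    "cong2 (of_nat q) 0 ((B * of_int (enorm B)) ^ m) (\<psi> (int q))"
    using assms q by (simp_all add: cubic_reciprocal_def cong2_0_iff)
  then have "cong2 (of_nat q) 0 ((A * of_int (enorm A)) ^ m * (B * of_int (enorm B)) ^ m)
      (\<chi> (int q) * \<psi> (int q))"
    by (rule cong2_mult)
  then show "of_nat q dvd (A * B * of_int (enorm (A * B))) ^ m - \<chi> (int q) * \<psi> (int q)"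
    by (simp add: cong2_0_iff enorm_mult power_mult_distrib mult_ac)
qed

lemma cubic_reciprocal_econj:
  assumes "cubic_reciprocal A \<chi>"
  shows "cubic_reciprocal (econj A) (\<lambda>a. econj (\<chi> a))"
  unfolding cubic_reciprocal_def
proof (intro conjI allI impI)
  fix a assume "coprime a (enorm (econj A))"
  then have "\<chi> a \<in> {1, \<omega>, \<omega>\<^sup>2}" using assms by (simp add: cubic_reciprocal_def)
  moreover have "econj (\<omega>\<^sup>2) = \<omega>" by (rule eis_eqI) (simp_all add: power2_eq_square)
  ultimately show "econj (\<chi> a) \<in> {1, \<omega>, \<omega>\<^sup>2}" by (auto simp: econj_omega simp del: econj_power)
next
  fix q m assume "prime q" "\<not> int q dvd enorm (econj A)" "q\<^sup>2 = 3 * m + 1"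
  then have "of_nat q dvd (A * of_int (enorm A)) ^ m - \<chi> (int q)"
    using assms by (simp add: cubic_reciprocal_def)
  then obtain w where "(A * of_int (enorm A)) ^ m - \<chi> (int q) = of_nat q * w" by (rule dvdE)
  then have "(A * of_int (enorm A)) ^ m = \<chi> (int q) + of_int (int q) * w"
    by (metis add.commute diff_add_cancel of_int_of_nat_eq)
  from arg_cong[OF this, of econj]
  have "(econj A * of_int (enorm A)) ^ m - econj (\<chi> (int q)) = of_nat q * econj w"
    by simp
  then show "of_nat q dvd (econj A * of_int (enorm (econj A))) ^ m - econj (\<chi> (int q))" by simp
qed (use assms in \<open>auto simp: cubic_reciprocal_def\<close>)

lemma (in cubic_character) cubic_reciprocal_J: "cubic_reciprocal J \<chi>"
  unfolding cubic_reciprocal_def enorm_J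
proof (intro conjI allI impI)
  fix a b assume "[a = b] (mod int r)"
  then show "\<chi> a = \<chi> b" by (metis chi_mod cong_def)
next
  fix a assume "coprime a (int r)"
  then have "\<not> int r dvd a" using r_gt_1 coprime_absorb_right[of "int r" a] by auto
  then show "\<chi> a \<in> {1, \<omega>, \<omega>\<^sup>2}" by (rule chi_values)
next
  fix q m assume "prime q" "\<not> int q dvd int r" "q\<^sup>2 = 3 * m + 1"
  then show "of_nat q dvd (J * of_int (int r)) ^ m - \<chi> (int q)"
    using reciprocity[of q m] by (cases "q = r") (simp_all add: enorm_J)
qed (simp_all add: chi_mult)

lemma cubic_reciprocal_unit:
  assumes "A = 1 \<or> A = - 1"
  shows "cubic_reciprocal A (\<lambda>_. 1)"
proof -
  have N: "enorm A = 1" using assms by (auto simp: enorm_def)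
  have "of_nat q dvd A ^ m - 1" if "q\<^sup>2 = 3 * m + 1" "prime q" for q m
  \<comment> \<open>For A = -1 the sign disappears because m is even for odd q; for q = 2, where m =
    1 is odd, 1 and -1 agree modulo 2.\<close>
  proof (cases "q = 2")
    case True
    with that have "m = 1" by simp
    then show ?thesis using assms True by auto
  next
    case False
    then have "odd q" using \<open>prime q\<close> primes_dvd_imp_eq two_is_prime_nat by blast
    then have "odd (q\<^sup>2)" by simp
    then have "even m" using that by simp
    then show ?thesis using assms by auto
  qed
  then show ?thesis by (auto simp: cubic_reciprocal_def N)
qed

text \<open>The norm a^2 - ab + b^2 divides a^3 + b^3, so -a and b have the same cube modulo r. If r
  = 2 modulo 3, cubing is injective on nonzero residues by Fermat, whence a = -b and the norm is 3
  b^2.\<close>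

lemma prime_dvd_enorm_cong_1:
  assumes "prime r" "r \<noteq> 3" "int r dvd enorm A" "coprime (re A) (om A)"
  shows "[r = 1] (mod 3)"
proof (rule ccontr)
  assume n1: "\<not> [r = 1] (mod 3)"
  define a b where "a = re A" and "b = om A"
  have N: "int r dvd a\<^sup>2 - a * b + b\<^sup>2" using assms(3) by (simp add: enorm_def a_def b_def)
  have pr: "prime (int r)" using assms(1) by simp
  have rb: "\<not> int r dvd b"
  proof
    assume "int r dvd b"
    moreover from this have "int r dvd a\<^sup>2 - a * b + b\<^sup>2 - b * (b - a)"
      using N by (intro dvd_diff) auto
    then have "int r dvd a\<^sup>2" by (simp add: algebra_simps power2_eq_square)
    then have "int r dvd a" using pr prime_dvd_power by blast
    ultimately show False using assms(4) pr by (metis a_def b_def coprime_common_divisor not_prime_unit)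
  qed
  have ra: "\<not> int r dvd a"
  proof
    assume "int r dvd a"
    then have "int r dvd a\<^sup>2 - a * b + b\<^sup>2 - a * (a - b)" using N by (intro dvd_diff) auto
    then have "int r dvd b\<^sup>2" by (simp add: algebra_simps power2_eq_square)
    then show False using pr rb prime_dvd_power by blast
  qed
  have "r mod 3 \<noteq> 0" using assms(1,2) primes_dvd_imp_eq[of 3 r] by (auto simp: dvd_eq_mod_eq_0)
  moreover have "r mod 3 \<noteq> 1" using n1 by (simp add: cong_def)
  ultimately have r2: "r mod 3 = 2" by arith
  define k where "k = r div 3"
  have k: "r - 1 = 3 * k + 1" using r2 unfolding k_def by presburger
  have cube: "[(- a) ^ 3 = b ^ 3] (mod int r)"
  proof -
    have "int r dvd (- (a + b)) * (a\<^sup>2 - a * b + b\<^sup>2)" using N by (rule dvd_mult)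
    also have "(- (a + b)) * (a\<^sup>2 - a * b + b\<^sup>2) = (- a) ^ 3 - b ^ 3"
      by (simp add: power2_eq_square power3_eq_cube algebra_simps)
    finally show ?thesis by (simp add: cong_iff_dvd_diff)
  qed
  have fermat: "[x ^ (r - 1) = 1] (mod int r)" if "\<not> int r dvd x" for x
    using fermat_int[OF assms(1) that] .
  have c: "[((- a) ^ 3) ^ k = (b ^ 3) ^ k] (mod int r)" using cube by (rule cong_pow)
  have "[(- a) ^ (r - 1) = b ^ (r - 1)] (mod int r)"
    using fermat[of "- a"] fermat[of b] ra rb cong_sym cong_trans by (metis dvd_minus_iff)
  then have "[((- a) ^ 3) ^ k * (- a) = (b ^ 3) ^ k * b] (mod int r)"
    by (simp only: k power_add power_mult power_one_right)
  moreover have "[((- a) ^ 3) ^ k * (- a) = (b ^ 3) ^ k * (- a)] (mod int r)"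
    using c by (intro cong_mult cong_refl)
  ultimately have "[(b ^ 3) ^ k * (- a) = (b ^ 3) ^ k * b] (mod int r)"
    using cong_sym cong_trans by blast
  moreover have "coprime ((b ^ 3) ^ k) (int r)"
    using rb pr prime_imp_coprime[of "int r" b] by (auto simp: coprime_commute)
  ultimately have "[- a = b] (mod int r)" using cong_mult_lcancel by blast
  then have "int r dvd - (- a - b)" unfolding cong_iff_dvd_diff dvd_minus_iff .
  then have "int r dvd a + b" by (simp add: add.commute)
  then have "int r dvd (a + b) * (a - 2 * b) - (a\<^sup>2 - a * b + b\<^sup>2)" using N by (intro dvd_diff) auto
  also have "(a + b) * (a - 2 * b) - (a\<^sup>2 - a * b + b\<^sup>2) = - (3 * b\<^sup>2)"
    by (simp add: power2_eq_square algebra_simps)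
  finally have "int r dvd 3 * b\<^sup>2" by simp
  then have "int r dvd 3" using pr rb by (metis prime_dvd_mult_iff prime_dvd_power)
  then have "r dvd 3" by presburger
  then show False using assms(1,2) primes_dvd_imp_eq[of r 3] by auto
qed

text \<open>The product of the \<omega>-coordinates of A K for K = J and K = \<open>econj J\<close>
  is a combination of the two norms, so r divides one of them. Since r also divides the norm of that
  A K, it divides A K itself; cancelling K in r = K (\<open>econj K\<close>) leaves the
  claim.\<close>

lemma dvd_if_norm_dvd:
  assumes "prime (int r)" "enorm J = int r" "int r dvd enorm A"
  shows "J dvd A \<or> econj J dvd A"
proof -
  define a b c d where "a = re A" "b = om A" "c = re J" "d = om J"
  note defs = this
  have *: "econj K dvd A" if "int r dvd om (A * K)" "enorm K = int r" for K
  proof -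
    have "int r dvd enorm (A * K)" using that by (simp add: enorm_mult)
    then have "int r dvd (re (A * K))\<^sup>2 - om (A * K) * (re (A * K) - om (A * K))"
      by (simp add: enorm_def power2_eq_square algebra_simps del: eis_sel)
    moreover have "int r dvd om (A * K) * (re (A * K) - om (A * K))" using that(1)
      by (rule dvd_mult2)
    ultimately have "int r dvd (re (A * K))\<^sup>2" by (metis diff_add_cancel dvd_add)
    then have "int r dvd re (A * K)" using assms(1) prime_dvd_power by blast
    then have "of_int (int r) dvd A * K" using that(1) unfolding of_int_dvd_eis_iff by blast
    then obtain B where "A * K = of_int (int r) * B" by (auto elim: dvdE)
    also have "of_int (int r) = K * econj K" using that by (simp add: mult_econj)
    finally have "K * A = K * (econj K * B)" by (simp add: mult_ac)
    moreover have "K \<noteq> 0" using that assms(1) by (auto simp: enorm_def)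
    ultimately show ?thesis by simp
  qed
  have "om (A * econj J) * om (A * J) = b\<^sup>2 * enorm J - d\<^sup>2 * enorm A"
    by (simp add: enorm_def defs power2_eq_square algebra_simps)
  then have "int r dvd om (A * econj J) * om (A * J)" using assms by simp
  then have "int r dvd om (A * econj J) \<or> int r dvd om (A * J)"
    using assms(1) by (simp only: prime_dvd_mult_iff)
  then show ?thesis using *[of J] *[of "econj J"] assms(2) by auto
qed

text \<open>Induction on the norm, splitting off a Jacobi sum or its conjugate. Coprime coordinates
  exclude inert prime factors; divisibility of the \<omega>-coordinate by 3 passes to the cofactor
  because the split-off factor has it too.\<close>

theorem cubic_reciprocal_exists:
  assumes "3 dvd om A" "coprime (re A) (om A)"
  shows "\<exists>\<chi>. cubic_reciprocal A \<chi>"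
  using assms
proof (induction "nat (enorm A)" arbitrary: A rule: less_induct)
  case (less A)
  have re3: "\<not> 3 dvd re A"
  proof
    assume "3 dvd re A"
    then have "is_unit (3 :: int)" using less.prems by (meson coprime_common_divisor)
    then show False by simp
  qed
  have pos: "enorm A > 0"
    using less.prems enorm_nonneg[of A] enorm_eq_0_iff[of A] by (cases "A = 0") auto
  show ?case
  proof (cases "enorm A = 1")
    case True
    \<comment> \<open>Of the six units only 1 and -1 have an \<omega>-coordinate divisible by
      3.\<close>
    obtain b where b: "om A = 3 * b" using less.prems by (auto elim: dvdE)
    have "(2 * re A - om A)\<^sup>2 + 27 * b\<^sup>2 = 4" using four_enorm[of A] True b
      by (simp add: power_mult_distrib)
    then have "b\<^sup>2 < 1" by (smt (verit) zero_le_power2)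
    then have "b = 0" by (smt (verit) zero_less_power2 power2_less_eq_zero_iff)
    then have "om A = 0" "(re A)\<^sup>2 = 1" using b True by (auto simp: enorm_def)
    then have "A = 1 \<or> A = - 1" by (auto simp: power2_eq_1_iff intro: eis_eqI)
    then show ?thesis using cubic_reciprocal_unit by blast
  next
    case False
    then have "nat (enorm A) \<noteq> 1" using pos by simp
    then obtain r where r: "prime r" "r dvd nat (enorm A)" using prime_factor_nat by blast
    then have rN: "int r dvd enorm A" using pos by (metis int_dvd_int_iff nat_0_le less_imp_le)
    have "\<not> 3 dvd enorm A"
    proof
      assume "3 dvd enorm A"
      then have "3 dvd enorm A - om A * (om A - re A)" using less.prems by (intro dvd_diff) auto
      then have "3 dvd (re A)\<^sup>2" by (simp add: enorm_def algebra_simps power2_eq_square)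
      then show False using re3 prime_dvd_power[of "3 :: int"] by auto
    qed
    then have r3: "r \<noteq> 3" using rN by auto
    have r1: "[r = 1] (mod 3)" using r r3 rN less.prems by (intro prime_dvd_enorm_cong_1)
    obtain \<chi> where "cubic_character r \<chi>" using cubic_character_exists[OF r(1) r1] .
    then interpret cubic_character r \<chi> .
    have "3 dvd J + 1" using J_cong_minus_1[OF r3] .
    then have J3: "3 dvd om J" "3 dvd re J + 1" using of_int_dvd_eis_iff[of 3 "J + 1"] by auto
    have "\<exists>K \<psi>. cubic_reciprocal K \<psi> \<and> K dvd A \<and> enorm K = int r \<and> 3 dvd om K \<and> \<not> 3 dvd re K"
    proof -
      have "J dvd A \<or> econj J dvd A" using r rN enorm_J by (intro dvd_if_norm_dvd) auto
      moreover have "\<not> 3 dvd re J" using J3 by presburger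
      moreover have "3 dvd om (econj J)" using J3 by simp
      moreover have "\<not> 3 dvd re (econj J)" using J3 unfolding econj_sel by presburger
      ultimately show ?thesis using J3 enorm_J cubic_reciprocal_J cubic_reciprocal_econj[OF cubic_reciprocal_J]
        by (metis enorm_simps(3))
    qed
    then obtain K \<psi> B where K: "cubic_reciprocal K \<psi>" "A = K * B" "enorm K = int r" "3 dvd om K" "\<not> 3 dvd re K"
      unfolding dvd_def[of _ A] by blast
    have "enorm A = int r * enorm B" using K by (simp add: enorm_mult)
    moreover from this have "enorm B > 0" using pos by (simp add: zero_less_mult_iff)
    ultimately have "enorm B < enorm A" using prime_gt_1_nat[OF r(1)] by simp
    then have lt: "nat (enorm B) < nat (enorm A)" using pos by simp
    have omA: "om A = re K * om B + om K * re B - om K * om B"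
      and reA: "re A = re K * re B - om K * om B" using K by simp_all
    have "3 dvd om A - om K * (re B - om B)" using K less.prems by (intro dvd_diff) auto
    then have "3 dvd re K * om B" by (simp add: omA algebra_simps)
    then have "3 dvd om B" using K by (simp add: prime_dvd_mult_iff)
    moreover have "coprime (re B) (om B)"
    proof (rule coprimeI)
      fix e assume "e dvd re B" "e dvd om B"
      then have "e dvd re A" "e dvd om A" unfolding omA reA by auto
      then show "is_unit e" using less.prems by (meson coprime_common_divisor)
    qed
    ultimately obtain \<psi>' where "cubic_reciprocal B \<psi>'" using less.hyps[OF lt] by blast
    then show ?thesis using K cubic_reciprocal_mult by blast
  qed
qed

section \<open>The cubic residue symbol of \<open>x + y \<theta>\<close>\<close>

definition \<theta> :: eis where "\<theta> = Eis 1 2"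

lemma theta_sel [simp]: "re \<theta> = 1" "om \<theta> = 2"
  by (simp_all add: \<theta>_def)

lemma theta_square: "\<theta>\<^sup>2 = - 3"
  by (rule eis_eqI) (simp_all add: power2_eq_square)

lemma cong2_of_int:
  "[a = b] (mod int q) \<Longrightarrow> cong2 (of_nat q) n (of_int a) (of_int b :: eis)"
  by (intro cong2_of_dvd_left) (simp add: of_nat_dvd_eis_iff cong_iff_dvd_diff)

lemma square_eq:
  assumes "\<not> 3 dvd (a :: int)"
  obtains k where "a\<^sup>2 = 3 * int k + 1"
proof -
  have "a mod 3 = 1 \<or> a mod 3 = 2" using assms by presburger
  then obtain b where "a = 3 * b + 1 \<or> a = 3 * b + 2" by (metis mult_div_mod_eq)
  then have "a\<^sup>2 = 3 * (3 * b\<^sup>2 + 2 * b) + 1 \<or> a\<^sup>2 = 3 * (3 * b\<^sup>2 + 4 * b + 1) + 1"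
    by (auto simp: power2_eq_square algebra_simps)
  then obtain c where c: "a\<^sup>2 = 3 * c + 1" by blast
  then have "c \<ge> 0" using zero_le_power2[of a] by linarith
  then show ?thesis using c that[of "nat c"] by simp
qed

lemma prime_square_eq:
  assumes "prime q" "q \<noteq> 3"
  obtains m :: nat where "q\<^sup>2 = 3 * m + 1"
proof -
  have "\<not> 3 dvd q" using assms primes_dvd_imp_eq[of 3 q] by auto
  then have "\<not> 3 dvd int q" by presburger
  then obtain m where "(int q)\<^sup>2 = 3 * int m + 1" using square_eq by blast
  then have "int (q\<^sup>2) = int (3 * m + 1)" by simp
  then show ?thesis using that by (simp only: of_nat_eq_iff)
qed

lemma prime_square_even:
  assumes "prime (p :: nat)" "p > 3" "p\<^sup>2 = 3 * M + 1"
  shows "even M"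
proof -
  have "odd (p\<^sup>2)" using assms(1,2) prime_odd_nat[of p] by simp
  then show ?thesis using assms(3) by simp
qed

lemma power_square_minus_1:
  assumes "q\<^sup>2 = 3 * m + (1 :: nat)"
  shows "3 * m = (q - 1) * (q + 1)"
  using assms by (cases q) (simp_all add: power2_eq_square algebra_simps)

text \<open>The exponent 3m is q^2 - 1, a multiple of q - 1: integers have trivial cubic
  symbol.\<close>

lemma int_cube_power_cong:
  assumes "prime q" "q\<^sup>2 = 3 * m + 1" "\<not> int q dvd c"
  shows "cong2 (of_nat q) 0 ((of_int c ^ 3) ^ m) (1 :: eis)"
proof -
  have "[(c ^ (q - 1)) ^ (q + 1) = 1 ^ (q + 1)] (mod int q)"
    by (intro cong_pow fermat_int assms)
  then have "[(c ^ 3) ^ m = 1] (mod int q)"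
    by (simp only: power_mult[symmetric] power_square_minus_1[OF assms(2)] power_one)
  then show ?thesis using cong2_of_int[of "(c ^ 3) ^ m" 1 q 0] by simp
qed

text \<open>For odd q the exponent 3m = (q - 1)(q + 1) is even, so the power is one of the integer
  \<theta>^2 = -3 with exponent a multiple of q - 1.\<close>

lemma theta_cube_power_cong:
  assumes "prime q" "q > 3" "q\<^sup>2 = 3 * m + 1"
  shows "cong2 (of_nat q) 0 ((\<theta> ^ 3) ^ m) (1 :: eis)"
proof -
  have "\<not> q dvd 3" using assms by (auto dest: dvd_imp_le)
  then have "\<not> int q dvd - 3" by (metis dvd_minus_iff int_dvd_int_iff of_nat_numeral)
  then have "[((- 3) ^ (q - 1)) ^ ((q + 1) div 2) = 1 ^ ((q + 1) div 2)] (mod int q)"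
    by (intro cong_pow fermat_int assms)
  then have c: "[(- 3) ^ ((q - 1) * ((q + 1) div 2)) = 1] (mod int q)"
    by (simp only: power_mult power_one)
  have "odd q" using assms(1,2) prime_odd_nat[of q] by simp
  then have "3 * m = 2 * ((q - 1) * ((q + 1) div 2))"
    using power_square_minus_1[OF assms(3)] by (auto elim!: oddE)
  then have "(\<theta> ^ 3) ^ m = (\<theta>\<^sup>2) ^ ((q - 1) * ((q + 1) div 2))"
    by (metis power_mult)
  also have "\<dots> = of_int ((- 3) ^ ((q - 1) * ((q + 1) div 2)))" by (simp only: theta_square) simp
  finally show ?thesis using cong2_of_int[OF c, of 0] by simp
qed

text \<open>At a prime a other than 3 this is the cubic residue symbol of \<omega> modulo a. On
  integers prime to 3 it is multiplicative and depends only on a modulo 9.\<close>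

definition omega_symbol :: "int \<Rightarrow> eis" where
  "omega_symbol a = \<omega> ^ nat ((a\<^sup>2 - 1) div 3)"

lemma omega_symbol_eq: "a\<^sup>2 = 3 * int k + 1 \<Longrightarrow> omega_symbol a = \<omega> ^ k"
  by (simp add: omega_symbol_def)

lemma omega_symbol_nat_eq:
  assumes "n\<^sup>2 = 3 * k + 1"
  shows "omega_symbol (int n) = \<omega> ^ k"
proof (rule omega_symbol_eq)
  have "int (n\<^sup>2) = int (3 * k + 1)" by (simp only: assms)
  then show "(int n)\<^sup>2 = 3 * int k + 1" by simp
qed

lemma omega_symbol_mult:
  assumes "\<not> 3 dvd a" "\<not> 3 dvd b"
  shows "omega_symbol (a * b) = omega_symbol a * omega_symbol b"
proof -
  obtain k l where kl: "a\<^sup>2 = 3 * int k + 1" "b\<^sup>2 = 3 * int l + 1" using assms square_eq by metis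
  then have "(a * b)\<^sup>2 = 3 * int (3 * (k * l) + (k + l)) + 1"
    by (simp add: power_mult_distrib algebra_simps)
  then have "omega_symbol (a * b) = \<omega> ^ (3 * (k * l) + (k + l))" by (rule omega_symbol_eq)
  also have "\<dots> = \<omega> ^ (k + l)" by (simp add: power_add power_mult)
  finally show ?thesis using kl by (simp add: omega_symbol_eq power_add)
qed

lemma omega_symbol_cube: "omega_symbol a ^ 3 = 1"
  unfolding omega_symbol_def by (metis mult.commute omega_cube power_mult power_one)

lemma omega_symbol_minus [simp]: "omega_symbol (- a) = omega_symbol a"
  by (simp add: omega_symbol_def)

lemma omega_symbol_cong:
  assumes "\<not> 3 dvd a" "\<not> 3 dvd b" "[a = b] (mod 9)"
  shows "omega_symbol a = omega_symbol b"
proof -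
  obtain k l where kl: "a\<^sup>2 = 3 * int k + 1" "b\<^sup>2 = 3 * int l + 1" using assms square_eq by metis
  have "[a\<^sup>2 = b\<^sup>2] (mod 9)" using assms(3) by (rule cong_pow)
  then have "9 dvd 3 * (int k - int l)" using kl by (simp add: cong_iff_dvd_diff algebra_simps)
  then have "3 dvd int k - int l" by presburger
  then have "k mod 3 = l mod 3" by presburger
  then show ?thesis using kl by (metis omega_symbol_eq omega_power_mod)
qed

text \<open>Multiplicativity carries the values from the prime factors to c; the sign is harmless on
  both sides.\<close>

lemma eq_omega_symbol_power:
  fixes \<chi> :: "int \<Rightarrow> eis"
  assumes mult: "\<And>a b. \<chi> (a * b) = \<chi> a * \<chi> b" and one: "\<chi> 1 = 1" and "\<chi> (- 1) = 1"
    and "\<not> 3 dvd c" and pr: "\<And>q. prime q \<Longrightarrow> int q dvd c \<Longrightarrow> \<chi> (int q) = omega_symbol (int q) ^ e"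
  shows "\<chi> c = omega_symbol c ^ e"
proof -
  have nat_case: "\<chi> (int n) = omega_symbol (int n) ^ e"
    if "n > 0" "\<not> 3 dvd int n" "int n dvd c" for n
    using that
  proof (induction n rule: less_induct)
    case (less n)
    show ?case
    proof (cases "n = 1")
      case True
      then show ?thesis by (simp add: one omega_symbol_def)
    next
      case False
      then obtain q where q: "prime q" "q dvd n" using prime_factor_nat by blast
      then obtain l where l: "n = q * l" by (auto elim: dvdE)
      then have ln: "l < n" "l > 0" using less.prems prime_gt_1_nat[OF q(1)] by auto
      have 3: "\<not> 3 dvd int l" "\<not> 3 dvd int q" using less.prems l by auto
      have dvd: "int l dvd c" "int q dvd c" using less.prems l by (auto intro: dvd_trans)
      have "\<chi> (int n) = \<chi> (int q) * \<chi> (int l)" by (simp add: l mult)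
      also have "\<dots> = omega_symbol (int q) ^ e * omega_symbol (int l) ^ e"
        using less.IH[OF ln 3(1) dvd(1)] pr[OF q(1) dvd(2)] by simp
      also have "\<dots> = omega_symbol (int n) ^ e"
        using 3 by (simp add: l omega_symbol_mult power_mult_distrib)
      finally show ?thesis .
    qed
  qed
  have "c \<noteq> 0" using assms by auto
  then have abs: "\<chi> \<bar>c\<bar> = omega_symbol \<bar>c\<bar> ^ e" using nat_case[of "nat \<bar>c\<bar>"] assms by simp
  show ?thesis
  proof (cases "c \<ge> 0")
    case True
    then show ?thesis using abs by simp
  next
    case False
    then have "\<chi> c = \<chi> (- 1) * \<chi> \<bar>c\<bar>" by (simp flip: mult)
    then show ?thesis using abs assms(3) False by simp
  qed
qed

lemma coprime_omega_power_mult: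
  assumes "coprime (re A) (om A)"
  shows "coprime (re (\<omega> ^ j * A)) (om (\<omega> ^ j * A))"
proof (induction j)
  case (Suc j)
  define B where "B = \<omega> ^ j * A"
  have "coprime (- om B) (re B - om B)"
  proof (rule coprimeI)
    fix d assume d: "d dvd - om B" "d dvd re B - om B"
    then have "d dvd om B" by simp
    moreover from this have "d dvd re B" using d(2) by (metis diff_add_cancel dvd_add)
    ultimately show "is_unit d" using Suc by (metis B_def coprime_common_divisor)
  qed
  then have "coprime (re (\<omega> * B)) (om (\<omega> * B))" by simp
  then show ?case by (simp only: B_def power_Suc mult.assoc)
qed (use assms in simp)

context
  fixes x y :: int and A :: eis
  assumes xy: "coprime x y" "odd (x + y)" "\<not> 3 dvd x" and A: "A = of_int x + of_int y * \<theta>"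
begin

lemma A_sel: "re A = x + y" "om A = 2 * y"
  by (simp_all add: A)

lemma enorm_A: "enorm A = x\<^sup>2 + 3 * y\<^sup>2"
  by (simp add: enorm_def A_sel power2_eq_square algebra_simps)

lemma coprime_A: "coprime (re A) (om A)"
proof -
  have "coprime (x + y) 2" using xy by (simp add: coprime_commute)
  moreover have "coprime (x + y) y" using xy by (simp add: coprime_iff_gcd_eq_1)
  ultimately show ?thesis unfolding A_sel by simp
qed

text \<open>Oddness of x + y excludes q = 2, and x prime to 3 excludes q = 3. The norm differs from
  (x - 3ey)(x + 3ey) by 12 y^2.\<close>

lemma prime_dvd_linear_form:
  assumes "prime q" "int q dvd x - 3 * (e * y)" "e\<^sup>2 = 1"
  shows "q > 3" "\<not> int q dvd 2 * y" "\<not> int q dvd enorm A"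
proof -
  have pr: "prime (int q)" using assms(1) by simp
  have y: "\<not> int q dvd y"
  proof
    assume "int q dvd y"
    moreover from this have "int q dvd x - 3 * (e * y) + 3 * (e * y)" using assms(2)
      by (intro dvd_add) auto
    ultimately show False using xy(1) pr by (metis coprime_common_divisor diff_add_cancel not_prime_unit)
  qed
  have "q \<noteq> 2"
  proof
    assume "q = 2"
    then have "even (x - 3 * (e * y))" using assms(2) by simp
    moreover have "odd e" using assms(3) by (metis even_power odd_one zero_less_numeral)
    ultimately show False using xy(2) by simp
  qed
  moreover have "q \<noteq> 3"
  proof
    assume "q = 3"
    then have "3 dvd x - 3 * (e * y) + 3 * (e * y)" using assms(2) by (intro dvd_add) auto
    then show False using xy(3) by simp
  qed
  ultimately show "q > 3" using prime_ge_2_nat[OF assms(1)] by simp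
  have q2: "\<not> int q dvd 2" and q3: "\<not> int q dvd 3"
    using \<open>q > 3\<close> by (auto dest: zdvd_imp_le)
  show "\<not> int q dvd 2 * y" using pr q2 y by (simp add: prime_dvd_mult_iff)
  show "\<not> int q dvd enorm A"
  proof
    assume "int q dvd enorm A"
    then have "int q dvd enorm A - (x - 3 * (e * y)) * (x + 3 * (e * y))"
      using assms(2) by (intro dvd_diff) auto
    also have "enorm A - (x - 3 * (e * y)) * (x + 3 * (e * y)) = 3 * y\<^sup>2 + 9 * (e\<^sup>2 * y\<^sup>2)"
      by (simp add: enorm_A power2_eq_square algebra_simps)
    also have "\<dots> = 2 * 2 * 3 * y\<^sup>2" using assms(3) by simp
    finally show False using pr q2 q3 y by (metis prime_dvd_mult_iff prime_dvd_power)
  qed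
qed

text \<open>Modulo q, x = 3ey and A = y (3e + \<theta>) = -2y \<omega>^i \<theta>. Hence A N(A),
  which is A^2 times the conjugate of A, is -c^3 \<theta>^3 \<omega>^i with c = -2y; the cubes have
  trivial symbol, the sign goes because m is even, and \<omega>^(j+i) remains.\<close>

lemma symbol_at_linear_form:
  assumes "prime q" "int q dvd x - 3 * (e * y)" "(e, i) = (1, 1) \<or> (e, i) = (- 1, 2 :: nat)"
    and \<chi>: "cubic_reciprocal (\<omega> ^ j * A) \<chi>"
  shows "\<chi> (int q) = omega_symbol (int q) ^ (j + i)"
proof -
  have e2: "e\<^sup>2 = 1" using assms(3) by auto
  note lf = prime_dvd_linear_form[OF assms(1,2) e2]
  let ?c = "cong2 (of_nat q) (0 :: eis)"
  have "q \<noteq> 3" using lf by simp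
  then obtain m where m: "q\<^sup>2 = 3 * m + 1" using prime_square_eq assms(1) by blast
  have ev: "even m" using prime_square_even[OF assms(1) lf(1) m] .
  define c where "c = - 2 * y"
  have A1: "?c A (of_int c * \<omega> ^ i * \<theta>)"
  proof -
    have "A - of_int c * \<omega> ^ i * \<theta> = of_int (x - 3 * (e * y))"
      using assms(3) by (auto simp: A c_def power2_eq_square intro!: eis_eqI)
    then show ?thesis using assms(2) by (intro cong2_of_dvd_left) (simp add: of_nat_dvd_eis_iff)
  qed
  have A2: "?c (econj A) (of_int c * econj (\<omega> ^ i) * (- \<theta>))"
  proof -
    have "econj A - of_int c * econj (\<omega> ^ i) * (- \<theta>) = of_int (x - 3 * (e * y))"
      using assms(3) by (auto simp: A c_def power2_eq_square intro!: eis_eqI)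
    then show ?thesis using assms(2) by (intro cong2_of_dvd_left) (simp add: of_nat_dvd_eis_iff)
  qed
  have "A * of_int (enorm A) = A * A * econj A" by (simp add: mult_econj[symmetric] mult_ac)
  also have "?c \<dots> ((of_int c * \<omega> ^ i * \<theta>) * (of_int c * \<omega> ^ i * \<theta>) * (of_int c * econj (\<omega> ^ i) * (- \<theta>)))"
    by (intro cong2_mult A1 A2)
  also have "\<dots> = - (of_int c ^ 3 * \<theta> ^ 3 * \<omega> ^ i * (\<omega> ^ i * econj (\<omega> ^ i)))"
    by (simp add: power3_eq_cube mult_ac)
  also have "\<omega> ^ i * econj (\<omega> ^ i) = 1" by (simp add: mult_econj enorm_power del: econj_power)
  finally have "?c (A * of_int (enorm A)) (- (of_int c ^ 3 * \<theta> ^ 3 * \<omega> ^ i))" by simp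
  then have "?c (\<omega> ^ j * (A * of_int (enorm A))) (\<omega> ^ j * - (of_int c ^ 3 * \<theta> ^ 3 * \<omega> ^ i))"
    by (intro cong2_mult cong2_refl)
  then have "?c ((\<omega> ^ j * (A * of_int (enorm A))) ^ m) ((\<omega> ^ j * - (of_int c ^ 3 * \<theta> ^ 3 * \<omega> ^ i)) ^ m)"
    by (rule cong2_power)
  also have "(\<omega> ^ j * - (of_int c ^ 3 * \<theta> ^ 3 * \<omega> ^ i)) ^ m
      = (of_int c ^ 3) ^ m * (\<theta> ^ 3) ^ m * (\<omega> ^ m) ^ (j + i)"
    using ev by (simp add: power_mult_distrib power_add power_mult[symmetric] mult_ac)
  also have "?c \<dots> (1 * 1 * (\<omega> ^ m) ^ (j + i))"
  proof (intro cong2_mult cong2_refl)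
    have "\<not> int q dvd c" using lf(2) by (simp add: c_def)
    then show "?c ((of_int c ^ 3) ^ m) 1" by (rule int_cube_power_cong[OF assms(1) m])
    show "?c ((\<theta> ^ 3) ^ m) 1" by (rule theta_cube_power_cong[OF assms(1) lf(1) m])
  qed
  finally have 1: "?c ((\<omega> ^ j * (A * of_int (enorm A))) ^ m) ((\<omega> ^ m) ^ (j + i))" by simp
  have N: "enorm (\<omega> ^ j * A) = enorm A" by (simp add: enorm_mult enorm_power)
  have "of_nat q dvd (\<omega> ^ j * A * of_int (enorm A)) ^ m - \<chi> (int q)"
    using cubic_reciprocalD(4)[OF \<chi> assms(1) _ m] lf(3) N by simp
  then have "?c ((\<omega> ^ j * (A * of_int (enorm A))) ^ m) (\<chi> (int q))"
    by (simp add: cong2_0_iff mult.assoc)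
  then have "?c (\<chi> (int q)) ((\<omega> ^ m) ^ (j + i))" using 1 cong2_sym cong2_trans by blast
  then have d: "of_nat q dvd \<chi> (int q) - (\<omega> ^ m) ^ (j + i)" by (simp only: cong2_0_iff)
  have "coprime (int q) (enorm A)" using lf(3) assms(1) by (intro prime_imp_coprime) auto
  then have v: "\<chi> (int q) \<in> {1, \<omega>, \<omega>\<^sup>2}" using cubic_reciprocalD(3)[OF \<chi>] N by simp
  have "(m * (j + i)) mod 3 \<in> {0, 1, 2}" by auto
  then have "(\<omega> ^ m) ^ (j + i) \<in> {1, \<omega>, \<omega>\<^sup>2}"
    using omega_power_mod[of "m * (j + i)"] by (auto simp: power_mult[symmetric])
  from cube_roots_of_unity_cong_imp_eq[OF v this assms(1) d]
  show ?thesis using omega_symbol_nat_eq[OF m] by simp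
qed

text \<open>The exponent \<open>j\<close> serves to bring A into the form that reciprocity accepts.
  By periodicity \<chi>(p) splits over the two linear forms, whose prime factors are covered by
  \<open>symbol_at_linear_form\<close>.\<close>

lemma symbol_value:
  assumes "prime p" "p\<^sup>2 = 3 * M + 1" "\<not> int p dvd enorm A" "3 dvd om (\<omega> ^ j * A)"
    and "[int p = e * ((x - 3 * y) * (x + 3 * y))] (mod enorm A)" "e = 1 \<or> e = - 1"
  shows "cong2 (of_nat p) 0 ((A * of_int (enorm A)) ^ M)
    (omega_symbol (x - 3 * y) ^ (j + 1) * omega_symbol (x + 3 * y) ^ (j + 2) * omega_symbol (int p) ^ (2 * j))"
proof -
  have N: "enorm (\<omega> ^ j * A) = enorm A" by (simp add: enorm_mult enorm_power)
  obtain \<chi> where \<chi>: "cubic_reciprocal (\<omega> ^ j * A) \<chi>"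
    using cubic_reciprocal_exists[OF assms(4) coprime_omega_power_mult[OF coprime_A]] by blast
  have mult: "\<chi> (a * b) = \<chi> a * \<chi> b" for a b using \<chi> by (simp add: cubic_reciprocal_def)
  have cube: "\<chi> a ^ 3 = 1" if "coprime a (enorm A)" for a
  proof -
    have "\<chi> a \<in> {1, \<omega>, \<omega>\<^sup>2}" using \<chi> that by (simp add: cubic_reciprocal_def N)
    then show ?thesis using power_mult[of \<omega> 3 2] power_mult[of \<omega> 2 3] by auto
  qed
  have one: "\<chi> 1 = 1" using cube[of 1] mult[of 1 1] by (auto simp: power3_eq_cube)
  have mone: "\<chi> (- 1) = 1"
    using cube[of "- 1"] mult[of "- 1" "- 1"] one by (auto simp: power3_eq_cube)
  have x3: "\<not> 3 dvd x - 3 * y" "\<not> 3 dvd x + 3 * y" using xy(3) by presburger+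
  have "\<chi> (x - 3 * y) = omega_symbol (x - 3 * y) ^ (j + 1)"
    using symbol_at_linear_form[of _ 1 1, OF _ _ _ \<chi>]
    by (intro eq_omega_symbol_power[of \<chi>, OF mult one mone x3(1)]) simp
  moreover have "\<chi> (x + 3 * y) = omega_symbol (x + 3 * y) ^ (j + 2)"
    using symbol_at_linear_form[of _ "- 1" 2, OF _ _ _ \<chi>]
    by (intro eq_omega_symbol_power[of \<chi>, OF mult one mone x3(2)]) simp
  moreover have "\<chi> (int p) = \<chi> (e * ((x - 3 * y) * (x + 3 * y)))"
    using cubic_reciprocalD(2)[OF \<chi>] assms(5) N by simp
  moreover have "\<chi> e = 1" using assms(6) one mone by auto
  ultimately have p: "\<chi> (int p) = omega_symbol (x - 3 * y) ^ (j + 1) * omega_symbol (x + 3 * y) ^ (j + 2)"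
    by (simp add: mult)
  have Mp: "omega_symbol (int p) = \<omega> ^ M"
    using assms(2) by (rule omega_symbol_nat_eq)
  have "of_nat p dvd (\<omega> ^ j * A * of_int (enorm A)) ^ M - \<chi> (int p)"
    using cubic_reciprocalD(4)[OF \<chi> assms(1) _ assms(2)] assms(3) N by simp
  then have "cong2 (of_nat p) 0 ((\<omega> ^ j * A * of_int (enorm A)) ^ M) (\<chi> (int p))"
    by (simp only: cong2_0_iff)
  \<comment> \<open>Multiplying by \<omega>^(2jM) completes the auxiliary \<omega>^(jM) to a cube
    and so returns from \<omega>^j A to A.\<close>
  then have "cong2 (of_nat p) 0 ((\<omega> ^ M) ^ (2 * j) * (\<omega> ^ j * A * of_int (enorm A)) ^ M) ((\<omega> ^ M) ^ (2 * j) * \<chi> (int p))"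
    by (intro cong2_mult cong2_refl)
  also have "(\<omega> ^ M) ^ (2 * j) * (\<omega> ^ j * A * of_int (enorm A)) ^ M = ((\<omega> ^ 3) ^ j) ^ M * (A * of_int (enorm A)) ^ M"
    unfolding power_mult_distrib power_mult[symmetric] mult.assoc[symmetric] power_add[symmetric]
    by (simp add: algebra_simps)
  finally show ?thesis by (simp add: p Mp mult_ac)
qed

end

section \<open>Fibonacci numbers modulo a prime\<close>

text \<open>Frobenius fixes the integer coordinates and sends \<omega> to \<omega>^p, which is
  \<omega> or its conjugate.\<close>

lemma frobenius_eis:
  assumes "prime p" "p \<noteq> 3"
  shows "cong2 (of_nat p) 0 (z ^ p) (if p mod 3 = 1 then z else econj z)"
proof -
  have fermat: "cong2 (of_nat p) 0 (of_int a ^ p) (of_int a :: eis)" for a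
  proof -
    have "[a ^ p = a] (mod int p)"
    proof (cases "int p dvd a")
      case True
      then have "int p dvd a ^ p - a" using prime_gt_0_nat[OF assms(1)]
        by (intro dvd_diff dvd_power_le) (auto intro: dvd_trans[OF _ dvd_power])
      then show ?thesis by (simp add: cong_iff_dvd_diff)
    next
      case False
      then have "[a * a ^ (p - 1) = a * 1] (mod int p)"
        by (intro cong_mult cong_refl fermat_int assms)
      then show ?thesis using prime_gt_0_nat[OF assms(1)] by (simp add: power_eq_if)
    qed
    then show ?thesis using cong2_of_int[of "a ^ p" a p 0] by simp
  qed
  have "\<not> 3 dvd p" using assms primes_dvd_imp_eq[of 3 p] by auto
  then have p3: "p mod 3 = 1 \<or> p mod 3 = 2" by presburger
  define u where "u = (if p mod 3 = 1 then \<omega> else econj \<omega>)"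
  have "\<omega> ^ p = u"
    using omega_power_mod[of p] p3 by (auto simp: u_def econj_omega)
  have "z ^ p = (of_int (re z) + of_int (om z) * \<omega>) ^ p" by (subst eis_eq[of z]) simp
  also have "cong2 (of_nat p) 0 \<dots> (of_int (re z) ^ p + (of_int (om z) * \<omega>) ^ p)"
    by (intro cong2_of_dvd_left freshmans_dream_add assms)
  also have "of_int (re z) ^ p + (of_int (om z) * \<omega>) ^ p = of_int (re z) ^ p + of_int (om z) ^ p * u"
    by (simp add: power_mult_distrib \<open>\<omega> ^ p = u\<close>)
  also have "cong2 (of_nat p) 0 \<dots> (of_int (re z) + of_int (om z) * u)"
    by (intro cong2_add cong2_mult cong2_refl fermat)
  also have "of_int (re z) + of_int (om z) * u = (if p mod 3 = 1 then z else econj z)"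
    by (auto simp: u_def intro: eis_eqI)
  finally show ?thesis .
qed

text \<open>Binet's formula with the denominator multiplied out; only the sum 1 and the product -1
  of the two roots are used.\<close>

lemma fib_binet_cong:
  assumes "cong2 m 0 (\<phi> + \<psi>) 1" "cong2 m 0 (\<phi> * \<psi>) (- 1 :: 'a::comm_ring_1)"
  shows "cong2 m 0 (of_nat (fib n) * (\<phi> - \<psi>)) (\<phi> ^ n - \<psi> ^ n)"
proof (induction n rule: fib.induct)
  case (3 n)
  have "of_nat (fib (Suc (Suc n))) * (\<phi> - \<psi>)
      = of_nat (fib (Suc n)) * (\<phi> - \<psi>) + of_nat (fib n) * (\<phi> - \<psi>)"
    by (simp add: algebra_simps)
  also have "cong2 m 0 \<dots> (1 * (\<phi> ^ Suc n - \<psi> ^ Suc n) - (- 1) * (\<phi> ^ n - \<psi> ^ n))"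
    using cong2_add[OF 3(1,2)] by (simp add: algebra_simps)
  also have "cong2 m 0 \<dots> ((\<phi> + \<psi>) * (\<phi> ^ Suc n - \<psi> ^ Suc n) - (\<phi> * \<psi>) * (\<phi> ^ n - \<psi> ^ n))"
    by (intro cong2_diff cong2_mult cong2_refl assms[THEN cong2_sym])
  also have "\<dots> = \<phi> ^ Suc (Suc n) - \<psi> ^ Suc (Suc n)" by (simp add: algebra_simps)
  finally show ?case .
qed simp_all

lemma omega_power_inverse: "\<omega> ^ (2 * k) * \<omega> ^ k = 1" "\<omega> ^ k * \<omega> ^ (2 * k) = 1"
proof -
  have "2 * k + k = 3 * k" "k + 2 * k = 3 * k" by simp_all
  then show "\<omega> ^ (2 * k) * \<omega> ^ k = 1" "\<omega> ^ k * \<omega> ^ (2 * k) = 1"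
    using power_mult[of \<omega> 3 k] by (simp_all only: power_add[symmetric] omega_cube power_one)
qed

text \<open>
  Frobenius fixes \<open>\<phi>\<close> if \<open>p \<equiv> 1\<close> and swaps \<open>\<phi>, \<psi>\<close> if \<open>p \<equiv> 2 (mod 3)\<close>; in both cases \<open>\<phi>\<^sup>M\<close> determines
  \<open>\<phi>\<close> and \<open>\<psi>\<close> to the power \<open>2 [p/3] + 1\<close>.
\<close>

lemma fib_cong_of_power:
  fixes \<phi> \<psi> :: eis
  assumes "prime p" "p > 3" "p\<^sup>2 = 3 * M + 1"
    and sum: "cong2 (of_nat p) 0 (\<phi> + \<psi>) 1" and prod: "cong2 (of_nat p) 0 (\<phi> * \<psi>) (- 1)"
    and M: "cong2 (of_nat p) 0 (\<phi> ^ M) (\<omega> ^ k)"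
    and frob: "cong2 (of_nat p) 0 (\<phi> ^ p) (if p mod 3 = 1 then \<phi> else \<psi>)"
  shows "cong2 (of_nat p) 0 (of_nat (fib (2 * (p div 3) + 1)) * (\<phi> - \<psi>)) (\<omega> ^ k * \<phi> - \<omega> ^ (2 * k) * \<psi>)"
proof -
  let ?c = "cong2 (of_nat p) (0 :: eis)"
  define n where "n = p div 3"
  have "\<not> 3 dvd p" using assms(1,2) primes_dvd_imp_eq[of 3 p] by auto
  then have p3: "p mod 3 = 1 \<or> p mod 3 = 2" by presburger
  have prod2: "?c (\<phi> ^ (2 * l) * \<psi> ^ (2 * l)) 1" for l
    using cong2_power[OF prod, of "2 * l"] by (simp add: power_mult_distrib)
  have "?c (\<phi> ^ (2 * n + 1) - \<psi> ^ (2 * n + 1)) (\<omega> ^ k * \<phi> - \<omega> ^ (2 * k) * \<psi>)"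
  proof (cases "p mod 3 = 1")
    case True
    then have p: "p = 3 * n + 1" unfolding n_def by presburger
    \<comment> \<open>From p - 1 = 3n it follows that M = n (p + 1), so Frobenius turns \<phi>^M
      into \<phi>^(2n).\<close>
    have Mn: "M = p * n + n" using assms(3)
      unfolding p by (simp add: power2_eq_square algebra_simps)
    have "\<phi> ^ (2 * n) = \<phi> ^ n * \<phi> ^ n" by (simp add: mult_2 power_add)
    also have "?c \<dots> ((\<phi> ^ p) ^ n * \<phi> ^ n)"
      using frob True by (intro cong2_mult cong2_power cong2_refl) (auto intro: cong2_sym)
    also have "\<dots> = \<phi> ^ M" by (simp add: Mn power_add power_mult)
    also have "?c \<dots> (\<omega> ^ k)" by (rule M)
    finally have 1: "?c (\<phi> ^ (2 * n)) (\<omega> ^ k)" .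
    have "\<psi> ^ (2 * n) = \<omega> ^ (2 * k) * \<omega> ^ k * \<psi> ^ (2 * n)" by (simp add: omega_power_inverse)
    also have "?c \<dots> (\<omega> ^ (2 * k) * \<phi> ^ (2 * n) * \<psi> ^ (2 * n))"
      by (intro cong2_mult cong2_refl cong2_sym[OF 1])
    also have "\<dots> = \<omega> ^ (2 * k) * (\<phi> ^ (2 * n) * \<psi> ^ (2 * n))" by (simp only: mult.assoc)
    also have "?c \<dots> (\<omega> ^ (2 * k) * 1)" by (intro cong2_mult cong2_refl prod2)
    finally have 2: "?c (\<psi> ^ (2 * n)) (\<omega> ^ (2 * k))" by simp
    show ?thesis unfolding power_add power_one_right
      by (intro cong2_diff cong2_mult cong2_refl 1 2)
  next
    case False
    then have p: "p = 3 * n + 2" unfolding n_def using p3 by presburger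
    \<comment> \<open>From p + 1 = 3(n + 1) it follows that M = (p - 1)(n + 1), so Frobenius turns
      \<phi>^(M+n+1) into \<psi>^(n+1).\<close>
    have Mn: "M + (n + 1) = p * (n + 1)" using assms(3)
      unfolding p by (simp add: power2_eq_square algebra_simps)
    have "odd p" using assms(1,2) prime_odd_nat[of p] by simp
    \<comment> \<open>The parity makes (\<phi> \<psi>)^(n+1) equal to 1 rather than -1.\<close>
    then have "even (n + 1)" unfolding p by simp
    have "?c (\<omega> ^ k * \<phi> ^ (n + 1)) (\<phi> ^ M * \<phi> ^ (n + 1))"
      by (intro cong2_mult cong2_refl cong2_sym[OF M])
    also have "\<dots> = (\<phi> ^ p) ^ (n + 1)" by (simp only: power_add[symmetric] Mn power_mult)
    also have "?c \<dots> (\<psi> ^ (n + 1))" using frob False by (intro cong2_power) simp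
    finally have *: "?c (\<omega> ^ k * \<phi> ^ (n + 1)) (\<psi> ^ (n + 1))" .
    have pp: "?c (\<phi> ^ (n + 1) * \<psi> ^ (n + 1)) 1"
      using cong2_power[OF prod, of "n + 1"] \<open>even (n + 1)\<close>
      by (simp only: power_mult_distrib power_minus_even power_one)
    have "\<psi> ^ (2 * n + 2) = \<psi> ^ (n + 1) * \<psi> ^ (n + 1)"
      by (simp add: power_add[symmetric] mult_2)
    also have "?c \<dots> (\<omega> ^ k * \<phi> ^ (n + 1) * \<psi> ^ (n + 1))"
      by (intro cong2_mult cong2_refl cong2_sym[OF *])
    also have "\<dots> = \<omega> ^ k * (\<phi> ^ (n + 1) * \<psi> ^ (n + 1))" by (simp only: mult.assoc)
    also have "?c \<dots> (\<omega> ^ k * 1)" by (intro cong2_mult cong2_refl pp)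
    finally have 1: "?c (\<psi> ^ (2 * n + 2)) (\<omega> ^ k)" by simp
    have "\<phi> ^ (2 * n + 2) = \<omega> ^ (2 * k) * \<omega> ^ k * (\<phi> ^ (n + 1) * \<phi> ^ (n + 1))"
      unfolding omega_power_inverse by (simp add: power_add[symmetric] mult_2)
    also have "\<dots> = \<omega> ^ (2 * k) * (\<phi> ^ (n + 1) * (\<omega> ^ k * \<phi> ^ (n + 1)))" by (simp only: mult_ac)
    also have "?c \<dots> (\<omega> ^ (2 * k) * (\<phi> ^ (n + 1) * \<psi> ^ (n + 1)))"
      by (intro cong2_mult cong2_refl *)
    also have "?c \<dots> (\<omega> ^ (2 * k) * 1)" by (intro cong2_mult cong2_refl pp)
    finally have 2: "?c (\<phi> ^ (2 * n + 2)) (\<omega> ^ (2 * k))" by simp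
    \<comment> \<open>Known are the powers with exponent 2n + 2; \<phi> \<psi> = -1 raises the
      exponent by one and interchanges the roots.\<close>
    have "\<phi> ^ (2 * n + 1) - \<psi> ^ (2 * n + 1) = (- 1) * \<psi> ^ (2 * n + 1) - (- 1) * \<phi> ^ (2 * n + 1)"
      by simp
    also have "?c \<dots> ((\<phi> * \<psi>) * \<psi> ^ (2 * n + 1) - (\<phi> * \<psi>) * \<phi> ^ (2 * n + 1))"
      by (intro cong2_diff cong2_mult cong2_refl cong2_sym[OF prod])
    also have "\<dots> = \<psi> ^ (2 * n + 2) * \<phi> - \<phi> ^ (2 * n + 2) * \<psi>" by (simp add: mult_ac)
    also have "?c \<dots> (\<omega> ^ k * \<phi> - \<omega> ^ (2 * k) * \<psi>)" by (intro cong2_diff cong2_mult cong2_refl 1 2)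
    finally show ?thesis .
  qed
  then show ?thesis using fib_binet_cong[OF sum prod] cong2_trans unfolding n_def by blast
qed

text \<open>These are \<omega> = (-1 + \<theta>)/2 and its conjugate, with the denominator
  cleared.\<close>

lemma two_omega_combination:
  "2 * (\<omega> * \<phi> - \<omega>\<^sup>2 * \<psi>) = - (\<phi> - \<psi>) + \<theta> * (\<phi> + \<psi>)"
  "2 * (\<omega>\<^sup>2 * \<phi> - \<omega> ^ 4 * \<psi>) = - (\<phi> - \<psi>) - \<theta> * (\<phi> + \<psi>)"
  by (rule eis_eqI; simp add: power2_eq_square power4_eq_xxxx algebra_simps)+

lemma cong2_eis_iff:
  "cong2 (of_nat p) 0 a b \<longleftrightarrow> [re a = re b] (mod int p) \<and> [om a = om b] (mod int p)"
  by (simp add: cong2_0_iff of_nat_dvd_eis_iff cong_iff_dvd_diff)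

lemma cube_mod_9:
  assumes "\<not> 3 dvd (y :: int)"
  obtains e where "e = 1 \<or> e = - 1" "[y ^ 3 = e] (mod 9)"
proof -
  have "\<exists>b e. y = 3 * b + e \<and> (e = 1 \<or> e = - 1)" using assms by presburger
  then obtain b e where be: "y = 3 * b + e" "e = 1 \<or> e = - 1" by blast
  have "y ^ 3 - e ^ 3 = 9 * (3 * b ^ 3 + 3 * b\<^sup>2 * e + b * e\<^sup>2)"
    by (simp add: be(1) power2_eq_square power3_eq_cube algebra_simps)
  moreover have "e ^ 3 = e" using be(2) by auto
  ultimately have "[y ^ 3 = e] (mod 9)" by (simp add: cong_iff_dvd_diff)
  then show ?thesis using that be(2) by blast
qed

lemma coprime_of_prime_form:
  fixes a b x y :: int
  assumes "prime p" "int p = a * x\<^sup>2 + b * y\<^sup>2"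
  shows "coprime x y"
proof (rule coprimeI)
  fix d assume "d dvd x" "d dvd y"
  then have "d\<^sup>2 dvd int p" unfolding assms(2) by (intro dvd_add dvd_mult dvd_power_same)
  then obtain e where e: "int p = d * (d * e)" by (auto simp: power2_eq_square mult.assoc dvd_def)
  have "irreducible (int p)" using assms(1) by (simp add: prime_elem_imp_irreducible)
  then have "is_unit d \<or> is_unit (d * e)" using e by (rule irreducibleD)
  then show "is_unit d" using dvd_mult_left by blast
qed

lemma omega_symbol_2: "omega_symbol 2 = \<omega>" and omega_symbol_4: "omega_symbol 4 = \<omega>\<^sup>2"
  using omega_symbol_eq[of 2 1] omega_symbol_eq[of 4 5] omega_power_mod[of 5] by simp_all

text \<open>Here A itself is admissible (j = 0). As x - 3y and x + 3y agree modulo 9, the value is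
  the product of a symbol and its square.\<close>

lemma symbol_value_3_dvd:
  assumes "coprime x y" "odd (x + y)" "\<not> 3 dvd x" "A = of_int x + of_int y * \<theta>"
    and "prime p" "p\<^sup>2 = 3 * M + 1" "\<not> int p dvd x\<^sup>2 + 3 * y\<^sup>2"
    and "[int p = e * ((x - 3 * y) * (x + 3 * y))] (mod x\<^sup>2 + 3 * y\<^sup>2)" "e = 1 \<or> e = - 1"
    and "3 dvd y"
  shows "cong2 (of_nat p) 0 ((A * of_int (x\<^sup>2 + 3 * y\<^sup>2)) ^ M) 1"
proof -
  have "omega_symbol (x - 3 * y) = omega_symbol (x + 3 * y)"
  proof (rule omega_symbol_cong)
    show "\<not> 3 dvd x - 3 * y" "\<not> 3 dvd x + 3 * y" using assms(3) by presburger+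
    show "[x - 3 * y = x + 3 * y] (mod 9)" using assms(10) unfolding cong_iff_dvd_diff by presburger
  qed
  then have "omega_symbol (x - 3 * y) * omega_symbol (x + 3 * y) ^ 2 = 1"
    using omega_symbol_cube[of "x + 3 * y"]
    by (simp add: power2_eq_square power3_eq_cube mult.assoc)
  moreover have "3 dvd om (\<omega> ^ 0 * A)" using assms(10) by (simp add: assms(4))
  ultimately show ?thesis
    using symbol_value[OF assms(1-6), of 0 e] assms(7-9) enorm_A[OF assms(1-4)]
    by (simp add: numeral_2_eq_2)
qed

text \<open>Here \<omega> A is admissible (j = 1). The exponents become 2 for x - 3y, 3 for x + 3y
  and 2 for p, which leaves the square of the symbol of (x - 3y) p; x^3 is 1 or -1 modulo 9 and
  drops out.\<close>

lemma symbol_value_3_dvd_diff: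
  assumes "coprime x y" "odd (x + y)" "\<not> 3 dvd x" "A = of_int x + of_int y * \<theta>"
    and "prime p" "p\<^sup>2 = 3 * M + 1" "\<not> int p dvd x\<^sup>2 + 3 * y\<^sup>2"
    and "[int p = e * ((x - 3 * y) * (x + 3 * y))] (mod x\<^sup>2 + 3 * y\<^sup>2)" "e = 1 \<or> e = - 1"
    and "3 dvd y - x" "\<not> 3 dvd int p" "\<not> 3 dvd c" "[(x - 3 * y) * int p = c * x ^ 3] (mod 9)"
  shows "cong2 (of_nat p) 0 ((A * of_int (x\<^sup>2 + 3 * y\<^sup>2)) ^ M) (omega_symbol c ^ 2)"
proof -
  have 3: "\<not> 3 dvd x - 3 * y" using assms(3) by presburger
  obtain f where f: "f = 1 \<or> f = - 1" "[x ^ 3 = f] (mod 9)" using cube_mod_9[OF assms(3)] .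
  have "omega_symbol (x - 3 * y) * omega_symbol (int p) = omega_symbol ((x - 3 * y) * int p)"
    using 3 assms(11) by (simp add: omega_symbol_mult)
  also have "\<dots> = omega_symbol (c * f)"
  proof (rule omega_symbol_cong)
    show "\<not> 3 dvd (x - 3 * y) * int p" using 3 assms(11) by (simp add: prime_dvd_mult_iff)
    show "\<not> 3 dvd c * f" using assms(12) f(1) by auto
    show "[(x - 3 * y) * int p = c * f] (mod 9)"
      using assms(13) cong_scalar_left[OF f(2), of c] by (rule cong_trans)
  qed
  also have "\<dots> = omega_symbol c" using f(1) by auto
  finally have "omega_symbol (x - 3 * y) ^ 2 * omega_symbol (int p) ^ 2 = omega_symbol c ^ 2"
    by (simp flip: power_mult_distrib)
  moreover have "3 dvd om (\<omega> ^ 1 * A)" using assms(10) by (simp add: assms(4)) presburger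
  ultimately show ?thesis
    using symbol_value[OF assms(1-6), of 1 e] assms(7-9) enorm_A[OF assms(1-4)]
      omega_symbol_cube[of "x + 3 * y"]
    by (simp add: numeral_2_eq_2 numeral_3_eq_3)
qed

text \<open>Modulo p, -x \<theta>/(3y) is a square root of 5, because x^2 = -15 y^2. This gives the
  two roots A \<theta>/(-6y) and its conjugate.\<close>

lemma fib_cong_x2_15y2:
  fixes x y :: int
  assumes "prime p" "p > 5" and pxy: "int p = x\<^sup>2 + 15 * y\<^sup>2"
  defines "F \<equiv> int (fib (2 * (p div 3) + 1))"
  shows "3 dvd y \<Longrightarrow> [F = 1] (mod int p)"
    and "3 dvd y - x \<Longrightarrow> [10 * y * F = x - 5 * y] (mod int p)"
proof -
  have p3: "p > 3" "p \<noteq> 3" using assms(2) by simp_all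
  have "\<not> 3 dvd p" using assms(1,2) primes_dvd_imp_eq[of 3 p] by auto
  then have np3: "\<not> 3 dvd int p" by presburger
  have x3: "\<not> 3 dvd x"
  proof
    assume "3 dvd x"
    then have "3 dvd x\<^sup>2 + 15 * y\<^sup>2" by (intro dvd_add) (auto simp: power2_eq_square)
    then show False using np3 pxy by simp
  qed
  obtain l where "x\<^sup>2 = 3 * int l + 1" using square_eq[OF x3] .
  then have "int p = 3 * (int l + 5 * y\<^sup>2) + 1" using pxy by simp
  then have pm: "p mod 3 = 1" by presburger
  have "odd p" using assms(1,2) prime_odd_nat[of p] by simp
  then have "odd (x\<^sup>2 + 15 * y\<^sup>2)" using pxy by (metis even_of_nat)
  then have od: "odd (x + y)" by simp
  have cop: "coprime x y" using coprime_of_prime_form[OF assms(1), of 1 x 15 y] pxy by simp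
  have c15: "coprime 15 (int p)"
  proof -
    have "coprime (3 * 5) (int p)"
      using coprime_small[OF assms(1,2), of 3] coprime_small[OF assms(1,2), of 5]
      by (simp only: coprime_mult_left_iff) simp
    then show ?thesis by simp
  qed
  have c2y: "coprime (2 * y) (int p)"
    using coprime_denominator_form(1)[OF assms(1,2), of 1 x 15 y] pxy by simp
  have c2x: "coprime (2 * x) (int p)"
    using coprime_denominator_form(1)[OF assms(1,2) c15, of y 1 x] pxy by simp
  have c3: "coprime 3 (int p)" using coprime_small[OF assms(1,2), of 3] by simp
  have c6y: "coprime (- 6 * y) (int p)"
  proof -
    have "coprime (3 * (2 * y)) (int p)" using c3 c2y by (simp only: coprime_mult_left_iff)
    then show ?thesis by simp
  qed
  have np: "\<not> is_unit (int p)" using assms(2) by simp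
  define N where "N = x\<^sup>2 + 3 * y\<^sup>2"
  have pN: "\<not> int p dvd N"
  proof
    assume "int p dvd N"
    then have "int p dvd int p - N" by simp
    also have "int p - N = 3 * (2 * y)\<^sup>2" by (simp add: N_def pxy power2_eq_square)
    finally have "int p dvd 3 * (2 * y)\<^sup>2" .
    moreover have "coprime (3 * (2 * y)\<^sup>2) (int p)"
      using c3 c2y by (simp only: coprime_mult_left_iff coprime_power_left_iff) simp
    ultimately show False using np coprime_common_divisor by (metis dvd_refl)
  qed
  obtain M where M: "p\<^sup>2 = 3 * M + 1" using prime_square_eq[OF assms(1) p3(2)] .
  \<comment> \<open>\<open>i\<close> is the inverse of the sum A \<theta> - (\<open>econj A\<close>)
    \<theta> = -6y, which normalises the sum of the roots to 1.\<close>
  obtain i where i: "[- 6 * y * i = 1] (mod int p)" using cong_solve_coprime_int[OF c6y] by blast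
  then have i': "int p dvd - 6 * y * i - 1" by (simp add: cong_iff_dvd_diff)
  define A where "A = of_int x + of_int y * \<theta>"
  define \<phi> \<psi> where "\<phi> = A * \<theta> * of_int i" and "\<psi> = - econj A * \<theta> * of_int i"
  let ?c = "cong2 (of_nat p) (0 :: eis)"
  have sum: "?c (\<phi> + \<psi>) 1"
  proof -
    have "\<phi> + \<psi> = of_int (- 6 * y * i)"
      by (rule eis_eqI) (simp_all add: \<phi>_def \<psi>_def A_def algebra_simps)
    then show ?thesis using cong2_of_int[OF i, of 0] by simp
  qed
  have prod: "?c (\<phi> * \<psi>) (- 1)"
  proof -
    have "\<phi> * \<psi> = of_int (3 * N * i\<^sup>2)"
      by (rule eis_eqI) (simp_all add: \<phi>_def \<psi>_def A_def N_def power2_eq_square algebra_simps)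
    moreover have "[3 * N * i\<^sup>2 = - 1] (mod int p)"
    proof -
      have "3 * N * i\<^sup>2 - (- 1) = int p * (3 * i\<^sup>2) + (- 6 * y * i - 1) * (6 * y * i - 1)"
        by (simp add: N_def pxy power2_eq_square algebra_simps)
      then show ?thesis using i' unfolding cong_iff_dvd_diff by simp
    qed
    ultimately show ?thesis using cong2_of_int[of "3 * N * i\<^sup>2" "- 1" p 0] by simp
  qed
  have A\<phi>: "?c ((A * of_int N) ^ M) (\<phi> ^ M)"
  proof -
    \<comment> \<open>N = -12 y^2 modulo p. Written with \<open>i\<close>, the product A N becomes
      (2y)^3 \<theta>^4 A i, which is \<phi> times cubes.\<close>
    have "[N = 72 * y ^ 3 * i] (mod int p)"
    proof -
      have "N - 72 * y ^ 3 * i = int p - (- 6 * y * i - 1) * (- 12 * y\<^sup>2)"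
        by (simp add: N_def pxy power2_eq_square power3_eq_cube algebra_simps)
      then show ?thesis using i' unfolding cong_iff_dvd_diff by simp
    qed
    then have "?c (A * of_int N) (A * of_int (72 * y ^ 3 * i))"
      by (intro cong2_mult cong2_refl cong2_of_int)
    also have "A * of_int (72 * y ^ 3 * i) = of_int (2 * y) ^ 3 * \<theta> ^ 3 * \<phi>"
    proof -
      have "of_int (2 * y) ^ 3 * \<theta> ^ 3 * \<phi> = of_int (8 * y ^ 3) * ((\<theta>\<^sup>2)\<^sup>2 * (A * of_int i))"
        by (simp add: \<phi>_def power2_eq_square power3_eq_cube algebra_simps)
      then show ?thesis by (simp only: theta_square) (simp add: algebra_simps)
    qed
    finally have "?c ((A * of_int N) ^ M) ((of_int (2 * y) ^ 3 * \<theta> ^ 3 * \<phi>) ^ M)"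
      by (rule cong2_power)
    also have "(of_int (2 * y) ^ 3 * \<theta> ^ 3 * \<phi>) ^ M = (of_int (2 * y) ^ 3) ^ M * (\<theta> ^ 3) ^ M * \<phi> ^ M"
      by (simp only: power_mult_distrib)
    also have "?c \<dots> (1 * 1 * \<phi> ^ M)"
    proof (intro cong2_mult cong2_refl theta_cube_power_cong int_cube_power_cong assms(1) M p3)
      show "\<not> int p dvd 2 * y" using c2y np coprime_common_divisor by (metis dvd_refl)
    qed
    finally show ?thesis by simp
  qed
  have frob: "?c (\<phi> ^ p) (if p mod 3 = 1 then \<phi> else \<psi>)"
    using frobenius_eis[OF assms(1) p3(2), of \<phi>] pm by simp
  have e: "[int p = - 1 * ((x - 3 * y) * (x + 3 * y))] (mod x\<^sup>2 + 3 * y\<^sup>2)"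
  proof -
    have "int p - (- 1 * ((x - 3 * y) * (x + 3 * y))) = (x\<^sup>2 + 3 * y\<^sup>2) * 2"
      by (simp add: pxy power2_eq_square algebra_simps)
    then show ?thesis unfolding cong_iff_dvd_diff by (metis dvd_triv_left)
  qed
  have diff: "of_nat (fib (2 * (p div 3) + 1)) * (\<phi> - \<psi>) = of_int (F * (2 * x * i)) * \<theta>"
    by (rule eis_eqI) (simp_all add: F_def \<phi>_def \<psi>_def A_def algebra_simps)
  note fib = fib_cong_of_power[OF assms(1) p3(1) M sum prod _ frob, unfolded diff]
  {
    assume "3 dvd y"
    then have "?c ((A * of_int N) ^ M) 1"
      unfolding N_def using symbol_value_3_dvd[OF cop od x3 A_def assms(1) M pN[unfolded N_def] e]
        by simp
    then have "?c (\<phi> ^ M) (\<omega> ^ 0)" using A\<phi> cong2_sym cong2_trans by (metis power_0)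
    from fib[OF this] have "?c (of_int (F * (2 * x * i)) * \<theta>) (\<phi> - \<psi>)" by simp
    then have "[F * (2 * x * i) = 2 * x * i] (mod int p)"
      by (simp add: cong2_eis_iff \<phi>_def \<psi>_def A_def algebra_simps)
    then have "[2 * x * i * F = 2 * x * i * 1] (mod int p)" by (simp add: mult.commute)
    moreover have "coprime i (int p)" using i
      by (metis coprime_iff_invertible_int mult.commute)
    then have "coprime (2 * x * i) (int p)" using c2x by simp
    ultimately show "[F = 1] (mod int p)" using cong_mult_lcancel by blast
  }
  {
    assume d: "3 dvd y - x"
    then obtain n where n: "y = x + 3 * n" by (metis dvdE add.commute diff_add_cancel)
    \<comment> \<open>Modulo 9 the factors are -2x and 16 x^2, and -32 = 4.\<close>
    have "(x - 3 * y) * int p - 4 * x ^ 3 = 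
        9 * (- 4 * x ^ 3 - 36 * x\<^sup>2 * n - 120 * x * n\<^sup>2 - 135 * n ^ 3)"
      by (simp add: pxy n power2_eq_square power3_eq_cube algebra_simps)
    then have "[(x - 3 * y) * int p = 4 * x ^ 3] (mod 9)"
      unfolding cong_iff_dvd_diff by (metis dvd_triv_left)
    then have "?c ((A * of_int N) ^ M) (omega_symbol 4 ^ 2)"
      unfolding N_def
      using symbol_value_3_dvd_diff[OF cop od x3 A_def assms(1) M pN[unfolded N_def] e _ d np3]
      by simp
    moreover have "omega_symbol 4 ^ 2 = \<omega> ^ 1" using omega_power_mod[of 4]
      by (simp add: omega_symbol_4 flip: power_mult)
    ultimately have "?c (\<phi> ^ M) (\<omega> ^ 1)" using A\<phi> cong2_sym cong2_trans by metis
    from fib[OF this] have "?c (of_int (F * (2 * x * i)) * \<theta>) (\<omega> * \<phi> - \<omega>\<^sup>2 * \<psi>)" by simp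
    then have "?c (2 * (of_int (F * (2 * x * i)) * \<theta>)) (2 * (\<omega> * \<phi> - \<omega>\<^sup>2 * \<psi>))"
      by (intro cong2_mult cong2_refl)
    also have "\<dots> = - (\<phi> - \<psi>) + \<theta> * (\<phi> + \<psi>)" by (rule two_omega_combination)
    also have "?c \<dots> (- (\<phi> - \<psi>) + \<theta> * 1)" by (intro cong2_add cong2_mult cong2_refl sum)
    finally have "[2 * (F * (2 * x * i)) = 1 - 2 * x * i] (mod int p)"
      by (simp add: cong2_eis_iff \<phi>_def \<psi>_def A_def algebra_simps)
    then have "int p dvd 2 * (F * (2 * x * i)) - (1 - 2 * x * i)" by (simp only: cong_iff_dvd_diff)
    \<comment> \<open>The factor 6y clears the inverse \<open>i\<close>, and the factor x allows x^2
      to be replaced by -15 y^2.\<close>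
    then have "int p dvd (2 * (F * (2 * x * i)) - (1 - 2 * x * i)) * (6 * x * y)
        + (- 6 * y * i - 1) * (4 * F * x\<^sup>2 + 2 * x\<^sup>2) + int p * (4 * F + 2)"
      using i' by (intro dvd_add dvd_mult2) simp_all
    also have "\<dots> = 3 * (2 * y) * (10 * y * F - (x - 5 * y))"
      by (simp add: pxy power2_eq_square algebra_simps)
    finally have "int p dvd 3 * (2 * y) * (10 * y * F - (x - 5 * y))" .
    moreover have "coprime (int p) (3 * (2 * y))"
      using c3 c2y by (simp only: coprime_mult_right_iff coprime_commute)
    ultimately have "int p dvd 10 * y * F - (x - 5 * y)" using coprime_dvd_mult_right_iff by blast
    then show "[10 * y * F = x - 5 * y] (mod int p)" by (simp only: cong_iff_dvd_diff)
  }
qed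


text \<open>Modulo p, y \<theta>/x is a square root of 5, because 3 y^2 = -5 x^2. The roots are
  A/(2x) and its conjugate, and Frobenius exchanges them since p = 2 modulo 3.\<close>

lemma fib_cong_5x2_3y2:
  fixes x y :: int
  assumes "prime p" "p > 5" and pxy: "int p = 5 * x\<^sup>2 + 3 * y\<^sup>2"
  defines "F \<equiv> int (fib (2 * (p div 3) + 1))"
  shows "3 dvd y \<Longrightarrow> [F = 1] (mod int p)"
    and "3 dvd y - x \<Longrightarrow> [2 * y * F = - (x + y)] (mod int p)"
proof -
  have p3: "p > 3" "p \<noteq> 3" using assms(2) by simp_all
  have "\<not> 3 dvd p" using assms(1,2) primes_dvd_imp_eq[of 3 p] by auto
  then have np3: "\<not> 3 dvd int p" by presburger
  have x3: "\<not> 3 dvd x"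
  proof
    assume "3 dvd x"
    then have "3 dvd 5 * x\<^sup>2 + 3 * y\<^sup>2" by (intro dvd_add) (auto simp: power2_eq_square)
    then show False using np3 pxy by simp
  qed
  obtain l where "x\<^sup>2 = 3 * int l + 1" using square_eq[OF x3] .
  then have "int p = 3 * (5 * int l + 1 + y\<^sup>2) + 2" using pxy by simp
  then have pm: "p mod 3 = 2" by presburger
  have "odd p" using assms(1,2) prime_odd_nat[of p] by simp
  then have "odd (5 * x\<^sup>2 + 3 * y\<^sup>2)" using pxy by (metis even_of_nat)
  then have od: "odd (x + y)" by simp
  have cop: "coprime x y" using coprime_of_prime_form[OF assms(1) pxy] .
  have c3: "coprime 3 (int p)" using coprime_small[OF assms(1,2), of 3] by simp
  have c5: "coprime 5 (int p)" using coprime_small[OF assms(1,2), of 5] by simp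
  have c2: "coprime (int p) 2" using coprime_small[OF assms(1,2), of 2]
    by (simp add: coprime_commute)
  have c2y: "coprime (2 * y) (int p)" using coprime_denominator_form(1)[OF assms(1,2) c5 pxy] .
  have c2x: "coprime (2 * x) (int p)"
    using coprime_denominator_form(1)[OF assms(1,2) c3, of y 5 x] pxy by simp
  have np: "\<not> is_unit (int p)" using assms(2) by simp
  have p2x: "\<not> int p dvd 2 * x" using c2x np coprime_common_divisor by (metis dvd_refl)
  define N where "N = x\<^sup>2 + 3 * y\<^sup>2"
  have pN: "\<not> int p dvd N"
  proof
    assume "int p dvd N"
    then have "int p dvd int p - N" by simp
    also have "int p - N = (2 * x)\<^sup>2" by (simp add: N_def pxy power2_eq_square)
    finally have "int p dvd (2 * x)\<^sup>2" .
    then have "int p dvd 2 * x" by (rule prime_dvd_power[rotated]) (use assms(1) in simp)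
    then show False using p2x by blast
  qed
  obtain M where M: "p\<^sup>2 = 3 * M + 1" using prime_square_eq[OF assms(1) p3(2)] .
  have ev: "even M" using prime_square_even[OF assms(1) p3(1) M] .
  obtain i where i: "[2 * x * i = 1] (mod int p)" using cong_solve_coprime_int[OF c2x] by blast
  then have i': "int p dvd 2 * x * i - 1" by (simp add: cong_iff_dvd_diff)
  define A where "A = of_int x + of_int y * \<theta>"
  define \<phi> \<psi> where "\<phi> = A * of_int i" and "\<psi> = econj A * of_int i"
  let ?c = "cong2 (of_nat p) (0 :: eis)"
  have sum: "?c (\<phi> + \<psi>) 1"
  proof -
    have "\<phi> + \<psi> = of_int (2 * x * i)"
      by (rule eis_eqI) (simp_all add: \<phi>_def \<psi>_def A_def algebra_simps)
    then show ?thesis using cong2_of_int[OF i, of 0] by simp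
  qed
  have prod: "?c (\<phi> * \<psi>) (- 1)"
  proof -
    have "\<phi> * \<psi> = of_int (N * i\<^sup>2)"
      by (rule eis_eqI) (simp_all add: \<phi>_def \<psi>_def A_def N_def power2_eq_square algebra_simps)
    moreover have "[N * i\<^sup>2 = - 1] (mod int p)"
    proof -
      have "N * i\<^sup>2 - (- 1) = int p * i\<^sup>2 - (2 * x * i - 1) * (2 * x * i + 1)"
        by (simp add: N_def pxy power2_eq_square algebra_simps)
      then show ?thesis using i' unfolding cong_iff_dvd_diff by simp
    qed
    ultimately show ?thesis using cong2_of_int[of "N * i\<^sup>2" "- 1" p 0] by simp
  qed
  have A\<phi>: "?c ((A * of_int N) ^ M) (\<phi> ^ M)"
  proof -
    \<comment> \<open>N = -4 x^2 modulo p, written so that A N becomes minus a cube times \<phi>;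
      the even exponent \<open>M\<close> absorbs the sign.\<close>
    have "[N = - ((2 * x) ^ 3 * i)] (mod int p)"
    proof -
      have "N - (- ((2 * x) ^ 3 * i)) = int p + (2 * x * i - 1) * (4 * x\<^sup>2)"
        by (simp add: N_def pxy power2_eq_square power3_eq_cube algebra_simps)
      then show ?thesis using i' unfolding cong_iff_dvd_diff by simp
    qed
    then have "?c (A * of_int N) (A * of_int (- ((2 * x) ^ 3 * i)))"
      by (intro cong2_mult cong2_refl cong2_of_int)
    also have "A * of_int (- ((2 * x) ^ 3 * i)) = - (of_int (2 * x) ^ 3 * \<phi>)"
      by (simp add: \<phi>_def mult_ac)
    finally have "?c ((A * of_int N) ^ M) ((- (of_int (2 * x) ^ 3 * \<phi>)) ^ M)" by (rule cong2_power)
    also have "(- (of_int (2 * x) ^ 3 * \<phi>)) ^ M = (of_int (2 * x) ^ 3) ^ M * \<phi> ^ M"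
      using ev by (simp only: power_mult_distrib power_minus_even)
    also have "?c \<dots> (1 * \<phi> ^ M)"
      by (intro cong2_mult cong2_refl int_cube_power_cong assms(1) M p2x)
    finally show ?thesis by simp
  qed
  have frob: "?c (\<phi> ^ p) (if p mod 3 = 1 then \<phi> else \<psi>)"
    using frobenius_eis[OF assms(1) p3(2), of \<phi>] pm by (simp add: \<phi>_def \<psi>_def)
  have e: "[int p = 1 * ((x - 3 * y) * (x + 3 * y))] (mod x\<^sup>2 + 3 * y\<^sup>2)"
  proof -
    have "int p - (1 * ((x - 3 * y) * (x + 3 * y))) = (x\<^sup>2 + 3 * y\<^sup>2) * 4"
      by (simp add: pxy power2_eq_square algebra_simps)
    then show ?thesis unfolding cong_iff_dvd_diff by (metis dvd_triv_left)
  qed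
  have diff: "of_nat (fib (2 * (p div 3) + 1)) * (\<phi> - \<psi>) = of_int (F * (2 * y * i)) * \<theta>"
    by (rule eis_eqI) (simp_all add: F_def \<phi>_def \<psi>_def A_def algebra_simps)
  note fib = fib_cong_of_power[OF assms(1) p3(1) M sum prod _ frob, unfolded diff]
  {
    assume "3 dvd y"
    then have "?c ((A * of_int N) ^ M) 1"
      unfolding N_def using symbol_value_3_dvd[OF cop od x3 A_def assms(1) M pN[unfolded N_def] e]
        by simp
    then have "?c (\<phi> ^ M) (\<omega> ^ 0)" using A\<phi> cong2_sym cong2_trans by (metis power_0)
    from fib[OF this] have "?c (of_int (F * (2 * y * i)) * \<theta>) (\<phi> - \<psi>)" by simp
    then have "[F * (2 * y * i) = 2 * y * i] (mod int p)"
      by (simp add: cong2_eis_iff \<phi>_def \<psi>_def A_def algebra_simps)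
    then have "[2 * y * i * F = 2 * y * i * 1] (mod int p)" by (simp add: mult.commute)
    moreover have "coprime i (int p)" using i
      by (metis coprime_iff_invertible_int mult.commute)
    then have "coprime (2 * y * i) (int p)" using c2y by simp
    ultimately show "[F = 1] (mod int p)" using cong_mult_lcancel by blast
  }
  {
    assume d: "3 dvd y - x"
    then obtain n where n: "y = x + 3 * n" by (metis dvdE add.commute diff_add_cancel)
    \<comment> \<open>Modulo 9 the factors are -2x and 8 x^2, and -16 = 2.\<close>
    have "(x - 3 * y) * int p - 2 * x ^ 3 =
        9 * (- 2 * x ^ 3 - 12 * x\<^sup>2 * n - 24 * x * n\<^sup>2 - 27 * n ^ 3)"
      by (simp add: pxy n power2_eq_square power3_eq_cube algebra_simps)
    then have "[(x - 3 * y) * int p = 2 * x ^ 3] (mod 9)"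
      unfolding cong_iff_dvd_diff by (metis dvd_triv_left)
    then have "?c ((A * of_int N) ^ M) (omega_symbol 2 ^ 2)"
      unfolding N_def
      using symbol_value_3_dvd_diff[OF cop od x3 A_def assms(1) M pN[unfolded N_def] e _ d np3]
      by simp
    then have "?c (\<phi> ^ M) (\<omega>\<^sup>2)" using A\<phi> cong2_sym cong2_trans omega_symbol_2 by metis
    from fib[OF this] have "?c (of_int (F * (2 * y * i)) * \<theta>) (\<omega>\<^sup>2 * \<phi> - \<omega> ^ 4 * \<psi>)" by simp
    then have "?c (2 * (of_int (F * (2 * y * i)) * \<theta>)) (2 * (\<omega>\<^sup>2 * \<phi> - \<omega> ^ 4 * \<psi>))"
      by (intro cong2_mult cong2_refl)
    also have "\<dots> = - (\<phi> - \<psi>) - \<theta> * (\<phi> + \<psi>)" by (rule two_omega_combination)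
    also have "?c \<dots> (- (\<phi> - \<psi>) - \<theta> * 1)" by (intro cong2_diff cong2_mult cong2_refl sum)
    finally have "[2 * (F * (2 * y * i)) = - 1 - 2 * y * i] (mod int p)"
      by (simp add: cong2_eis_iff \<phi>_def \<psi>_def A_def algebra_simps)
    then have "int p dvd 2 * (F * (2 * y * i)) - (- 1 - 2 * y * i)"
      by (simp only: cong_iff_dvd_diff)
    then have "int p dvd (2 * (F * (2 * y * i)) - (- 1 - 2 * y * i)) * (2 * x)
        - (2 * x * i - 1) * (4 * F * y + 2 * y)"
      using i' by (meson dvd_diff dvd_mult2)
    also have "\<dots> = 2 * (2 * y * F - (- (x + y)))"
      by (simp add: algebra_simps)
    finally have "int p dvd 2 * y * F - (- (x + y))" using c2 coprime_dvd_mult_right_iff by blast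
    then show "[2 * y * F = - (x + y)] (mod int p)" by (simp only: cong_iff_dvd_diff)
  }
qed

section \<open>Reduction of the binomial sums\<close>

text \<open>With \<open>odd_sum\<close> these are the two families of Morgan-Voyce polynomials; the
  odd one is there to close the recursion. The value z = 1 gives the sum over all k, and z = -1
  separates the even k.\<close>

definition even_sum :: "int \<Rightarrow> nat \<Rightarrow> int" where
  "even_sum z n = (\<Sum>k\<le>n. int ((n + k) choose (2 * k)) * z ^ k)"

definition odd_sum :: "int \<Rightarrow> nat \<Rightarrow> int" where
  "odd_sum z n = (\<Sum>k\<le>n. int ((n + k + 1) choose (2 * k + 1)) * z ^ k)"

lemma even_sum_Suc: "even_sum z (Suc n) = even_sum z n + z * odd_sum z n"
proof -
  have "even_sum z (Suc n) = 1 + (\<Sum>k\<le>n. int ((n + k + 2) choose (2 * k + 2)) * z ^ Suc k)"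
    unfolding even_sum_def by (subst sum.atMost_Suc_shift) simp
  also have "(\<Sum>k\<le>n. int ((n + k + 2) choose (2 * k + 2)) * z ^ Suc k)
      = (\<Sum>k\<le>n. int ((n + Suc k) choose (2 * Suc k)) * z ^ Suc k) + z * odd_sum z n"
    unfolding odd_sum_def sum_distrib_left sum.distrib[symmetric]
    by (intro sum.cong refl) (simp add: algebra_simps)
  also have "1 + ((\<Sum>k\<le>n. int ((n + Suc k) choose (2 * Suc k)) * z ^ Suc k) + z * odd_sum z n)
      = (\<Sum>k\<le>Suc n. int ((n + k) choose (2 * k)) * z ^ k) + z * odd_sum z n"
    by (subst sum.atMost_Suc_shift) simp
  also have "\<dots> = even_sum z n + z * odd_sum z n" by (simp add: even_sum_def binomial_eq_0)
  finally show ?thesis .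
qed

lemma odd_sum_Suc: "odd_sum z (Suc n) = odd_sum z n + even_sum z (Suc n)"
proof -
  have "odd_sum z (Suc n) = (\<Sum>k\<le>Suc n. int ((n + k + 1) choose (2 * k + 1)) * z ^ k) + even_sum z (Suc n)"
    unfolding odd_sum_def even_sum_def sum.distrib[symmetric]
    by (intro sum.cong refl) (simp add: algebra_simps)
  also have "(\<Sum>k\<le>Suc n. int ((n + k + 1) choose (2 * k + 1)) * z ^ k) = odd_sum z n"
    by (simp add: odd_sum_def binomial_eq_0)
  finally show ?thesis .
qed

lemma even_sum_0 [simp]: "even_sum z 0 = 1" and odd_sum_0 [simp]: "odd_sum z 0 = 1"
  by (simp_all add: even_sum_def odd_sum_def)

lemma even_sum_1_eq_fib: "even_sum 1 n = int (fib (2 * n + 1)) \<and> odd_sum 1 n = int (fib (2 * n + 2))"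
  by (induction n) (simp_all add: even_sum_Suc odd_sum_Suc)

text \<open>At z = -1 the matrix of the recursion has trace 1 and determinant 1, so its eigenvalues
  are primitive sixth roots of unity.\<close>

lemma even_sum_minus_1_period: "even_sum (- 1) (n + 6) = even_sum (- 1) n" "odd_sum (- 1) (n + 6) = odd_sum (- 1) n"
  by (simp_all add: eval_nat_numeral even_sum_Suc odd_sum_Suc)

lemma even_sum_minus_1_mod: "even_sum (- 1) n = even_sum (- 1) (n mod 6)"
proof -
  have "even_sum (- 1) (m + 6 * k) = even_sum (- 1) m" for m k
  proof (induction k)
    case (Suc k)
    then show ?case using even_sum_minus_1_period(1)[of "m + 6 * k"] by (simp add: algebra_simps)
  qed simp
  from this[of "n mod 6" "n div 6"] show ?thesis by simp
qed

lemma even_sum_minus_1_values: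
  "even_sum (- 1) (Suc 0) = 0" "even_sum (- 1) 2 = - 1" "even_sum (- 1) 3 = - 1"
  "even_sum (- 1) 4 = 0" "even_sum (- 1) 5 = 1"
  by (simp_all add: eval_nat_numeral even_sum_Suc odd_sum_Suc)

text \<open>The residue of p modulo 18 determines both p div 3 modulo 6 and p modulo 9; six residues
  are prime to 18.\<close>

lemma even_sum_minus_1_eq_eps:
  assumes "prime p" "p > 5"
  shows "even_sum (- 1) (p div 3) = eps p"
proof -
  have "odd p" using assms prime_odd_nat[of p] by simp
  have "\<not> 3 dvd p" using assms primes_dvd_imp_eq[of 3 p] by auto
  define d where "d = p mod 18"
  have p: "p = 18 * (p div 18) + d" by (simp add: d_def)
  have "d < 18" by (simp add: d_def)
  moreover have "odd d" using \<open>odd p\<close> p by presburger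
  moreover have "\<not> 3 dvd d" using \<open>\<not> 3 dvd p\<close> p by presburger
  ultimately have "d \<in> {1, 5, 7, 11, 13, 17}"
    by (auto simp: numeral_eq_Suc less_Suc_eq elim!: oddE) presburger+
  moreover have "p div 3 mod 6 = d div 3"
  proof -
    have "p = d + 3 * (6 * (p div 18))" using p by simp
    then have "p div 3 = 6 * (p div 18) + d div 3" by (metis div_mult_self2 zero_neq_numeral)
    then show ?thesis using \<open>d < 18\<close> by simp
  qed
  moreover have "int p mod 9 = int d mod 9"
  proof -
    have "int p = int d + 9 * (2 * int (p div 18))" using p by (simp flip: of_nat_mult of_nat_add)
    then show ?thesis by (metis mod_mult_self2)
  qed
  ultimately show ?thesis unfolding eps_def cong_def even_sum_minus_1_mod[of "p div 3"]
    by (elim insertE) (simp_all add: even_sum_minus_1_values)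
qed

lemma even_part_sum:
  fixes f :: "nat \<Rightarrow> int"
  shows "2 * (\<Sum>k\<le>n div 2. f (2 * k)) = (\<Sum>k\<le>n. f k) + (\<Sum>k\<le>n. f k * (- 1) ^ k)"
proof (induction n)
  case (Suc n)
  show ?case
  proof (cases "even n")
    case True
    then have "Suc n div 2 = n div 2" by simp
    then show ?thesis using Suc True by simp
  next
    case False
    then have "Suc n div 2 = Suc (n div 2)" "2 * Suc (n div 2) = Suc n" by (auto elim!: oddE)
    then show ?thesis using Suc False by (simp add: algebra_simps)
  qed
qed simp

section \<open>Comparison of binomial coefficients modulo p\<close>

lemma Suc_choose_double:
  assumes "k < n"
  shows "((n + Suc k) choose (2 * Suc k)) * ((2 * k + 1) * (2 * k + 2))
    = ((n + k) choose (2 * k)) * ((n + k + 1) * (n - k))"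
proof -
  have 1: "((n + Suc k) choose (2 * Suc k)) * (2 * k + 2) = ((n + k) choose (2 * k + 1)) * (n + k + 1)"
    using Suc_times_binomial_eq[of "n + k" "2 * k + 1"] by (simp add: mult.commute)
  have 2: "((n + k) choose (2 * k + 1)) * (2 * k + 1) = ((n + k) choose (2 * k)) * (n - k)"
    using binomial_absorb_comp[of "n + k" "2 * k"] Suc_times_binomial_eq[of "n + k - 1" "2 * k"] assms
    by (simp add: mult.commute)
  have "((n + Suc k) choose (2 * Suc k)) * ((2 * k + 1) * (2 * k + 2))
      = ((n + Suc k) choose (2 * Suc k)) * (2 * k + 2) * (2 * k + 1)" by (simp only: mult_ac)
  also have "\<dots> = ((n + k) choose (2 * k + 1)) * (2 * k + 1) * (n + k + 1)"
    unfolding 1 by (simp only: mult_ac)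
  also have "\<dots> = ((n + k) choose (2 * k)) * ((n + k + 1) * (n - k))"
    unfolding 2 by (simp only: mult_ac)
  finally show ?thesis .
qed

lemma Suc_choose_triple:
  "((3 * Suc k) choose Suc k) * ((2 * k + 1) * (2 * k + 2))
    = ((3 * k) choose k) * (3 * ((3 * k + 1) * (3 * k + 2)))"
proof -
  have f: "fact (3 * Suc k) = (3 * (k + 1)) * (3 * k + 2) * (3 * k + 1) * (fact (3 * k) :: nat)"
    "fact (2 * Suc k) = (2 * k + 2) * (2 * k + 1) * (fact (2 * k) :: nat)"
    by (simp_all add: eval_nat_numeral algebra_simps)
  have "fact (Suc k) * fact (2 * Suc k) * ((3 * Suc k) choose Suc k) = (fact (3 * Suc k) :: nat)"
    using binomial_fact_lemma[of "Suc k" "3 * Suc k"] by (simp del: fact_Suc)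
  moreover have "fact k * fact (2 * k) * ((3 * k) choose k) = (fact (3 * k) :: nat)"
    using binomial_fact_lemma[of k "3 * k"] by simp
  ultimately have "(k + 1) * (fact k * fact (2 * k)) * (((3 * Suc k) choose Suc k) * ((2 * k + 1) * (2 * k + 2)))
      = (k + 1) * (fact k * fact (2 * k)) * (((3 * k) choose k) * (3 * ((3 * k + 1) * (3 * k + 2))))"
    unfolding f by (simp add: algebra_simps)
  then show ?thesis by simp
qed

text \<open>Induction on k by comparing the quotients of consecutive terms, given by
  \<open>Suc_choose_double\<close> and \<open>Suc_choose_triple\<close>.\<close>

lemma choose_cong:
  assumes "prime p" "p > 5" "k \<le> p div 3"
  shows "[(- 27) ^ k * int ((p div 3 + k) choose (2 * k)) = int ((3 * k) choose k)] (mod int p)"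
  using assms(3)
proof (induction k)
  case (Suc k)
  define n where "n = p div 3"
  have kn: "k < n" using Suc.prems by (simp add: n_def)
  have IH: "[(- 27) ^ k * int ((n + k) choose (2 * k)) = int ((3 * k) choose k)] (mod int p)"
    using Suc by (simp add: n_def)
  let ?d = "int ((2 * k + 1) * (2 * k + 2))"
  have "coprime ((2 * k + 1) * (2 * k + 2)) p"
  proof -
    \<comment> \<open>This bound allows the common denominator of the two quotients to be cancelled
      modulo p.\<close>
    have "2 * k + 2 < p" using kn unfolding n_def by presburger
    then have "\<not> p dvd 2 * k + 1" "\<not> p dvd 2 * k + 2" by (auto dest: dvd_imp_le)
    then have "coprime p (2 * k + 1)" "coprime p (2 * k + 2)"
      using assms(1) prime_imp_coprime by blast+
    then show ?thesis by (simp only: coprime_mult_left_iff coprime_commute[of p])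
  qed
  then have cop: "coprime ?d (int p)" by (simp only: coprime_int_iff)
  have 1: "int ((n + Suc k) choose (2 * Suc k)) * ?d
      = int ((n + k) choose (2 * k)) * ((int n + int k + 1) * (int n - int k))"
    using arg_cong[OF Suc_choose_double[OF kn], of int] kn by (simp only: of_nat_mult of_nat_add of_nat_diff) simp
  have 2: "int ((3 * Suc k) choose Suc k) * ?d
      = int ((3 * k) choose k) * (3 * ((3 * int k + 1) * (3 * int k + 2)))"
    using arg_cong[OF Suc_choose_triple[of k], of int] by (simp only: of_nat_mult of_nat_add) simp
  \<comment> \<open>The left side is -3 (3n + 3k + 3)(3n - 3k), and 3n is -1 or -2 modulo p. The two
    possibilities only interchange the factors 3k + 1 and 3k + 2.\<close>
  have 3: "[- 27 * ((int n + int k + 1) * (int n - int k)) = 3 * ((3 * int k + 1) * (3 * int k + 2))] (mod int p)"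
  proof -
    have "\<not> 3 dvd p" using assms primes_dvd_imp_eq[of 3 p] by auto
    then have "p = 3 * n + 1 \<or> p = 3 * n + 2" unfolding n_def by presburger
    then have "- 27 * ((int n + int k + 1) * (int n - int k)) - 3 * ((3 * int k + 1) * (3 * int k + 2))
        = int p * (- 3 * (3 * int n + 3 - 1)) \<or>
      - 27 * ((int n + int k + 1) * (int n - int k)) - 3 * ((3 * int k + 1) * (3 * int k + 2))
        = int p * (- 3 * (3 * int n + 1))"
      by (auto simp: algebra_simps)
    then show ?thesis unfolding cong_iff_dvd_diff by (metis dvd_triv_left)
  qed
  have "(- 27) ^ Suc k * int ((n + Suc k) choose (2 * Suc k)) * ?d
      = (- 27) ^ k * int ((n + k) choose (2 * k)) * (- 27 * ((int n + int k + 1) * (int n - int k)))"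
    using 1 by (simp only: power_Suc mult_ac)
  also have "[\<dots> = int ((3 * k) choose k) * (3 * ((3 * int k + 1) * (3 * int k + 2)))] (mod int p)"
    by (intro cong_mult IH 3)
  also have "int ((3 * k) choose k) * (3 * ((3 * int k + 1) * (3 * int k + 2))) = int ((3 * Suc k) choose Suc k) * ?d"
    by (simp only: 2)
  finally show ?case using cop unfolding n_def by (simp only: cong_mult_rcancel)
qed simp

lemma quot_mod_cong:
  assumes "prime p" "coprime b (int p)" "[b * c = a] (mod int p)"
  shows "[quot_mod p a b = c] (mod int p)"
proof -
  have "[a * modular_inverse (int p) b = b * c * modular_inverse (int p) b] (mod int p)"
    by (intro cong_mult cong_refl cong_sym[OF assms(3)])
  also have "b * c * modular_inverse (int p) b = b * modular_inverse (int p) b * c"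
    by (simp only: mult_ac)
  also have "[\<dots> = 1 * c] (mod int p)"
    using assms(2) by (intro cong_mult cong_refl cong_modular_inverse1)
  finally show ?thesis by (simp add: quot_mod_def)
qed

lemma sum_choose_triple_cong_fib:
  assumes "prime p" "p > 5"
  shows "[(\<Sum>k = 0..p div 3. quot_mod p (int ((3 * k) choose k)) ((- 27) ^ k))
    = int (fib (2 * (p div 3) + 1))] (mod int p)"
proof -
  have "[(\<Sum>k = 0..p div 3. quot_mod p (int ((3 * k) choose k)) ((- 27) ^ k))
      = (\<Sum>k = 0..p div 3. int ((p div 3 + k) choose (2 * k)))] (mod int p)"
    using choose_cong[OF assms] coprime_denominator_sums[OF assms]
    by (intro cong_sum quot_mod_cong assms(1)) auto
  also have "(\<Sum>k = 0..p div 3. int ((p div 3 + k) choose (2 * k))) = even_sum 1 (p div 3)"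
    by (simp add: even_sum_def atLeast0AtMost)
  also have "\<dots> = int (fib (2 * (p div 3) + 1))" using even_sum_1_eq_fib by blast
  finally show ?thesis .
qed

text \<open>Its terms are those of the other sum at even index, where (-27)^(2k) = 27^(2k). Twice
  the even part of a sum is the sum plus its alternating version, which is
  \<open>eps p\<close>.\<close>

lemma sum_choose_sextuple_cong_fib:
  assumes "prime p" "p > 5"
  shows "[2 * (\<Sum>k = 0..p div 6. quot_mod p (int ((6 * k) choose (2 * k))) (27 ^ (2 * k)))
    = int (fib (2 * (p div 3) + 1)) + eps p] (mod int p)"
proof -
  define n where "n = p div 3"
  have n2: "p div 6 = n div 2" unfolding n_def by simp
  have quot: "[quot_mod p (int ((6 * k) choose (2 * k))) (27 ^ (2 * k)) = int ((n + 2 * k) choose (2 * (2 * k)))] (mod int p)"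
    if "k \<le> n div 2" for k
  proof (rule quot_mod_cong[OF assms(1) coprime_denominator_sums(1)[OF assms]])
    have "2 * k \<le> p div 3" using that unfolding n_def by presburger
    from choose_cong[OF assms this]
    show "[27 ^ (2 * k) * int ((n + 2 * k) choose (2 * (2 * k))) = int ((6 * k) choose (2 * k))] (mod int p)"
      by (simp add: n_def)
  qed
  have "[2 * (\<Sum>k = 0..p div 6. quot_mod p (int ((6 * k) choose (2 * k))) (27 ^ (2 * k)))
      = 2 * (\<Sum>k = 0..p div 6. int ((n + 2 * k) choose (2 * (2 * k))))] (mod int p)"
    using quot n2 by (intro cong_mult cong_refl cong_sum) auto
  also have "2 * (\<Sum>k = 0..p div 6. int ((n + 2 * k) choose (2 * (2 * k)))) = even_sum 1 n + even_sum (- 1) n"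
    unfolding n2 even_sum_def atLeast0AtMost
    using even_part_sum[of "\<lambda>k. int ((n + k) choose (2 * k))" n] by simp
  also have "\<dots> = int (fib (2 * (p div 3) + 1)) + eps p"
    using even_sum_1_eq_fib even_sum_minus_1_eq_eps[OF assms] unfolding n_def by simp
  finally show ?thesis .
qed

section \<open>Representation by quadratic forms of discriminant -60\<close>

lemma Legendre_values: "Legendre a p \<in> {- 1, 0, 1}"
  by (simp add: Legendre_def)

lemma Legendre_3:
  assumes "p mod 3 = 1 \<or> p mod 3 = (2 :: int)"
  shows "Legendre p 3 = (if p mod 3 = 1 then 1 else - 1)"
proof -
  have sq: "y\<^sup>2 mod 3 = 0 \<or> y\<^sup>2 mod 3 = 1" for y :: int
  proof -
    have "y mod 3 = 0 \<or> y mod 3 = 1 \<or> y mod 3 = 2" by presburger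
    moreover have "y\<^sup>2 mod 3 = (y mod 3)\<^sup>2 mod 3" by (simp add: power_mod)
    ultimately show ?thesis by auto
  qed
  have "QuadRes 3 p \<longleftrightarrow> p mod 3 = 1"
  proof
    assume "QuadRes 3 p"
    then obtain y where "y\<^sup>2 mod 3 = p mod 3" unfolding QuadRes_def cong_def by blast
    then show "p mod 3 = 1" using sq[of y] assms by auto
  next
    assume "p mod 3 = 1"
    then have "[1\<^sup>2 = p] (mod 3)" by (simp add: cong_def)
    then show "QuadRes 3 p" unfolding QuadRes_def by blast
  qed
  then show ?thesis using assms by (auto simp: Legendre_def cong_def)
qed

lemma Legendre_5:
  assumes "p mod 5 \<noteq> (0 :: int)"
  shows "Legendre p 5 = (if p mod 5 = 1 \<or> p mod 5 = 4 then 1 else - 1)"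
proof -
  have sq: "y\<^sup>2 mod 5 = 0 \<or> y\<^sup>2 mod 5 = 1 \<or> y\<^sup>2 mod 5 = 4" for y :: int
  proof -
    have "y mod 5 = 0 \<or> y mod 5 = 1 \<or> y mod 5 = 2 \<or> y mod 5 = 3 \<or> y mod 5 = 4" by presburger
    moreover have "y\<^sup>2 mod 5 = (y mod 5)\<^sup>2 mod 5" by (simp add: power_mod)
    ultimately show ?thesis by auto
  qed
  have "QuadRes 5 p \<longleftrightarrow> p mod 5 = 1 \<or> p mod 5 = 4"
  proof
    assume "QuadRes 5 p"
    then obtain y where "y\<^sup>2 mod 5 = p mod 5" unfolding QuadRes_def cong_def by blast
    then show "p mod 5 = 1 \<or> p mod 5 = 4" using sq[of y] assms by auto
  next
    assume "p mod 5 = 1 \<or> p mod 5 = 4"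
    then have "[1\<^sup>2 = p] (mod 5) \<or> [2\<^sup>2 = p] (mod 5)" by (auto simp: cong_def)
    then show "QuadRes 5 p" unfolding QuadRes_def by blast
  qed
  then show ?thesis using assms by (auto simp: Legendre_def cong_def)
qed

text \<open>By reciprocity -15 has the Legendre symbol (p/3)(p/5): the sign from the pair 3, p
  cancels the symbol of -1. In the four classes both factors are 1 or both are -1.\<close>

lemma minus_15_square:
  assumes "prime p" "p > 5" "p mod 15 \<in> {1, 2, 4, 8}"
  obtains t where "int p dvd t\<^sup>2 + 15"
proof -
  define h where "h = (p - 1) div 2"
  have p2: "2 < p" using assms by simp
  have QR3: "Legendre (int p) 3 * Legendre 3 (int p) = (- 1) ^ h"
    using Quadratic_Reciprocity[OF assms(1) p2, of 3] assms(2) by (simp add: h_def)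
  have QR5: "Legendre (int p) 5 * Legendre 5 (int p) = 1"
    using Quadratic_Reciprocity[OF assms(1) p2, of 5] assms(2)
    by (simp add: power_mult mult.commute)
  have "int p mod 3 = int (p mod 15 mod 3)" "int p mod 5 = int (p mod 15 mod 5)"
    by (simp_all add: mod_mod_cancel zmod_int)
  then have m: "(int p mod 3 = 1 \<and> (int p mod 5 = 1 \<or> int p mod 5 = 4)) \<or>
      (int p mod 3 = 2 \<and> (int p mod 5 = 2 \<or> int p mod 5 = 3))"
    using assms(3) by auto
  then have L: "Legendre (int p) 3 * Legendre (int p) 5 = 1"
    using Legendre_3[of "int p"] Legendre_5[of "int p"] by auto
  have L35: "Legendre 3 (int p) * Legendre 5 (int p) = (- 1) ^ h"
  proof -
    have "Legendre 3 (int p) * Legendre 5 (int p)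
        = (Legendre (int p) 3 * Legendre (int p) 5) * (Legendre 3 (int p) * Legendre 5 (int p))" using L by simp
    also have "\<dots> = (Legendre (int p) 3 * Legendre 3 (int p)) * (Legendre (int p) 5 * Legendre 5 (int p))"
      by (simp only: mult_ac)
    finally show ?thesis using QR3 QR5 by simp
  qed
  have "[Legendre (- 15) (int p) = (- 15) ^ h] (mod int p)"
    unfolding h_def by (rule euler_criterion[OF assms(1) p2])
  also have "(- 15 :: int) ^ h = (- 1) ^ h * (3 ^ h * 5 ^ h)"
    by (simp flip: power_mult_distrib)
  also have "[\<dots> = (- 1) ^ h * (Legendre 3 (int p) * Legendre 5 (int p))] (mod int p)"
    unfolding h_def by (intro cong_mult cong_refl cong_sym[OF euler_criterion] assms(1) p2)
  also have "(- 1) ^ h * (Legendre 3 (int p) * Legendre 5 (int p)) = 1"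
    unfolding L35 by (simp flip: power_add)
  finally have "[Legendre (- 15) (int p) = 1] (mod int p)" .
  then have d: "int p dvd Legendre (- 15) (int p) - 1" by (simp add: cong_iff_dvd_diff)
  have "Legendre (- 15) (int p) = 1"
  proof (rule ccontr)
    assume "Legendre (- 15) (int p) \<noteq> 1"
    then have "Legendre (- 15) (int p) - 1 = - 1 \<or> Legendre (- 15) (int p) - 1 = - 2"
      using Legendre_values[of "- 15" "int p"] by auto
    then have "int p dvd - 1 \<or> int p dvd - 2" using d by metis
    then have "int p dvd 1 \<or> int p dvd 2" unfolding dvd_minus_iff .
    then show False using assms(2) by (auto dest: zdvd_imp_le)
  qed
  then have "QuadRes (int p) (- 15)" by (auto simp: Legendre_def split: if_splits)
  then obtain t where "[t\<^sup>2 = - 15] (mod int p)" unfolding QuadRes_def by blast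
  then show ?thesis using that by (simp add: cong_iff_dvd_diff)
qed

text \<open>Pigeonhole: more than p pairs (a, b) have entries between 0 and the integer part of the
  root of p, so two of them share the value of a - t b modulo p.\<close>

lemma thue:
  assumes "prime p"
  obtains u v where "u \<noteq> 0 \<or> v \<noteq> 0" "u\<^sup>2 < int p" "v\<^sup>2 < int p" "int p dvd u - t * v"
proof -
  define m where "m = floor_sqrt p"
  have m: "m\<^sup>2 \<le> p" "p < (Suc m)\<^sup>2" by (simp_all add: m_def Suc_floor_sqrt_power2_gt)
  define S where "S = {0..int m} \<times> {0..int m}"
  define f where "f = (\<lambda>(a, b). (a - t * b) mod int p)"
  have "f ` S \<subseteq> {0..<int p}" using prime_gt_0_nat[OF assms] by (auto simp: f_def)
  then have "card (f ` S) \<le> p" using card_mono[of "{0..<int p}" "f ` S"] by simp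
  also have "p < card S" using m(2)
    by (simp add: S_def power2_eq_square card_cartesian_product nat_add_distrib)
  finally have "\<not> inj_on f S" using card_image by force
  then obtain a b a' b' where ab: "(a, b) \<in> S" "(a', b') \<in> S" "f (a, b) = f (a', b')" "(a, b) \<noteq> (a', b')"
    unfolding inj_on_def by auto
  \<comment> \<open>A prime is not a square, which makes the bounds strict.\<close>
  have ne: "m\<^sup>2 \<noteq> p" using assms by (metis prime_power_iff numeral_eq_one_iff semiring_norm(85))
  have sq: "c\<^sup>2 < int p" if "\<bar>c\<bar> \<le> int m" for c
  proof -
    have "c\<^sup>2 \<le> (int m)\<^sup>2" using that by (metis abs_le_square_iff abs_of_nat)
    also have "\<dots> = int (m\<^sup>2)" by simp
    also have "\<dots> < int p" using m(1) ne by linarith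
    finally show ?thesis .
  qed
  show ?thesis
  proof (rule that[of "a - a'" "b - b'"])
    show "a - a' \<noteq> 0 \<or> b - b' \<noteq> 0" using ab(4) by auto
    have "\<bar>a - a'\<bar> \<le> int m" "\<bar>b - b'\<bar> \<le> int m" using ab(1,2) by (auto simp: S_def)
    then show "(a - a')\<^sup>2 < int p" "(b - b')\<^sup>2 < int p" by (simp_all add: sq)
    have "int p dvd (a - t * b) - (a' - t * b')" using ab(3) by (simp add: f_def mod_eq_dvd_iff)
    then show "int p dvd a - a' - t * (b - b')" by (simp add: algebra_simps)
  qed
qed

text \<open>With u = t v modulo p and t^2 = -15 the form is a multiple of p, and it is positive and
  below 16 p.\<close>

lemma small_multiple:
  assumes "prime p" "p > 5" "p mod 15 \<in> {1, 2, 4, 8}"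
  obtains u v k :: int where "u\<^sup>2 + 15 * v\<^sup>2 = k * int p" "k \<in> {1..15}"
proof -
  obtain t where t: "int p dvd t\<^sup>2 + 15" using minus_15_square[OF assms] .
  obtain u v where uv: "u \<noteq> 0 \<or> v \<noteq> 0" "u\<^sup>2 < int p" "v\<^sup>2 < int p" "int p dvd u - t * v"
    using thue[OF assms(1)] .
  have "int p dvd (u - t * v) * (u + t * v) + (t\<^sup>2 + 15) * v\<^sup>2"
    using t uv(4) by (meson dvd_add dvd_mult2)
  also have "(u - t * v) * (u + t * v) + (t\<^sup>2 + 15) * v\<^sup>2 = u\<^sup>2 + 15 * v\<^sup>2"
    by (simp add: power2_eq_square algebra_simps)
  finally obtain k where k: "u\<^sup>2 + 15 * v\<^sup>2 = int p * k" by (auto simp: dvd_def)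
  have "u\<^sup>2 + 15 * v\<^sup>2 > 0"
    using uv(1) zero_le_power2[of u] zero_le_power2[of v] zero_less_power2[of u] zero_less_power2[of v] by linarith
  then have "k > 0" using k assms(2) by (simp add: zero_less_mult_iff)
  moreover have "int p * k < int p * 16" using uv(2,3) k by linarith
  then have "k < 16" using assms(2) by simp
  ultimately show ?thesis using that[of u v k] k by (simp add: mult.commute)
qed

section \<open>Parity arguments for binary forms\<close>

lemma odd_square_mod_8:
  assumes "odd (u :: int)"
  obtains c where "u\<^sup>2 = 8 * c + 1"
proof -
  obtain a where a: "u = 2 * a + 1" using assms by (auto elim: oddE)
  have "even (a * (a + 1))" by simp
  then obtain c where c: "a * (a + 1) = 2 * c" by (rule evenE)
  have "u\<^sup>2 = 4 * (a * (a + 1)) + 1" by (simp add: a power2_eq_square algebra_simps)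
  then show ?thesis using c that by simp
qed

text \<open>Odd squares are 1 modulo 8, so two odd arguments give a + b = 0 modulo 8. The
  coefficient pairs in use are 1, 15 and 3, 5.\<close>

lemma form_parity:
  fixes a b u v :: int
  assumes "odd a" "odd b" "8 dvd a + b" "even (a * u\<^sup>2 + b * v\<^sup>2)"
  shows "(even u \<and> even v) \<or> 8 dvd a * u\<^sup>2 + b * v\<^sup>2"
proof (cases "even u")
  case True
  then show ?thesis using assms by simp
next
  case False
  then have "odd v" using assms by simp
  obtain c d where "u\<^sup>2 = 8 * c + 1" "v\<^sup>2 = 8 * d + 1" using odd_square_mod_8 False \<open>odd v\<close> by metis
  then have "a * u\<^sup>2 + b * v\<^sup>2 = 8 * (a * c + b * d) + (a + b)" by (simp add: algebra_simps)
  then show ?thesis using assms(3) by simp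
qed

lemma form_not_twice_odd:
  fixes a b u v q :: int
  assumes "odd a" "odd b" "8 dvd a + b" "odd q"
  shows "a * u\<^sup>2 + b * v\<^sup>2 \<noteq> 2 * q"
proof
  assume eq: "a * u\<^sup>2 + b * v\<^sup>2 = 2 * q"
  then consider "even u" "even v" | "8 dvd 2 * q" using form_parity[OF assms(1-3), of u v] by auto
  then have "4 dvd 2 * q"
  proof cases
    case 1
    then obtain c d where "u = 2 * c" "v = 2 * d" by (auto elim!: evenE)
    then have "2 * q = 4 * (a * c\<^sup>2 + b * d\<^sup>2)" unfolding eq[symmetric]
      by (simp add: power2_eq_square algebra_simps)
    then show ?thesis by simp
  qed presburger
  then show False using assms(4) by presburger
qed

lemma form_four_times_odd:
  fixes a b u v q :: int
  assumes "odd a" "odd b" "8 dvd a + b" "odd q" "a * u\<^sup>2 + b * v\<^sup>2 = 4 * q"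
  obtains c d where "a * c\<^sup>2 + b * d\<^sup>2 = q"
proof -
  have "\<not> 8 dvd 4 * q" using assms(4) by presburger
  then have "even u" "even v" using form_parity[OF assms(1-3), of u v] assms(5) by auto
  then obtain c d where "u = 2 * c" "v = 2 * d" by (auto elim!: evenE)
  then have "4 * q = 4 * (a * c\<^sup>2 + b * d\<^sup>2)" unfolding assms(5)[symmetric]
    by (simp add: power2_eq_square algebra_simps)
  then have "a * c\<^sup>2 + b * d\<^sup>2 = q" by simp
  then show ?thesis by (rule that)
qed

lemma prime_dvd_square_plus:
  fixes q :: int
  assumes "prime q" "u\<^sup>2 + 15 * v\<^sup>2 = k * m" "q dvd 15" "q dvd k"
  obtains a where "u = q * a"
proof -
  have "q dvd k * m - 15 * v\<^sup>2" using assms(3,4) by (intro dvd_diff dvd_mult2)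
  also have "k * m - 15 * v\<^sup>2 = u\<^sup>2" using assms(2) by simp
  finally have "q dvd u" using assms(1) prime_dvd_power by blast
  then show ?thesis using that by (auto simp: dvd_def)
qed

lemma square_mod_15: "(u :: int)\<^sup>2 mod 15 \<in> {0, 1, 4, 6, 9, 10}"
proof -
  define n where "n = nat (u mod 15)"
  have n: "u mod 15 = int n" "n \<in> {..<15}" by (simp_all add: n_def)
  from n(2) have "(int n)\<^sup>2 mod 15 \<in> {0, 1, 4, 6, 9, 10}"
    by (simp add: lessThan_nat_numeral lessThan_Suc) (elim disjE; simp)
  then show ?thesis using n(1) by (metis power_mod)
qed

text \<open>The product k p must be a square modulo 15, which leaves six multipliers for each pair
  of classes.\<close>

lemma multiplier_mod_15:
  fixes k :: int
  assumes "u\<^sup>2 + 15 * v\<^sup>2 = k * int p" "k \<in> {1..15}"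
  shows "p mod 15 \<in> {1, 4} \<Longrightarrow> k \<in> {1, 4, 6, 9, 10, 15}"
    and "p mod 15 \<in> {2, 8} \<Longrightarrow> k \<in> {2, 3, 5, 8, 12, 15}"
proof -
  have "(k * int (p mod 15)) mod 15 = (u\<^sup>2 + 15 * v\<^sup>2) mod 15"
    unfolding assms(1) by (simp add: zmod_int mod_mult_right_eq)
  then have 1: "(k * int (p mod 15)) mod 15 \<in> {0, 1, 4, 6, 9, 10}" using square_mod_15[of u] by simp
  have "k = 1 \<or> k = 2 \<or> k = 3 \<or> k = 4 \<or> k = 5 \<or> k = 6 \<or> k = 7 \<or> k = 8 \<or> k = 9 \<or> k = 10 \<or>
      k = 11 \<or> k = 12 \<or> k = 13 \<or> k = 14 \<or> k = 15"
    using assms(2) by simp arith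
  then show "p mod 15 \<in> {1, 4} \<Longrightarrow> k \<in> {1, 4, 6, 9, 10, 15}"
    and "p mod 15 \<in> {2, 8} \<Longrightarrow> k \<in> {2, 3, 5, 8, 12, 15}"
    using 1 by (elim disjE; force)+
qed

text \<open>Multipliers 6 and 10 would represent 2p by 3a^2 + 5b^2, against parity. From 4, 9 and 15
  a common factor can be removed, with the variables exchanged for 15.\<close>

lemma prime_eq_x2_15y2:
  assumes "prime p" "p > 5" "p mod 15 \<in> {1, 4}"
  shows "\<exists>x y :: int. int p = x\<^sup>2 + 15 * y\<^sup>2"
proof -
  have od: "odd (int p)" using assms(1,2) prime_odd_nat[of p] by simp
  obtain u v k where uv: "u\<^sup>2 + 15 * v\<^sup>2 = k * int p" "k \<in> {1..15}"
    using small_multiple[OF assms(1,2)] assms(3) by auto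
  have "k \<in> {1, 4, 6, 9, 10, 15}" using multiplier_mod_15(1)[OF uv assms(3)] .
  then consider "k = 1" | "k = 4" | "k = 6" | "k = 9" | "k = 10" | "k = 15" by auto
  then show ?thesis
  proof cases
    case 1
    then show ?thesis using uv by (metis mult_1)
  next
    case 2
    then obtain c d where "1 * c\<^sup>2 + 15 * d\<^sup>2 = int p"
      using form_four_times_odd[of 1 15 "int p" u v] uv od by auto
    then show ?thesis by (metis mult_1)
  next
    case 3
    obtain a where "u = 3 * a" using prime_dvd_square_plus[OF _ uv(1), of 3] 3 by auto
    then have "3 * a\<^sup>2 + 5 * v\<^sup>2 = 2 * int p" using uv(1) 3 by (simp add: power_mult_distrib)
    then show ?thesis using form_not_twice_odd[of 3 5 "int p" a v] od by simp
  next
    case 4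
    obtain a where a: "u = 3 * a" using prime_dvd_square_plus[OF _ uv(1), of 3] 4 by auto
    then have eq: "3 * a\<^sup>2 + 5 * v\<^sup>2 = 3 * int p" using uv(1) 4 by (simp add: power_mult_distrib)
    then have "5 * v\<^sup>2 = 3 * (int p - a\<^sup>2)" by simp
    then have "3 dvd 5 * v\<^sup>2" by simp
    then have "3 dvd v\<^sup>2" by presburger
    then have "3 dvd v" using prime_dvd_power[of "3 :: int"] by simp
    then obtain b where "v = 3 * b" by (auto simp: dvd_def)
    then have "int p = a\<^sup>2 + 15 * b\<^sup>2" using eq by (simp add: power_mult_distrib)
    then show ?thesis by blast
  next
    case 5
    obtain a where "u = 5 * a" using prime_dvd_square_plus[OF _ uv(1), of 5] 5 by auto
    then have "5 * a\<^sup>2 + 3 * v\<^sup>2 = 2 * int p" using uv(1) 5 by (simp add: power_mult_distrib)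
    then show ?thesis using form_not_twice_odd[of 5 3 "int p" a v] od by simp
  next
    case 6
    obtain a where a: "u = 3 * a" using prime_dvd_square_plus[OF _ uv(1), of 3] 6 by auto
    obtain b where b: "u = 5 * b" using prime_dvd_square_plus[OF _ uv(1), of 5] 6 by auto
    \<comment> \<open>15 c = 6u - 5u = u.\<close>
    define c where "c = 2 * b - a"
    have "u = 15 * c" using a b by (simp add: c_def)
    then have "int p = v\<^sup>2 + 15 * c\<^sup>2" using uv(1) 6 by (simp add: power_mult_distrib)
    then show ?thesis by blast
  qed
qed

text \<open>Multiplier 8 with odd arguments allows no division by 2. Instead u = 3v or u = -3v
  modulo 8, and after choosing the sign w of v the substitution u = 8s - 3w turns the form into 8
  (5s^2 + 3(s - w)^2).\<close>

lemma eight_times_form: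
  fixes u v :: int
  assumes "u\<^sup>2 + 15 * v\<^sup>2 = 8 * q" "odd q" "odd u" "odd v"
  shows "\<exists>x y. q = 5 * x\<^sup>2 + 3 * y\<^sup>2"
proof -
  \<comment> \<open>u^2 - 9v^2 is 8 times this even number; a congruence modulo 16 is needed because
    modulo 8 all odd squares agree.\<close>
  have "even (q - 3 * v\<^sup>2)" using assms by simp
  then obtain c where "q - 3 * v\<^sup>2 = 2 * c" by (rule evenE)
  then have "u\<^sup>2 - 9 * v\<^sup>2 = 16 * c" using assms(1) by linarith
  then have "[u\<^sup>2 = 9 * v\<^sup>2] (mod 16)" by (simp add: cong_iff_dvd_diff)
  then have "((u mod 16)\<^sup>2) mod 16 = (9 * (v mod 16)\<^sup>2) mod 16"
    unfolding cong_def by (simp add: power_mod) (metis mod_mult_right_eq power_mod)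
  moreover have "u mod 16 \<in> {1, 3, 5, 7, 9, 11, 13, 15}" "v mod 16 \<in> {1, 3, 5, 7, 9, 11, 13, 15}"
    using assms(3,4) by (simp, presburger)+
  ultimately have "8 dvd u mod 16 + 3 * (v mod 16) \<or> 8 dvd u mod 16 - 3 * (v mod 16)"
    by (elim insertE) simp_all
  then have "8 dvd u + 3 * v \<or> 8 dvd u + 3 * (- v)" by presburger
  then obtain w where w: "8 dvd u + 3 * w" "w\<^sup>2 = v\<^sup>2" by (metis power2_minus)
  then obtain s where s: "u = 8 * s - 3 * w" by (metis dvdE add_diff_cancel_right')
  have "8 * q = 8 * (5 * s\<^sup>2 + 3 * (s - w)\<^sup>2)"
    unfolding assms(1)[symmetric] w(2)[symmetric] s by (simp add: power2_eq_square algebra_simps)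
  then show ?thesis by (metis mult_cancel_left zero_neq_numeral)
qed

text \<open>Multiplier 2 contradicts parity; 3 and 5 give the form at once, 12 after also removing a
  factor 4, and 8 by \<open>eight_times_form\<close> unless both variables are even.\<close>

lemma prime_eq_5x2_3y2:
  assumes "prime p" "p > 5" "p mod 15 \<in> {2, 8}"
  shows "\<exists>x y :: int. int p = 5 * x\<^sup>2 + 3 * y\<^sup>2"
proof -
  have od: "odd (int p)" using assms(1,2) prime_odd_nat[of p] by simp
  obtain u v k where uv: "u\<^sup>2 + 15 * v\<^sup>2 = k * int p" "k \<in> {1..15}"
    using small_multiple[OF assms(1,2)] assms(3) by auto
  have "k \<in> {2, 3, 5, 8, 12, 15}" using multiplier_mod_15(2)[OF uv assms(3)] .
  then consider "k = 2" | "k = 3" | "k = 5" | "k = 8" | "k = 12" | "k = 15" by auto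
  then show ?thesis
  proof cases
    case 1
    then show ?thesis using form_not_twice_odd[of 1 15 "int p" u v] uv od by simp
  next
    case 2
    obtain a where "u = 3 * a" using prime_dvd_square_plus[OF _ uv(1), of 3] 2 by auto
    then have "int p = 5 * v\<^sup>2 + 3 * a\<^sup>2" using uv(1) 2 by (simp add: power_mult_distrib)
    then show ?thesis by blast
  next
    case 3
    obtain a where "u = 5 * a" using prime_dvd_square_plus[OF _ uv(1), of 5] 3 by auto
    then have "int p = 5 * a\<^sup>2 + 3 * v\<^sup>2" using uv(1) 3 by (simp add: power_mult_distrib)
    then show ?thesis by blast
  next
    case 4
    show ?thesis
    proof (cases "even u")
      case True
      have "even (u\<^sup>2 + 15 * v\<^sup>2)" using uv(1) 4 by simp
      then have "even v" using True by simp
      with True obtain a b where "u = 2 * a" "v = 2 * b" by (auto elim!: evenE)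
      then have "1 * a\<^sup>2 + 15 * b\<^sup>2 = 2 * int p" using uv(1) 4 by (simp add: power_mult_distrib)
      then show ?thesis using form_not_twice_odd[of 1 15 "int p" a b] od by simp
    next
      case False
      have "even (u\<^sup>2 + 15 * v\<^sup>2)" using uv(1) 4 by simp
      then have "odd v" using False by simp
      then show ?thesis using eight_times_form[of u v "int p"] uv(1) 4 od False by simp
    qed
  next
    case 5
    obtain a where "u = 3 * a" using prime_dvd_square_plus[OF _ uv(1), of 3] 5 by auto
    then have "3 * a\<^sup>2 + 5 * v\<^sup>2 = 4 * int p" using uv(1) 5 by (simp add: power_mult_distrib)
    then obtain c d where "3 * c\<^sup>2 + 5 * d\<^sup>2 = int p"
      using form_four_times_odd[of 3 5 "int p" a v] od by auto
    then have "int p = 5 * d\<^sup>2 + 3 * c\<^sup>2" by simp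
    then show ?thesis by blast
  next
    case 6
    obtain a where a: "u = 3 * a" using prime_dvd_square_plus[OF _ uv(1), of 3] 6 by auto
    obtain b where b: "u = 5 * b" using prime_dvd_square_plus[OF _ uv(1), of 5] 6 by auto
    define c where "c = 2 * b - a"
    have "u = 15 * c" using a b by (simp add: c_def)
    then have "int p = v\<^sup>2 + 15 * c\<^sup>2" using uv(1) 6 by (simp add: power_mult_distrib)
    \<comment> \<open>Multiplier 15 is 0 modulo 15 and so passed the residue test; it is excluded
      because 2 and 8 are not squares modulo 15.\<close>
    then have "int p mod 15 = v\<^sup>2 mod 15" by simp
    moreover have "int p mod 15 = int (p mod 15)" by (simp add: zmod_int)
    ultimately show ?thesis using square_mod_15[of v] assms(3) by auto
  qed
qed

text \<open>In both representations x is prime to 3, so 3 divides y, y - x or y + x; the last case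
  becomes the second for the pair (x, -y).\<close>

theorem theorem3p4:
  fixes p :: nat
  assumes "prime p" and "p > 5"
  shows
    "([p = 1] (mod 15) \<or> [p = 4] (mod 15) \<longrightarrow>
        (\<exists>x y :: int. int p = x^2 + 15 * y^2) \<and>
        [2 * (\<Sum>k = 0..p div 6. quot_mod p (int ((6 * k) choose (2 * k))) (27 ^ (2 * k))) - eps p
          = (\<Sum>k = 0..p div 3. quot_mod p (int ((3 * k) choose k)) ((- 27) ^ k))] (mod int p) \<and>
        (\<forall>x y :: int. int p = x^2 + 15 * y^2 \<longrightarrow>
          (3 dvd y \<longrightarrow>
            [(\<Sum>k = 0..p div 3. quot_mod p (int ((3 * k) choose k)) ((- 27) ^ k))
              = 1] (mod int p)) \<and>
          (3 dvd y - x \<longrightarrow>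
            [(\<Sum>k = 0..p div 3. quot_mod p (int ((3 * k) choose k)) ((- 27) ^ k))
              = quot_mod p (x - 5 * y) (10 * y)] (mod int p))))
     \<and>
     ([p = 2] (mod 15) \<or> [p = 8] (mod 15) \<longrightarrow>
        (\<exists>x y :: int. int p = 5 * x^2 + 3 * y^2) \<and>
        [2 * (\<Sum>k = 0..p div 6. quot_mod p (int ((6 * k) choose (2 * k))) (27 ^ (2 * k))) - eps p
          = (\<Sum>k = 0..p div 3. quot_mod p (int ((3 * k) choose k)) ((- 27) ^ k))] (mod int p) \<and>
        (\<forall>x y :: int. int p = 5 * x^2 + 3 * y^2 \<longrightarrow>
          (3 dvd y \<longrightarrow>
            [(\<Sum>k = 0..p div 3. quot_mod p (int ((3 * k) choose k)) ((- 27) ^ k))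
              = 1] (mod int p)) \<and>
          (3 dvd y - x \<longrightarrow>
            [(\<Sum>k = 0..p div 3. quot_mod p (int ((3 * k) choose k)) ((- 27) ^ k))
              = quot_mod p (- (x + y)) (2 * y)] (mod int p))))"
proof -
  let ?S = "\<Sum>k = 0..p div 3. quot_mod p (int ((3 * k) choose k)) ((- 27) ^ k)"
  let ?T = "\<Sum>k = 0..p div 6. quot_mod p (int ((6 * k) choose (2 * k))) (27 ^ (2 * k))"
  let ?F = "int (fib (2 * (p div 3) + 1))"
  have S: "[?S = ?F] (mod int p)" by (rule sum_choose_triple_cong_fib[OF assms])
  have "[2 * ?T - eps p = ?F + eps p - eps p] (mod int p)"
    by (intro cong_diff cong_refl sum_choose_sextuple_cong_fib[OF assms])
  then have TS: "[2 * ?T - eps p = ?S] (mod int p)" using S by (simp add: cong_def)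
  have "\<exists>x y :: int. int p = x^2 + 15 * y^2" if "[p = 1] (mod 15) \<or> [p = 4] (mod 15)"
    using that assms by (intro prime_eq_x2_15y2) (auto simp: cong_def)
  moreover have "\<exists>x y :: int. int p = 5 * x^2 + 3 * y^2" if "[p = 2] (mod 15) \<or> [p = 8] (mod 15)"
    using that assms by (intro prime_eq_5x2_3y2) (auto simp: cong_def)
  moreover have "[?S = 1] (mod int p)" if "int p = x^2 + 15 * y^2" "3 dvd y" for x y
    using cong_trans[OF S fib_cong_x2_15y2(1)[OF assms that]] .
  moreover have "[?S = quot_mod p (x - 5 * y) (10 * y)] (mod int p)"
    if "int p = x^2 + 15 * y^2" "3 dvd y - x" for x y
  proof -
    have "coprime (10 * y) (int p)"
      using coprime_denominator_form(2)[OF assms, of 1 x 15 y] that(1) by simp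
    from quot_mod_cong[OF assms(1) this fib_cong_x2_15y2(2)[OF assms that]]
    show ?thesis using S cong_sym cong_trans by blast
  qed
  moreover have "[?S = 1] (mod int p)" if "int p = 5 * x^2 + 3 * y^2" "3 dvd y" for x y
    using cong_trans[OF S fib_cong_5x2_3y2(1)[OF assms that]] .
  moreover have "[?S = quot_mod p (- (x + y)) (2 * y)] (mod int p)"
    if "int p = 5 * x^2 + 3 * y^2" "3 dvd y - x" for x y
  proof -
    have "coprime 5 (int p)" using coprime_small[OF assms, of 5] by simp
    then have "coprime (2 * y) (int p)" using coprime_denominator_form(1)[OF assms] that(1) by blast
    from quot_mod_cong[OF assms(1) this fib_cong_5x2_3y2(2)[OF assms that]]
    show ?thesis using S cong_sym cong_trans by blast
  qed
  ultimately show ?thesis using TS by blast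
qed

end
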